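(* In $\mathcal{B}[G]$: for all $a,b\in A$ with $a\neq b$ there exist $f\in G$ and $n\in\omega$ such that $f(a)(n)=0$ and $f(b)(n)=1$.
   Context: Let $V$ be a model of $\mathrm{ZFA}$ plus the axiom of choice, with set of atoms $A$, $|A|>\aleph_0$. Let $\mathcal{S}$ be the group of all permutations of $A$, acting on $V$ by $\pi(x)=\{\pi(t)\mid t\in x\}$; $sym(x)=\{\pi\in\mathcal{S}\mid\pi(x)=x\}$; for at most countable $C\subseteq A$, $\mathcal{S}_C$ is the pointwise stabilizer of $C$; $F$ is the filter of subgroups of $\mathcal{S}$ containing some such $\mathcal{S}_C$; $x$ is symmetric iff $sym(x)\in F$; $\mathcal{B}$ is the permutation model of all $x$ whose transitive closure consists of symmetric elements. Working in $\mathcal{B}$: $Q$ is the set of functions $h\colon D\to\{0,1\}$ with $D\subseteq\omega$ finite, $h_0\le_Q h_1$ iff $h_0$ extends $h_1$; $I=\{h\in Q\mid\exists n,\ h(n)=0\}$. For $n\in\omega$ (identified with $\{0,\dots,n-1\}$), $P_n$ is the set of functions $f\colon A\to Q$ in $\mathcal{B}$ with (1) $\mathrm{dom}\,f(a)=n$ for all $a$; (2) $f^{-1}(I)$ at most countable; (3) for each $t\colon n\to\{0,1\}$ infinitely many $a\in A$ satisfy $f(a)=t$. $P=\bigcup_n P_n$, with $f_0\le f_1$ ($f_0$ stronger) iff $f_0(a)\le_Q f_1(a)$ for all $a\in A$. $G$ is a $P$-generic filter over $\mathcal{B}$ and $\mathcal{B}[G]$ is the generic extension. *)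

theory Defs
  imports Main
begin

text \<open>
  Models of set theory with atoms are arbitrary first-order structures: a carrier, a binary
  relation on it, and the element interpreting the set of atoms. They need not be well founded,
  nor full with respect to HOL subsets of the carrier, so that filters which are generic over
  such a model (and external to it) can exist.
\<close>

datatype fm =
    FMem nat nat
  | FEq nat nat
  | FNeg fm
  | FConj fm fm
  | FAll nat fm

text \<open>
  The constant for the set of atoms is not a symbol of the language: the formulas are only used in
  axiom schemas with parameters, where it can be supplied as a parameter.
\<close>

primrec sat :: "'v set \<Rightarrow> ('v \<Rightarrow> 'v \<Rightarrow> bool) \<Rightarrow> fm \<Rightarrow> (nat \<Rightarrow> 'v) \<Rightarrow> bool" where
  "sat M E (FMem i j) e \<longleftrightarrow> E (e i) (e j)"
| "sat M E (FEq i j) e \<longleftrightarrow> e i = e j"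
| "sat M E (FNeg \<phi>) e \<longleftrightarrow> \<not> sat M E \<phi> e"
| "sat M E (FConj \<phi> \<psi>) e \<longleftrightarrow> sat M E \<phi> e \<and> sat M E \<psi> e"
| "sat M E (FAll i \<phi>) e \<longleftrightarrow> (\<forall>x\<in>M. sat M E \<phi> (e(i := x)))"


section \<open>Set-theoretic notions inside a structure\<close>

text \<open>
  Every notion below is the usual one with all quantifiers ranging over the carrier \<open>M\<close>. A HOL set
  of elements of \<open>M\<close> plays the role of a class of the structure.
\<close>

locale membership =
  fixes M :: "'v set"
    and E :: "'v \<Rightarrow> 'v \<Rightarrow> bool"  (infix "\<epsilon>" 50)
    and A :: 'v
begin

definition elts :: "'v \<Rightarrow> 'v set" where
  "elts x = {z \<in> M. z \<epsilon> x}"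

definition is_set :: "'v \<Rightarrow> bool" where
  "is_set x \<longleftrightarrow> x \<in> M \<and> x \<notin> elts A"

text \<open>\<open>codes x X\<close>: the class \<open>X\<close> is a set of the structure, namely \<open>x\<close>.\<close>

definition codes :: "'v \<Rightarrow> 'v set \<Rightarrow> bool" where
  "codes x X \<longleftrightarrow> is_set x \<and> elts x = X"

definition transitive :: "'v \<Rightarrow> bool" where
  "transitive x \<longleftrightarrow> is_set x \<and> (\<forall>y\<in>elts x. elts y \<subseteq> elts x)"

definition is_pair :: "'v \<Rightarrow> 'v \<Rightarrow> 'v \<Rightarrow> bool" where
  "is_pair z x y \<longleftrightarrow> x \<in> M \<and> y \<in> M \<and> (\<exists>u v. codes u {x} \<and> codes v {x, y} \<and> codes z {u, v})"

text \<open>\<open>app f x y\<close> says \<open>f(x) = y\<close>.\<close>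

definition app :: "'v \<Rightarrow> 'v \<Rightarrow> 'v \<Rightarrow> bool" where
  "app f x y \<longleftrightarrow> (\<exists>z\<in>elts f. is_pair z x y)"

definition fn :: "'v \<Rightarrow> 'v \<Rightarrow> 'v set \<Rightarrow> bool" where
  "fn f d X \<longleftrightarrow> is_set f \<and> (\<forall>z\<in>elts f. \<exists>x\<in>elts d. \<exists>y\<in>X. is_pair z x y) \<and>
     (\<forall>x\<in>elts d. \<exists>!y. app f x y)"

definition injective :: "'v \<Rightarrow> bool" where
  "injective f \<longleftrightarrow> (\<forall>x x' y. app f x y \<and> app f x' y \<longrightarrow> x = x')"

definition bijection :: "'v \<Rightarrow> 'v \<Rightarrow> 'v \<Rightarrow> bool" where
  "bijection f x y \<longleftrightarrow> fn f x (elts y) \<and> injective f \<and> (\<forall>v\<in>elts y. \<exists>u\<in>elts x. app f u v)"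

definition is_zero :: "'v \<Rightarrow> bool" where
  "is_zero x \<longleftrightarrow> codes x {}"

definition is_succ :: "'v \<Rightarrow> 'v \<Rightarrow> bool" where
  "is_succ y x \<longleftrightarrow> x \<in> M \<and> codes y (insert x (elts x))"

definition is_one :: "'v \<Rightarrow> bool" where
  "is_one y \<longleftrightarrow> (\<exists>x. is_zero x \<and> is_succ y x)"

text \<open>
  Under the axiom of foundation, the ordinals are the transitive sets of transitive sets, and the
  natural numbers are the ordinals \<open>n\<close> such that each \<open>m \<le> n\<close> is zero or a successor.
\<close>

definition is_ord :: "'v \<Rightarrow> bool" where
  "is_ord x \<longleftrightarrow> transitive x \<and> (\<forall>y\<in>elts x. transitive y)"

definition \<omega> :: "'v set" where
  "\<omega> = {n. is_ord n \<and> (\<forall>m\<in>insert n (elts n). is_zero m \<or> (\<exists>k. is_succ m k))}"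

definition is_finite :: "'v \<Rightarrow> bool" where
  "is_finite x \<longleftrightarrow> (\<exists>n\<in>\<omega>. \<exists>f. bijection f x n)"

text \<open>At most countable.\<close>

definition is_countable :: "'v \<Rightarrow> bool" where
  "is_countable x \<longleftrightarrow> (\<exists>f. fn f x \<omega> \<and> injective f)"

text \<open>\<open>is_trancl x T\<close>: \<open>T\<close> is the least transitive set having \<open>x\<close> itself as an element.\<close>

definition is_trancl :: "'v \<Rightarrow> 'v \<Rightarrow> bool" where
  "is_trancl x T \<longleftrightarrow> transitive T \<and> x \<in> elts T \<and>
     (\<forall>U. transitive U \<and> x \<in> elts U \<longrightarrow> elts T \<subseteq> elts U)"


section \<open>The permutation model\<close>

definition perms :: "'v set" where
  "perms = {\<pi>. bijection \<pi> A A}"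

text \<open>
  \<open>acts \<pi> x y\<close> says \<open>\<pi>(x) = y\<close> for the extension of \<open>\<pi>\<close> to the universe. As usual for a definition by
  recursion on membership, the value is read off from a set function \<open>g\<close> that satisfies the recursion
  equation on a transitive domain containing \<open>x\<close>.
\<close>

definition acts :: "'v \<Rightarrow> 'v \<Rightarrow> 'v \<Rightarrow> bool" where
  "acts \<pi> x y \<longleftrightarrow> (\<exists>T g. transitive T \<and> x \<in> elts T \<and> fn g T M \<and> app g x y \<and>
     (\<forall>t\<in>elts T. \<forall>u. app g t u \<longrightarrow>
        (if t \<in> elts A then app \<pi> t u else codes u {w. \<exists>s\<in>elts t. app g s w})))"

definition symm :: "'v \<Rightarrow> 'v set" where
  "symm x = {\<pi> \<in> perms. acts \<pi> x x}"

definition pointwise_stabilizer :: "'v \<Rightarrow> 'v set" where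
  "pointwise_stabilizer C = {\<pi> \<in> perms. \<forall>c\<in>elts C. app \<pi> c c}"

definition perm_subgroup :: "'v set \<Rightarrow> bool" where
  "perm_subgroup H \<longleftrightarrow> (\<exists>h. codes h H) \<and> H \<subseteq> perms \<and>
     (\<forall>\<iota>\<in>perms. (\<forall>a\<in>elts A. app \<iota> a a) \<longrightarrow> \<iota> \<in> H) \<and>
     (\<forall>\<pi>\<in>H. \<forall>\<sigma>\<in>H. \<forall>\<rho>\<in>perms.
        (\<forall>a b c. app \<sigma> a b \<and> app \<pi> b c \<longrightarrow> app \<rho> a c) \<longrightarrow> \<rho> \<in> H) \<and>
     (\<forall>\<pi>\<in>H. \<forall>\<rho>\<in>perms. (\<forall>a b. app \<pi> a b \<longrightarrow> app \<rho> b a) \<longrightarrow> \<rho> \<in> H)"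

definition perm_filter :: "'v set set" where
  "perm_filter = {H. perm_subgroup H \<and>
     (\<exists>C. is_set C \<and> elts C \<subseteq> elts A \<and> is_countable C \<and> pointwise_stabilizer C \<subseteq> H)}"

definition symmetric :: "'v \<Rightarrow> bool" where
  "symmetric x \<longleftrightarrow> symm x \<in> perm_filter"

definition perm_model :: "'v set" where
  "perm_model = {x \<in> M. \<exists>T. is_trancl x T \<and> (\<forall>t\<in>elts T. symmetric t)}"


section \<open>The forcing notion\<close>

definition bits :: "'v set" where
  "bits = {b. is_zero b \<or> is_one b}"

definition Q :: "'v set" where
  "Q = {h. \<exists>d. is_set d \<and> elts d \<subseteq> \<omega> \<and> is_finite d \<and> fn h d bits}"

definition le_Q :: "'v \<Rightarrow> 'v \<Rightarrow> bool" where
  "le_Q h0 h1 \<longleftrightarrow> elts h1 \<subseteq> elts h0"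

definition I :: "'v set" where
  "I = {h \<in> Q. \<exists>n\<in>\<omega>. \<exists>z. is_zero z \<and> app h n z}"

definition P_level :: "'v \<Rightarrow> 'v set" where
  "P_level n = {f. fn f A Q \<and>
     (\<forall>a h. app f a h \<longrightarrow> fn h n bits) \<and>
     (\<exists>c. codes c {a \<in> elts A. \<exists>h\<in>I. app f a h} \<and> is_countable c) \<and>
     (\<forall>t. fn t n bits \<longrightarrow> (\<exists>s. codes s {a \<in> elts A. app f a t} \<and> \<not> is_finite s))}"

definition P :: "'v set" where
  "P = (\<Union>n\<in>\<omega>. P_level n)"

definition le_P :: "'v \<Rightarrow> 'v \<Rightarrow> bool" where
  "le_P f0 f1 \<longleftrightarrow> (\<forall>a\<in>elts A. \<forall>h0 h1. app f0 a h0 \<and> app f1 a h1 \<longrightarrow> le_Q h0 h1)"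

end


section \<open>ZFA with the axiom of choice\<close>

text \<open>
  Separation and replacement are first-order schemas with parameters, supplied by the values of \<open>e\<close>
  at the remaining variables.
\<close>

locale zfa_choice = membership +
  assumes atom_set: "A \<in> M"
    and atoms_empty: "\<And>a. a \<in> elts A \<Longrightarrow> elts a = {}"
    and empty_set: "\<exists>z. codes z {}"
    and extensionality: "\<And>x y. is_set x \<Longrightarrow> is_set y \<Longrightarrow> elts x = elts y \<Longrightarrow> x = y"
    and pairing: "\<And>x y. x \<in> M \<Longrightarrow> y \<in> M \<Longrightarrow> \<exists>z. codes z {x, y}"
    and union: "\<And>x. x \<in> M \<Longrightarrow> \<exists>z. codes z (\<Union>y\<in>elts x. elts y)"
    and powerset: "\<And>x. is_set x \<Longrightarrow> \<exists>z. codes z {y. is_set y \<and> elts y \<subseteq> elts x}"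
    and infinity: "\<exists>w. is_set w \<and> (\<forall>z. is_zero z \<longrightarrow> z \<in> elts w) \<and>
                       (\<forall>x\<in>elts w. \<forall>y. is_succ y x \<longrightarrow> y \<in> elts w)"
    and foundation: "\<And>x. x \<in> M \<Longrightarrow> elts x \<noteq> {} \<Longrightarrow> \<exists>y\<in>elts x. elts y \<inter> elts x = {}"
    and separation: "\<And>\<phi> e x. range e \<subseteq> M \<Longrightarrow> x \<in> M \<Longrightarrow>
                       \<exists>z. codes z {u \<in> elts x. sat M E \<phi> (e(0 := u))}"
    and replacement: "\<And>\<phi> e x. range e \<subseteq> M \<Longrightarrow> x \<in> M \<Longrightarrow>
                       (\<forall>u\<in>M. \<forall>v\<in>M. \<forall>w\<in>M. sat M E \<phi> (e(0 := u, 1 := v)) \<longrightarrow>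
                          sat M E \<phi> (e(0 := u, 1 := w)) \<longrightarrow> v = w) \<Longrightarrow>
                       \<exists>z. codes z {v \<in> M. \<exists>u\<in>elts x. sat M E \<phi> (e(0 := u, 1 := v))}"
    and choice: "\<And>x. is_set x \<Longrightarrow> (\<forall>y\<in>elts x. elts y \<noteq> {}) \<Longrightarrow>
                       \<exists>f. fn f x M \<and> (\<forall>y\<in>elts x. \<exists>z\<in>elts y. app f y z)"


section \<open>Generic filters and generic extensions\<close>

locale forcing = membership +
  fixes \<P> :: "'a set"
    and le :: "'a \<Rightarrow> 'a \<Rightarrow> bool"  (infix "\<preceq>" 50)
begin

definition dense :: "'a \<Rightarrow> bool" where
  "dense D \<longleftrightarrow> is_set D \<and> elts D \<subseteq> \<P> \<and> (\<forall>p\<in>\<P>. \<exists>q\<in>elts D. q \<preceq> p)"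

definition is_filter :: "'a set \<Rightarrow> bool" where
  "is_filter G \<longleftrightarrow> G \<subseteq> \<P> \<and> G \<noteq> {} \<and>
     (\<forall>p\<in>G. \<forall>q\<in>\<P>. p \<preceq> q \<longrightarrow> q \<in> G) \<and>
     (\<forall>p\<in>G. \<forall>q\<in>G. \<exists>r\<in>G. r \<preceq> p \<and> r \<preceq> q)"

text \<open>The filter \<open>G\<close> is an external set; only the dense sets belong to the ground model.\<close>

definition generic :: "'a set \<Rightarrow> bool" where
  "generic G \<longleftrightarrow> is_filter G \<and> (\<forall>D. dense D \<longrightarrow> G \<inter> elts D \<noteq> {})"

text \<open>
  Names are atoms (naming themselves) and sets of pairs of a name and a condition. The recursion is
  unfolded by means of a set \<open>T\<close> of names containing \<open>\<tau>\<close>, all names occurring in \<open>\<tau>\<close>, and so on.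
\<close>

definition is_name :: "'a \<Rightarrow> bool" where
  "is_name \<tau> \<longleftrightarrow> (\<exists>T. is_set T \<and> \<tau> \<in> elts T \<and>
     (\<forall>\<sigma>\<in>elts T. \<sigma> \<in> elts A \<or> (\<forall>z\<in>elts \<sigma>. \<exists>\<rho>\<in>elts T. \<exists>p\<in>\<P>. is_pair z \<rho> p)))"

definition is_top :: "'a \<Rightarrow> bool" where
  "is_top u \<longleftrightarrow> u \<in> \<P> \<and> (\<forall>p\<in>\<P>. p \<preceq> u)"

text \<open>
  \<open>is_check x y\<close>: \<open>y\<close> is the canonical name of \<open>x\<close>, where an atom is its own canonical name and that
  of a set \<open>x\<close> consists of the pairs of the canonical name of an element of \<open>x\<close> and the weakest
  condition. The recursion is rendered as in \<open>acts\<close>.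
\<close>

definition is_check :: "'a \<Rightarrow> 'a \<Rightarrow> bool" where
  "is_check x y \<longleftrightarrow> (\<exists>u T g. is_top u \<and> transitive T \<and> x \<in> elts T \<and> fn g T M \<and> app g x y \<and>
     (\<forall>t\<in>elts T. \<forall>v. app g t v \<longrightarrow>
        (if t \<in> elts A then v = t
         else codes v {z. \<exists>s\<in>elts t. \<exists>w. app g s w \<and> is_pair z w u})))"

text \<open>
  The structure \<open>(N, EN, AN)\<close> is the generic extension by \<open>G\<close>, and \<open>val\<close> is the evaluation of names:
  \<open>N\<close> consists of the values of the names, atoms are evaluated to distinct atoms, and a name which is
  a set is evaluated to the set of the values of those \<open>\<sigma>\<close> which are paired in it with some \<open>p\<close> in \<open>G\<close>.
  Over a well-founded ground model this determines \<open>(N, EN, AN)\<close> up to isomorphism. Over an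
  ill-founded one, where evaluation cannot be defined by recursion, it is satisfied by the
  structure of names modulo forced equality.
\<close>

definition generic_extension ::
  "'a set \<Rightarrow> 'w set \<Rightarrow> ('w \<Rightarrow> 'w \<Rightarrow> bool) \<Rightarrow> 'w \<Rightarrow> ('a \<Rightarrow> 'w) \<Rightarrow> bool" where
  "generic_extension G N EN AN val \<longleftrightarrow>
     N = val ` {\<tau>. is_name \<tau>} \<and>
     membership.is_set N EN AN AN \<and>
     (\<forall>x y. membership.is_set N EN AN x \<and> membership.is_set N EN AN y \<and>
        membership.elts N EN x = membership.elts N EN y \<longrightarrow> x = y) \<and>
     inj_on val (elts A) \<and>
     (\<forall>a\<in>elts A. val a \<in> membership.elts N EN AN \<and> membership.elts N EN (val a) = {}) \<and>
     (\<forall>\<tau>. is_name \<tau> \<and> is_set \<tau> \<longrightarrow>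
        membership.codes N EN AN (val \<tau>) {val \<sigma> | \<sigma> z p. z \<in> elts \<tau> \<and> is_pair z \<sigma> p \<and> p \<in> G})"

text \<open>The element of a generic extension corresponding to the set \<open>G\<close> of elements of the ground model.\<close>

definition is_generic_object ::
  "'a set \<Rightarrow> 'w set \<Rightarrow> ('w \<Rightarrow> 'w \<Rightarrow> bool) \<Rightarrow> 'w \<Rightarrow> ('a \<Rightarrow> 'w) \<Rightarrow> 'w \<Rightarrow> bool" where
  "is_generic_object G N EN AN val g \<longleftrightarrow>
     membership.codes N EN AN g {val y | p y. p \<in> G \<and> is_check p y}"

end

end

theory Submission
  imports Defs
begin

text \<open>
  The conditions \<open>q\<close> for which some \<open>n\<close> satisfies \<open>q(a)(n) = 0\<close> and \<open>q(b)(n) = 1\<close> form a dense set in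
  the permutation model, and the evaluation of canonical names transports such a \<open>q\<close> in \<open>G\<close> to the
  extension.

  Density: let \<open>f\<close> be a condition with domain \<open>n\<close>. Working in the full universe, with choice, each of the
  infinite fibres of \<open>f\<close> contains a countable infinite set whose complement in the fibre is infinite.
  All fibres but that of the constant function \<open>1\<close> consist of points of the countable set \<open>f\<^sup>-\<^sup>1(I)\<close>, so the
  union \<open>S\<close> of these sets is countable, and \<open>a \<in> S\<close>, \<open>b \<notin> S\<close> can be arranged by a finite change. Put
  \<open>f'(c)(n) = 0\<close> if \<open>c \<in> S\<close> and \<open>1\<close> otherwise. Since \<open>S\<close> is a countable set of atoms, it supports itself,
  so \<open>S\<close>, and with it \<open>f'\<close>, belongs to the permutation model.

  Membership in the permutation model comes from one principle: permutations of the atoms act as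
  automorphisms of the universe, hence preserve every first-order definable relation whose parameters
  they fix. So a set of elements of the permutation model which is definable from finitely many
  elements of the model has a countable support and belongs to the model.
\<close>

section \<open>Definable relations\<close>

text \<open>The universe is an arbitrary first-order structure, possibly ill-founded and with few of
  the HOL subsets of its carrier. Separation, replacement, induction and recursion are therefore
  available for first-order definable classes only, and each use of them is paid for by a
  definability proof. This is why a calculus of definability comes first; it serves both the axiom
  schemas and the automorphism argument.

  Choice is at hand in the universe and not to be expected in the permutation model, so the parts of
  the fibres are chosen outside and brought back by their support. The conditions, however, are
  those which the model itself recognises; finiteness and countability of its sets of atoms mean the
  same in both structures because an enumeration of a countable set of atoms is supported by that
  set.

  No forcing theorem is involved: whether \<open>q\<close> separates \<open>a\<close> and
  \<open>b\<close> is settled in the ground model, and the canonical embedding preserves the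
  positive facts concerned. Uncountability of \<open>A\<close> enters through the weakest condition,
  on which canonical names rest: its only fibre is all of \<open>A\<close>, which must be
  infinite.\<close>

text \<open>
  \<open>Def M E K R\<close>: the relation \<open>R\<close> is first-order definable in \<open>(M, E)\<close> with parameters in \<open>K\<close>. An
  environment \<open>e\<close> assigns values to de Bruijn variables, so that binding a variable is \<open>case_nat\<close>; this
  lets the closure rules below be applied by unification to ordinary HOL formulas.
\<close>

inductive Def :: "'v set \<Rightarrow> ('v \<Rightarrow> 'v \<Rightarrow> bool) \<Rightarrow> 'v set \<Rightarrow> ((nat \<Rightarrow> 'v) \<Rightarrow> bool) \<Rightarrow> bool"
  for M :: "'v set" and E :: "'v \<Rightarrow> 'v \<Rightarrow> bool" and K :: "'v set" where
  mem: "Def M E K (\<lambda>e. E (e i) (e j))"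
| eq: "Def M E K (\<lambda>e. e i = e j)"
| neg: "Def M E K P \<Longrightarrow> Def M E K (\<lambda>e. \<not> P e)"
| conj: "Def M E K P \<Longrightarrow> Def M E K Q \<Longrightarrow> Def M E K (\<lambda>e. P e \<and> Q e)"
| all: "Def M E K P \<Longrightarrow> Def M E K (\<lambda>e. \<forall>x\<in>M. P (case_nat x e))"
| par: "c \<in> K \<Longrightarrow> Def M E K P \<Longrightarrow> Def M E K (\<lambda>e. P (case_nat c e))"
| cong: "Def M E K P \<Longrightarrow> (\<And>e. range e \<subseteq> M \<Longrightarrow> Q e = P e) \<Longrightarrow> Def M E K Q"

lemma Def_mono: "Def M E K P \<Longrightarrow> K \<subseteq> K' \<Longrightarrow> Def M E K' P"
proof (induction rule: Def.induct)
  case (cong P Q)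
  then show ?case by (intro Def.cong[of M E K' P Q])
next
  case (par c P)
  then show ?case by (intro Def.par[of c K' M E P]) auto
next
  case (all P)
  then show ?case by (intro Def.all)
qed (assumption | rule Def.mem Def.eq Def.neg Def.conj)+

text \<open>A derivation mentions finitely many parameters, so they can be listed in the environment
  of a single formula.\<close>

lemma Def_finite_parameters:
  "Def M E K P \<Longrightarrow> \<exists>F. finite F \<and> F \<subseteq> K \<and> Def M E F P"
proof (induction rule: Def.induct)
  case (conj P Q)
  then obtain F G where "finite F" "F \<subseteq> K" "Def M E F P" "finite G" "G \<subseteq> K" "Def M E G Q"
    by blast
  then show ?case
    by (intro exI[of _ "F \<union> G"] conjI Def.conj) (auto elim: Def_mono)
next
  case (par c P)
  then obtain F where "finite F" "F \<subseteq> K" "Def M E F P" by blast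
  with par show ?case
    by (intro exI[of _ "insert c F"] conjI Def.par) (auto elim: Def_mono)
next
  case (cong P Q)
  then obtain F where "finite F" "F \<subseteq> K" "Def M E F P" by blast
  with cong.hyps show ?case by (intro exI[of _ F] conjI Def.cong[of M E F P Q])
next
  case (neg P)
  then obtain F where "finite F" "F \<subseteq> K" "Def M E F P" by blast
  then show ?case by (intro exI[of _ F]) (blast intro: Def.neg[of M E F P])
next
  case (all P)
  then obtain F where "finite F" "F \<subseteq> K" "Def M E F P" by blast
  then show ?case by (intro exI[of _ F]) (blast intro: Def.all[of M E F P])
next
  case (mem i j)
  then show ?case by (intro exI[of _ "{}"] conjI Def.mem) auto
next
  case (eq i j)
  then show ?case by (intro exI[of _ "{}"] conjI Def.eq) auto
qed

lemma range_case_nat_eq: "range (case_nat x e) = insert x (range e)"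
proof -
  have "(UNIV :: nat set) = insert 0 (range Suc)" using not0_implies_Suc by (auto simp: image_iff)
  then have "range (case_nat x e) = case_nat x e ` insert 0 (range Suc)" by simp
  then show ?thesis by (simp only: image_insert image_image) simp
qed

lemma range_case_nat: "x \<in> M \<Longrightarrow> range e \<subseteq> M \<Longrightarrow> range (case_nat x e) \<subseteq> M"
  by (simp add: range_case_nat_eq)

text \<open>Covers weakening and permutation of variables. Under a binder the renaming is lifted to
  \<open>case_nat 0 (Suc \<circ> r)\<close>, which leaves the bound variable alone.\<close>

lemma Def_rename: "Def M E K P \<Longrightarrow> Def M E K (\<lambda>e. P (e \<circ> r))"
proof (induction arbitrary: r rule: Def.induct)
  case (all P)
  let ?r = "case_nat 0 (Suc \<circ> r)"
  have "case_nat x e \<circ> ?r = case_nat x (e \<circ> r)" for x and e :: "nat \<Rightarrow> 'a"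
    by (auto simp: fun_eq_iff split: nat.splits)
  with Def.all[OF all.IH[of ?r]] show ?case by (simp only:)
next
  case (par c P)
  let ?r = "case_nat 0 (Suc \<circ> r)"
  have "case_nat x e \<circ> ?r = case_nat x (e \<circ> r)" for x and e :: "nat \<Rightarrow> 'a"
    by (auto simp: fun_eq_iff split: nat.splits)
  with Def.par[OF par.hyps(1) par.IH[of ?r]] show ?case by (simp only:)
next
  case (cong P Q)
  show ?case
    by (rule Def.cong[OF cong.IH[of r]]) (rule cong.hyps(2), auto)
next
  case (mem i j)
  show ?case using Def.mem[of M E K "r i" "r j"] by (simp only: comp_apply)
next
  case (eq i j)
  show ?case using Def.eq[of M E K "r i" "r j"] by (simp only: comp_apply)
next
  case (neg P)
  show ?case by (rule Def.neg[OF neg.IH])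
next
  case (conj P Q)
  show ?case by (rule Def.conj[OF conj.IH])
qed

text \<open>The variable \<open>i\<close> of \<open>P\<close> is rendered as the variable \<open>r i\<close> of the formula, and the parameter
  \<open>c j\<close> is supplied at the variable \<open>q j\<close>; the infinitely many other variables can be bound.\<close>

lemma Def_sat:
  assumes "Def M E (range c) P" "infinite (- (range r \<union> range q))"
  shows "\<exists>\<phi>. \<forall>\<rho>. range \<rho> \<subseteq> M \<longrightarrow> (\<forall>j. \<rho> (q j) = c j) \<longrightarrow> sat M E \<phi> \<rho> = P (\<rho> \<circ> r)"
  using assms
proof (induction arbitrary: r rule: Def.induct)
  case (mem i j)
  show ?case by (rule exI[of _ "FMem (r i) (r j)"]) simp
next
  case (eq i j)
  show ?case by (rule exI[of _ "FEq (r i) (r j)"]) simp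
next
  case (neg P)
  then obtain \<phi> where "\<forall>\<rho>. range \<rho> \<subseteq> M \<longrightarrow> (\<forall>j. \<rho> (q j) = c j) \<longrightarrow> sat M E \<phi> \<rho> = P (\<rho> \<circ> r)"
    by blast
  then have "\<forall>\<rho>. range \<rho> \<subseteq> M \<longrightarrow> (\<forall>j. \<rho> (q j) = c j) \<longrightarrow> sat M E (FNeg \<phi>) \<rho> = (\<not> P (\<rho> \<circ> r))"
    by (metis sat.simps(3))
  then show ?case by blast
next
  case (conj P Q)
  then obtain \<phi> \<psi> where "\<forall>\<rho>. range \<rho> \<subseteq> M \<longrightarrow> (\<forall>j. \<rho> (q j) = c j) \<longrightarrow> sat M E \<phi> \<rho> = P (\<rho> \<circ> r)"
    "\<forall>\<rho>. range \<rho> \<subseteq> M \<longrightarrow> (\<forall>j. \<rho> (q j) = c j) \<longrightarrow> sat M E \<psi> \<rho> = Q (\<rho> \<circ> r)"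
    by metis
  then have "\<forall>\<rho>. range \<rho> \<subseteq> M \<longrightarrow> (\<forall>j. \<rho> (q j) = c j) \<longrightarrow>
      sat M E (FConj \<phi> \<psi>) \<rho> = (P (\<rho> \<circ> r) \<and> Q (\<rho> \<circ> r))"
    by (metis sat.simps(4))
  then show ?case by blast
next
  case (all P)
  \<comment> \<open>Taking one variable from the infinite supply leaves it infinite, so nested
    quantifiers never run out of fresh variables.\<close>
  then obtain m where m: "m \<notin> range r \<union> range q"
    by (metis ComplD all_not_in_conv finite.emptyI)
  let ?r = "case_nat m r"
  have "- (range ?r \<union> range q) = - (range r \<union> range q) - {m}"
    by (auto simp: range_case_nat_eq)
  then have "infinite (- (range ?r \<union> range q))" using all.prems by simp
  then obtain \<phi> where \<phi>: "\<forall>\<rho>. range \<rho> \<subseteq> M \<longrightarrow> (\<forall>j. \<rho> (q j) = c j) \<longrightarrow> sat M E \<phi> \<rho> = P (\<rho> \<circ> ?r)"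
    using all.IH by blast
  have "sat M E (FAll m \<phi>) \<rho> = (\<forall>x\<in>M. P (case_nat x (\<rho> \<circ> r)))"
    if \<rho>: "range \<rho> \<subseteq> M" "\<forall>j. \<rho> (q j) = c j" for \<rho>
  proof -
    have "sat M E \<phi> (\<rho>(m := x)) = P (case_nat x (\<rho> \<circ> r))" if "x \<in> M" for x
    proof -
      have "\<rho>(m := x) \<circ> ?r = case_nat x (\<rho> \<circ> r)"
        using m by (auto simp: fun_eq_iff split: nat.splits)
      moreover have "range (\<rho>(m := x)) \<subseteq> M" using \<rho>(1) that by auto
      moreover have "\<forall>j. (\<rho>(m := x)) (q j) = c j" using m \<rho>(2) by auto
      ultimately show ?thesis using \<phi> by metis
    qed
    then show ?thesis by simp
  qed
  then show ?case by blast
next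
  case (par d P)
  then obtain j where j: "d = c j" by blast
  \<comment> \<open>The bound variable is read at the place where the environment already holds the
    parameter.\<close>
  let ?r = "case_nat (q j) r"
  have "range ?r \<union> range q = range r \<union> range q"
    by (auto simp: range_case_nat_eq)
  then have "infinite (- (range ?r \<union> range q))" using par.prems by simp
  then obtain \<phi> where \<phi>: "\<forall>\<rho>. range \<rho> \<subseteq> M \<longrightarrow> (\<forall>j. \<rho> (q j) = c j) \<longrightarrow> sat M E \<phi> \<rho> = P (\<rho> \<circ> ?r)"
    using par.IH by blast
  have "\<rho> \<circ> ?r = case_nat d (\<rho> \<circ> r)" if "\<forall>j. \<rho> (q j) = c j" for \<rho>
    using that j by (auto simp: fun_eq_iff split: nat.splits)
  with \<phi> show ?case by metis
next
  case (cong P Q)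
  then obtain \<phi> where "\<forall>\<rho>. range \<rho> \<subseteq> M \<longrightarrow> (\<forall>j. \<rho> (q j) = c j) \<longrightarrow> sat M E \<phi> \<rho> = P (\<rho> \<circ> r)"
    by blast
  moreover have "Q (\<rho> \<circ> r) = P (\<rho> \<circ> r)" if "range \<rho> \<subseteq> M" for \<rho>
    by (rule cong.hyps) (use that in auto)
  ultimately show ?case by metis
qed

text \<open>By induction on the derivation: equality needs that \<open>\<iota>\<close> is injective,
  the quantifier that it maps onto \<open>M\<close>, and a parameter has to be a fixed
  point.\<close>

lemma Def_invariant:
  assumes "Def M E K P" "bij_betw \<iota> M M" "\<And>x y. x \<in> M \<Longrightarrow> y \<in> M \<Longrightarrow> E (\<iota> x) (\<iota> y) = E x y"
    "\<And>c. c \<in> K \<Longrightarrow> \<iota> c = c" "range e \<subseteq> M" "K \<subseteq> M"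
  shows "P (\<iota> \<circ> e) = P e"
  using assms(1,5)
proof (induction arbitrary: e rule: Def.induct)
  case (mem i j)
  then show ?case using assms(3) by (simp add: range_subsetD)
next
  case (eq i j)
  then have "e i \<in> M" "e j \<in> M" by auto
  then show ?case using assms(2) by (auto simp: bij_betw_def inj_on_def)
next
  case (all P)
  have *: "case_nat (\<iota> x) (\<iota> \<circ> e) = \<iota> \<circ> case_nat x e" for x
    by (auto simp: fun_eq_iff split: nat.splits)
  have "(\<forall>x\<in>M. P (case_nat x (\<iota> \<circ> e))) = (\<forall>x\<in>\<iota> ` M. P (case_nat x (\<iota> \<circ> e)))"
    using assms(2) by (simp add: bij_betw_def)
  also have "\<dots> = (\<forall>x\<in>M. P (\<iota> \<circ> case_nat x e))" by (simp add: *)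
  also have "\<dots> = (\<forall>x\<in>M. P (case_nat x e))"
    by (intro ball_cong refl all.IH range_case_nat all.prems)
  finally show ?case .
next
  case (par c P)
  have *: "case_nat (\<iota> x) (\<iota> \<circ> e) = \<iota> \<circ> case_nat x e" for x
    by (auto simp: fun_eq_iff split: nat.splits)
  have "P (case_nat c (\<iota> \<circ> e)) = P (\<iota> \<circ> case_nat c e)" using *[of c] assms(4) par.hyps by simp
  also have "\<dots> = P (case_nat c e)"
    using par.hyps assms(6) by (intro par.IH range_case_nat par.prems) auto
  finally show ?case .
next
  case (cong P Q)
  have "range (\<iota> \<circ> e) \<subseteq> M" using cong.prems assms(2) by (auto simp: bij_betw_def)
  with cong show ?case by simp
qed auto

section \<open>Definable terms and closure rules for definability\<close>

text \<open>Terms whose graph is definable. Only environments with values in \<open>M\<close> matter.\<close>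

definition DT :: "'v set \<Rightarrow> ('v \<Rightarrow> 'v \<Rightarrow> bool) \<Rightarrow> 'v set \<Rightarrow> ((nat \<Rightarrow> 'v) \<Rightarrow> 'v) \<Rightarrow> bool" where
  "DT M E K t \<longleftrightarrow> (\<forall>e. range e \<subseteq> M \<longrightarrow> t e \<in> M) \<and> Def M E K (\<lambda>e. e 0 = t (\<lambda>i. e (Suc i)))"

named_theorems def_intros

text \<open>A binder makes its object variable 0 and shifts the old environment. With the premise in
  the form \<open>P (e 0) (\<lambda>i. e (Suc i))\<close>, a pattern for unification, the rule can
  be applied backwards to any HOL formula.\<close>

lemma Def_all [def_intros]:
  assumes "Def M E K (\<lambda>e. P (e 0) (\<lambda>i. e (Suc i)))"
  shows "Def M E K (\<lambda>e. \<forall>x\<in>M. P x e)"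
  using Def.all[OF assms] by simp

lemmas Def_not [def_intros] = Def.neg
lemmas Def_conj [def_intros] = Def.conj

lemma Def_disj [def_intros]:
  assumes "Def M E K P" "Def M E K Q" shows "Def M E K (\<lambda>e. P e \<or> Q e)"
proof -
  have "Def M E K (\<lambda>e. \<not> (\<not> P e \<and> \<not> Q e))" by (intro Def.neg Def.conj assms)
  then show ?thesis by (simp only: de_Morgan_conj not_not)
qed

lemma Def_imp [def_intros]:
  assumes "Def M E K P" "Def M E K Q" shows "Def M E K (\<lambda>e. P e \<longrightarrow> Q e)"
  unfolding imp_conv_disj by (intro Def_disj Def_not assms)

lemma Def_iff [def_intros]:
  assumes "Def M E K P" "Def M E K Q" shows "Def M E K (\<lambda>e. P e \<longleftrightarrow> Q e)"
  unfolding iff_conv_conj_imp by (intro Def_imp Def_conj assms)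

lemma Def_if [def_intros]:
  assumes "Def M E K P" "Def M E K Q" "Def M E K R"
  shows "Def M E K (\<lambda>e. if P e then Q e else R e)"
  unfolding if_bool_eq_conj by (intro Def_imp Def_conj Def_not assms)

lemma Def_True: "Def M E K (\<lambda>e. True)"
  by (rule Def.cong[OF Def.eq[of M E K 0 0]]) simp

lemma Def_const [def_intros]: "Def M E K (\<lambda>e. b)"
proof (cases b)
  case False
  show ?thesis by (rule Def.cong[OF Def_not[OF Def_True]]) (simp add: False)
qed (simp add: Def_True)

lemma Def_ex [def_intros]:
  assumes "Def M E K (\<lambda>e. P (e 0) (\<lambda>i. e (Suc i)))"
  shows "Def M E K (\<lambda>e. \<exists>x\<in>M. P x e)"
proof -
  have "Def M E K (\<lambda>e. \<not> (\<forall>x\<in>M. \<not> P x e))" by (intro Def_not Def_all assms)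
  then show ?thesis by (simp only: ball_simps not_not)
qed

lemma shift_range: "range e \<subseteq> M \<Longrightarrow> range (\<lambda>i. e (Suc i)) \<subseteq> M"
  by auto

text \<open>The bounding class may depend on the environment; since it lies in \<open>M\<close>, the
  bounded quantifier is expressed by a quantifier of the structure.\<close>

lemma Def_Ball [def_intros]:
  assumes "Def M E K (\<lambda>e. e 0 \<in> S (\<lambda>i. e (Suc i)))" "Def M E K (\<lambda>e. P (e 0) (\<lambda>i. e (Suc i)))"
    "\<And>e. range e \<subseteq> M \<Longrightarrow> S e \<subseteq> M"
  shows "Def M E K (\<lambda>e. \<forall>x\<in>S e. P x e)"
  by (rule Def.cong[OF Def_all[OF Def_imp[OF assms(1,2)]]]) (use assms(3) in fastforce)

lemma Def_Bex [def_intros]: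
  assumes "Def M E K (\<lambda>e. e 0 \<in> S (\<lambda>i. e (Suc i)))" "Def M E K (\<lambda>e. P (e 0) (\<lambda>i. e (Suc i)))"
    "\<And>e. range e \<subseteq> M \<Longrightarrow> S e \<subseteq> M"
  shows "Def M E K (\<lambda>e. \<exists>x\<in>S e. P x e)"
  by (rule Def.cong[OF Def_ex[OF Def_conj[OF assms(1,2)]]]) (use assms(3) in fastforce)

lemma Def_Bex_class:
  assumes "Def M E K (\<lambda>e. e 0 \<in> W)" "Def M E K (\<lambda>e. P (e 0) (\<lambda>i. e (Suc i)))" "W \<subseteq> M"
  shows "Def M E K (\<lambda>e. \<exists>x\<in>W. P x e)"
  by (rule Def_Bex[where S="\<lambda>_. W"]) (use assms in auto)

text \<open>Substitution goes through the graph of the term: its value is introduced by a quantifier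
  and then identified.\<close>

lemma Def_subst:
  assumes "Def M E K (\<lambda>e. P (e 0) (\<lambda>i. e (Suc i)))" "DT M E K t"
  shows "Def M E K (\<lambda>e. P (t e) e)"
proof -
  have "Def M E K (\<lambda>e. \<exists>x\<in>M. x = t e \<and> P x e)"
    using assms by (intro Def_ex Def_conj) (auto simp: DT_def)
  then show ?thesis
    by (rule Def.cong) (use assms(2) in \<open>auto simp: DT_def\<close>)
qed

lemma DT_in: "DT M E K t \<Longrightarrow> range e \<subseteq> M \<Longrightarrow> t e \<in> M"
  by (simp add: DT_def)

lemma DT_shift: assumes "DT M E K t" shows "DT M E K (\<lambda>e. t (\<lambda>i. e (r i)))"
proof -
  have "Def M E K (\<lambda>e. e 0 = t (\<lambda>i. e (Suc i)))" using assms by (simp add: DT_def)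
  from Def_rename[OF this, of "case_nat 0 (Suc \<circ> r)"]
  have "Def M E K (\<lambda>e. e 0 = t (\<lambda>i. e (Suc (r i))))" by (simp add: comp_def)
  moreover have "t (\<lambda>i. e (r i)) \<in> M" if "range e \<subseteq> M" for e :: "nat \<Rightarrow> 'a"
    using assms that by (intro DT_in) auto
  ultimately show ?thesis by (simp add: DT_def)
qed

text \<open>With the two- and three-place versions below, a notion shown definable for variables
  becomes a rule for arbitrary terms.\<close>

lemma Def_subst1:
  assumes "Def M E K (\<lambda>e. R (e 0))" "DT M E K s"
  shows "Def M E K (\<lambda>e. R (s e))"
  using Def_subst[of M E K "\<lambda>x e. R x", OF _ assms(2)] assms(1) by simp

lemma Def_subst2:
  assumes "Def M E K (\<lambda>e. R (e 0) (e (Suc 0)))" "DT M E K s" "DT M E K t"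
  shows "Def M E K (\<lambda>e. R (s e) (t e))"
proof -
  have "Def M E K (\<lambda>e. R (e 0) (t (\<lambda>i. e (Suc i))))"
    using Def_subst[of M E K "\<lambda>y e. R (e 0) y", OF _ DT_shift[OF assms(3), of Suc]]
      Def_rename[OF assms(1), of "case_nat (Suc 0) (\<lambda>_. 0)"] by (simp add: comp_def)
  from Def_subst[OF this assms(2)] show ?thesis by simp
qed

lemma Def_subst3:
  assumes "Def M E K (\<lambda>e. R (e 0) (e (Suc 0)) (e (Suc (Suc 0))))" "DT M E K s" "DT M E K t" "DT M E K u"
  shows "Def M E K (\<lambda>e. R (s e) (t e) (u e))"
proof -
  \<comment> \<open>A substitution always replaces variable 0, so the variables are permuted to
    bring each argument there in turn, the last one first.\<close>
  have "Def M E K (\<lambda>e. R (e (Suc 0)) (e (Suc (Suc 0))) (e 0))"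
    using Def_rename[OF assms(1), of "\<lambda>i. if i = 0 then 1 else if i = 1 then 2 else 0"]
    by (simp add: comp_def numeral_2_eq_2)
  from Def_subst[of M E K "\<lambda>y e. R (e 0) (e (Suc 0)) y", OF this DT_shift[OF assms(4), of "\<lambda>i. Suc (Suc i)"]]
  have "Def M E K (\<lambda>e. R (e 0) (e (Suc 0)) (u (\<lambda>i. e (Suc (Suc i)))))" .
  from Def_rename[OF this, of "case_nat (Suc 0) (case_nat 0 (\<lambda>i. Suc (Suc i)))"]
  have "Def M E K (\<lambda>e. R (e (Suc 0)) (e 0) (u (\<lambda>i. e (Suc (Suc i)))))" by (simp add: comp_def)
  from Def_subst[of M E K "\<lambda>y e. R (e 0) y (u (\<lambda>i. e (Suc i)))", OF this DT_shift[OF assms(3), of Suc]]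
  have "Def M E K (\<lambda>e. R (e 0) (t (\<lambda>i. e (Suc i))) (u (\<lambda>i. e (Suc i))))" .
  from Def_subst[OF this assms(2)] show ?thesis by simp
qed

lemma DT_var [def_intros]: "DT M E K (\<lambda>e. e i)"
  by (auto simp: DT_def intro: Def.eq)

lemma DT_param [def_intros]: assumes "c \<in> K" "K \<subseteq> M" shows "DT M E K (\<lambda>e. c)"
  using Def.par[OF assms(1) Def.eq[of M E K "Suc 0" 0]] assms by (auto simp: DT_def)

lemma Def_mem [def_intros]: "DT M E K s \<Longrightarrow> DT M E K t \<Longrightarrow> Def M E K (\<lambda>e. E (s e) (t e))"
  by (rule Def_subst2[of M E K E]) (rule Def.mem)

lemma Def_eq [def_intros]: "DT M E K s \<Longrightarrow> DT M E K t \<Longrightarrow> Def M E K (\<lambda>e. s e = t e)"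
  by (rule Def_subst2[of M E K "(=)"]) (rule Def.eq)

lemma Def_carrier [def_intros]: "DT M E K s \<Longrightarrow> Def M E K (\<lambda>e. s e \<in> M)"
  by (rule Def.cong[OF Def_True]) (simp add: DT_in)

text \<open>For terms whose value is only characterised by a relation, such as descriptions and set
  comprehensions.\<close>

lemma DT_graph:
  assumes "\<And>e. range e \<subseteq> M \<Longrightarrow> t e \<in> M" "Def M E K (\<lambda>e. R (e 0) (\<lambda>i. e (Suc i)))"
    "\<And>e y. range e \<subseteq> M \<Longrightarrow> y \<in> M \<Longrightarrow> R y e \<longleftrightarrow> y = t e"
  shows "DT M E K t"
  unfolding DT_def
proof
  show "Def M E K (\<lambda>e. e 0 = t (\<lambda>i. e (Suc i)))"
    by (rule Def.cong[OF assms(2)]) (use assms(3)[OF shift_range] in blast)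
qed (use assms(1) in blast)

lemma DT_subst1:
  assumes "DT M E K (\<lambda>e. F (e 0))" "DT M E K t"
  shows "DT M E K (\<lambda>e. F (t e))"
proof (rule DT_graph[where R="\<lambda>y e. y = F (t e)"])
  have *: "Def M E K (\<lambda>e. e 0 = F (e (Suc 0)))" using assms(1) by (simp add: DT_def)
  show "Def M E K (\<lambda>e. e 0 = F (t (\<lambda>i. e (Suc i))))"
    by (rule Def_subst2[of M E K "\<lambda>y x. y = F x", OF * DT_var DT_shift[OF assms(2)]])
  fix e :: "nat \<Rightarrow> 'a" assume "range e \<subseteq> M"
  then have "range (\<lambda>_ :: nat. t e) \<subseteq> M" using DT_in[OF assms(2)] by auto
  from DT_in[OF assms(1) this] show "F (t e) \<in> M" .
qed auto

lemma DT_subst2: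
  assumes "DT M E K (\<lambda>e. F (e 0) (e (Suc 0)))" "DT M E K s" "DT M E K t"
  shows "DT M E K (\<lambda>e. F (s e) (t e))"
proof (rule DT_graph[where R="\<lambda>y e. y = F (s e) (t e)"])
  have *: "Def M E K (\<lambda>e. e 0 = F (e (Suc 0)) (e (Suc (Suc 0))))" using assms(1) by (simp add: DT_def)
  show "Def M E K (\<lambda>e. e 0 = F (s (\<lambda>i. e (Suc i))) (t (\<lambda>i. e (Suc i))))"
    by (rule Def_subst3[of M E K "\<lambda>z x y. z = F x y", OF * DT_var DT_shift[OF assms(2)] DT_shift[OF assms(3)]])
  fix e :: "nat \<Rightarrow> 'a" assume "range e \<subseteq> M"
  then have "range (case_nat (s e) (\<lambda>_. t e)) \<subseteq> M"
    using DT_in[OF assms(2)] DT_in[OF assms(3)] by (intro range_case_nat) auto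
  from DT_in[OF assms(1) this] show "F (s e) (t e) \<in> M" by simp
qed auto

lemma Def_Collect [def_intros]:
  "Def M E K (\<lambda>e. P (t e) e) \<Longrightarrow> Def M E K (\<lambda>e. t e \<in> {z. P z e})"
  by simp

lemma Def_insert [def_intros]:
  "Def M E K (\<lambda>e. s e = t e \<or> s e \<in> X e) \<Longrightarrow> Def M E K (\<lambda>e. s e \<in> insert (t e) (X e))"
  by simp

lemma Def_empty [def_intros]: "Def M E K (\<lambda>e. s e \<in> {})"
  using Def_const[of M E K False] by simp

lemma Def_shift:
  assumes "Def M E K (\<lambda>e. P (e 0) (\<lambda>i. e (Suc i)))" "DT M E K s"
  shows "Def M E K (\<lambda>e. P (s e) (\<lambda>i. e (r i)))"
proof -
  have "Def M E K (\<lambda>e. P (e 0) (\<lambda>i. e (Suc (r i))))"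
    using Def_rename[OF assms(1), of "case_nat 0 (\<lambda>i. Suc (r i))"] by (simp add: comp_def)
  from Def_subst[of M E K "\<lambda>x e. P x (\<lambda>i. e (r i))", OF this assms(2)] show ?thesis .
qed

section \<open>Definability of the notions of set theory\<close>

text \<open>
  The notions of a structure \<open>W\<close> are definable in any larger structure \<open>M\<close> in which \<open>W\<close> is a definable
  class. This will be applied with the universe as \<open>M\<close>, and both the universe and the permutation model
  as \<open>W\<close>.
\<close>

locale definable_class = membership W E A
  for W :: "'v set" and E :: "'v \<Rightarrow> 'v \<Rightarrow> bool" (infix "\<epsilon>" 50) and A :: 'v +
  fixes M :: "'v set"
  assumes class_subset: "W \<subseteq> M"
    and atoms_in_class: "A \<in> W"
    and class_definable: "Def M E {A} (\<lambda>e. e 0 \<in> W)"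
begin

lemma elts_subset: "elts x \<subseteq> W"
  by (auto simp: elts_def)

lemma elts_subset_M: "elts x \<subseteq> M"
  using elts_subset class_subset by blast

lemma is_set_in: "is_set x \<Longrightarrow> x \<in> W"
  by (simp add: is_set_def)

lemma is_pair_in: "is_pair z x y \<Longrightarrow> z \<in> W \<and> x \<in> W \<and> y \<in> W"
  by (auto simp: is_pair_def codes_def is_set_def)

lemma app_in: "app f x y \<Longrightarrow> x \<in> W \<and> y \<in> W"
  by (auto simp: app_def dest: is_pair_in)

text \<open>The definitions quantify over the whole type. As \<open>app\<close> holds only between
  elements of the carrier, such quantifiers can be bounded, which definability requires.\<close>

lemma all_app: "(\<forall>y. app f x y \<longrightarrow> R y) \<longleftrightarrow> (\<forall>y\<in>W. app f x y \<longrightarrow> R y)"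
  using app_in by blast

lemma all_app2: "(\<forall>x y. app f x y \<longrightarrow> R x y) \<longleftrightarrow> (\<forall>x\<in>W. \<forall>y\<in>W. app f x y \<longrightarrow> R x y)"
  using app_in by blast

lemma ex_codes: "(\<exists>c. codes c X \<and> R c) \<longleftrightarrow> (\<exists>c\<in>W. codes c X \<and> R c)"
  by (auto simp: codes_def is_set_def)

lemma fn_in: "fn f d X \<Longrightarrow> f \<in> W"
  by (simp add: fn_def is_set_def)

lemma all_fn: "(\<forall>t. fn t n X \<longrightarrow> R t) \<longleftrightarrow> (\<forall>t\<in>W. fn t n X \<longrightarrow> R t)"
  using fn_in by blast

lemma transitive_in: "transitive T \<Longrightarrow> T \<in> W"
  by (simp add: transitive_def is_set_def)

lemma omega_subset: "\<omega> \<subseteq> W"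
  by (auto simp: \<omega>_def is_ord_def transitive_def is_set_def)

lemma bits_subset: "bits \<subseteq> W"
  by (auto simp: bits_def is_zero_def is_one_def is_succ_def codes_def is_set_def)

lemma Q_subset: "Q \<subseteq> W"
  by (auto simp: Q_def fn_def is_set_def)

lemma I_subset: "I \<subseteq> W"
  using Q_subset by (auto simp: I_def)

lemma P_level_subset: "P_level n \<subseteq> W"
  by (auto simp: P_level_def fn_def is_set_def)

lemma P_subset: "P \<subseteq> W"
  using P_level_subset by (auto simp: P_def)

lemma perms_subset: "perms \<subseteq> W"
  by (auto simp: perms_def bijection_def fn_def is_set_def)

lemmas class_subsets = elts_subset_M class_subset[THEN subset_trans[OF omega_subset]]
  class_subset[THEN subset_trans[OF bits_subset]] class_subset[THEN subset_trans[OF Q_subset]]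
  class_subset[THEN subset_trans[OF I_subset]] class_subset[THEN subset_trans[OF P_level_subset]]
  class_subset[THEN subset_trans[OF P_subset]] class_subset[THEN subset_trans[OF perms_subset]]
  class_subset

context
  fixes K :: "'v set"
  assumes AK: "A \<in> K" and KM: "K \<subseteq> M"
begin

text \<open>The language has no symbol for the set of atoms, and already \<open>is_set\<close>
  refers to it; hence \<open>A\<close> has to be among the parameters.\<close>

lemma DT_A: "DT M E K (\<lambda>e. A)"
  using AK KM by (rule DT_param)

lemma def_class [def_intros]: "DT M E K s \<Longrightarrow> Def M E K (\<lambda>e. s e \<in> W)"
  by (rule Def_subst1[of M E K "\<lambda>x. x \<in> W"]) (use Def_mono[OF class_definable] AK in auto)

lemma def_elts [def_intros]:
  assumes "DT M E K s" "DT M E K t" shows "Def M E K (\<lambda>e. s e \<in> elts (t e))"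
  unfolding elts_def by (intro def_intros assms)

lemma def_is_set [def_intros]: "DT M E K s \<Longrightarrow> Def M E K (\<lambda>e. is_set (s e))"
  unfolding is_set_def by (intro def_intros DT_A)

lemma def_codes [def_intros]:
  assumes "DT M E K t" "Def M E K (\<lambda>e. e 0 \<in> X (\<lambda>i. e (Suc i)))" "\<And>e. range e \<subseteq> M \<Longrightarrow> X e \<subseteq> M"
  shows "Def M E K (\<lambda>e. codes (t e) (X e))"
proof (rule Def.cong)
  show "Def M E K (\<lambda>e. is_set (t e) \<and> (\<forall>z\<in>M. z \<in> elts (t e) \<longleftrightarrow> z \<in> X e))"
    by (intro Def_conj Def_all def_is_set Def_iff def_elts DT_var assms(1,2) DT_shift[OF assms(1)])
  show "codes (t e) (X e) \<longleftrightarrow> is_set (t e) \<and> (\<forall>z\<in>M. z \<in> elts (t e) \<longleftrightarrow> z \<in> X e)" if "range e \<subseteq> M" for e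
    using assms(3)[OF that] elts_subset_M[of "t e"] by (auto simp: codes_def)
qed

lemma def_subset_elts [def_intros]:
  assumes "DT M E K s" "DT M E K t" shows "Def M E K (\<lambda>e. elts (s e) \<subseteq> elts (t e))"
proof -
  have *: "elts x \<subseteq> elts y \<longleftrightarrow> (\<forall>z\<in>M. z \<in> elts x \<longrightarrow> z \<in> elts y)" for x y
    using elts_subset_M[of x] by blast
  show ?thesis unfolding *
    by (intro def_intros DT_shift[OF assms(1)] DT_shift[OF assms(2)])
qed

lemma def_transitive_0: "Def M E K (\<lambda>e. transitive (e 0))"
  unfolding transitive_def by (intro def_intros class_subsets)

lemmas def_transitive [def_intros] = Def_subst1[of M E K transitive, OF def_transitive_0]

lemma def_is_pair_0: "Def M E K (\<lambda>e. is_pair (e 0) (e (Suc 0)) (e (Suc (Suc 0))))"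
proof -
  have *: "is_pair z x y \<longleftrightarrow> x \<in> W \<and> y \<in> W \<and> (\<exists>u\<in>W. \<exists>v\<in>W. codes u {x} \<and> codes v {x, y} \<and> codes z {u, v})"
    for x y z by (auto simp: is_pair_def codes_def is_set_def)
  show ?thesis unfolding *
    by (intro def_intros class_subsets) auto
qed

lemmas def_is_pair [def_intros] = Def_subst3[of M E K is_pair, OF def_is_pair_0]

lemma def_app_0: "Def M E K (\<lambda>e. app (e 0) (e (Suc 0)) (e (Suc (Suc 0))))"
  unfolding app_def by (intro def_intros class_subsets)

lemmas def_app [def_intros] = Def_subst3[of M E K app, OF def_app_0]

lemma def_fn [def_intros]:
  assumes s: "DT M E K s" and t: "DT M E K t"
    and X: "Def M E K (\<lambda>e. e 0 \<in> X (\<lambda>i. e (Suc i)))" and sub: "\<And>e. range e \<subseteq> M \<Longrightarrow> X e \<subseteq> M"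
  shows "Def M E K (\<lambda>e. fn (s e) (t e) (X e))"
proof (rule Def.cong)
  \<comment> \<open>The codomain is tested below three quantifiers: the tested element is variable 0
    and the environment of \<open>X\<close> is shifted three times.\<close>
  have *: "Def M E K (\<lambda>e. e 0 \<in> X (\<lambda>i. e (Suc (Suc (Suc i)))))"
    by (rule Def_shift[of M E K "\<lambda>y e. y \<in> X e", OF X DT_var])
  show "Def M E K (\<lambda>e. is_set (s e) \<and> (\<forall>z\<in>elts (s e). \<exists>x\<in>elts (t e). \<exists>y\<in>M. y \<in> X e \<and> is_pair z x y) \<and>
      (\<forall>x\<in>elts (t e). \<exists>y\<in>M. app (s e) x y \<and> (\<forall>y'\<in>M. app (s e) x y' \<longrightarrow> y' = y)))"
    by (intro Def_conj def_is_set Def_Ball Def_Bex Def_all Def_ex def_elts Def_imp Def_eq def_app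
        def_is_pair DT_var elts_subset_M * s t DT_shift[OF s] DT_shift[OF t])
  show "fn (s e) (t e) (X e) \<longleftrightarrow>
      is_set (s e) \<and> (\<forall>z\<in>elts (s e). \<exists>x\<in>elts (t e). \<exists>y\<in>M. y \<in> X e \<and> is_pair z x y) \<and>
      (\<forall>x\<in>elts (t e). \<exists>y\<in>M. app (s e) x y \<and> (\<forall>y'\<in>M. app (s e) x y' \<longrightarrow> y' = y))"
    if "range e \<subseteq> M" for e
  proof -
    have "(\<exists>!y. app (s e) x y) \<longleftrightarrow> (\<exists>y\<in>M. app (s e) x y \<and> (\<forall>y'\<in>M. app (s e) x y' \<longrightarrow> y' = y))" for x
      using app_in[of "s e" x] class_subset unfolding Ex1_def by blast
    moreover have "(\<exists>y\<in>X e. is_pair z x y) \<longleftrightarrow> (\<exists>y\<in>M. y \<in> X e \<and> is_pair z x y)" for x z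
      using sub[OF that] by blast
    ultimately show ?thesis by (simp add: fn_def)
  qed
qed

lemma def_injective_0: "Def M E K (\<lambda>e. injective (e 0))"
proof -
  have *: "injective f \<longleftrightarrow> (\<forall>x\<in>W. \<forall>x'\<in>W. \<forall>y\<in>W. app f x y \<and> app f x' y \<longrightarrow> x = x')" for f
    using app_in by (auto simp: injective_def) blast+
  show ?thesis unfolding * by (intro def_intros class_subsets)
qed

lemmas def_injective [def_intros] = Def_subst1[of M E K injective, OF def_injective_0]

lemma def_bijection_0: "Def M E K (\<lambda>e. bijection (e 0) (e (Suc 0)) (e (Suc (Suc 0))))"
  unfolding bijection_def by (intro def_intros class_subsets)

lemmas def_bijection [def_intros] = Def_subst3[of M E K bijection, OF def_bijection_0]

lemma def_is_zero [def_intros]: "DT M E K s \<Longrightarrow> Def M E K (\<lambda>e. is_zero (s e))"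
  unfolding is_zero_def by (intro def_intros) auto

lemma def_is_succ_0: "Def M E K (\<lambda>e. is_succ (e 0) (e (Suc 0)))"
  unfolding is_succ_def by (intro def_intros class_subsets) (use elts_subset_M in auto)

lemmas def_is_succ [def_intros] = Def_subst2[of M E K is_succ, OF def_is_succ_0]

lemma def_is_one_0: "Def M E K (\<lambda>e. is_one (e 0))"
proof -
  have *: "is_one y \<longleftrightarrow> (\<exists>x\<in>W. is_zero x \<and> is_succ y x)" for y
    by (auto simp: is_one_def is_succ_def)
  show ?thesis unfolding * by (intro def_intros class_subsets)
qed

lemmas def_is_one [def_intros] = Def_subst1[of M E K is_one, OF def_is_one_0]

lemma def_is_ord_0: "Def M E K (\<lambda>e. is_ord (e 0))"
  unfolding is_ord_def by (intro def_intros class_subsets)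

lemmas def_is_ord [def_intros] = Def_subst1[of M E K is_ord, OF def_is_ord_0]

lemma def_omega_0: "Def M E K (\<lambda>e. e 0 \<in> \<omega>)"
proof -
  have *: "n \<in> \<omega> \<longleftrightarrow> is_ord n \<and> (\<forall>m\<in>W. m = n \<or> m \<in> elts n \<longrightarrow> is_zero m \<or> (\<exists>k\<in>W. is_succ m k))" for n
    using elts_subset[of n] by (auto simp: \<omega>_def is_ord_def transitive_def is_set_def is_succ_def)
  show ?thesis unfolding * by (intro def_intros class_subsets)
qed

lemmas def_omega [def_intros] = Def_subst1[of M E K "\<lambda>n. n \<in> \<omega>", OF def_omega_0]

lemma def_is_finite_0: "Def M E K (\<lambda>e. is_finite (e 0))"
proof -
  have *: "is_finite x \<longleftrightarrow> (\<exists>n\<in>\<omega>. \<exists>f\<in>W. bijection f x n)" for x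
    by (auto simp: is_finite_def bijection_def fn_def is_set_def)
  show ?thesis unfolding * by (intro def_intros class_subsets)
qed

lemmas def_is_finite [def_intros] = Def_subst1[of M E K is_finite, OF def_is_finite_0]

lemma def_is_countable_0: "Def M E K (\<lambda>e. is_countable (e 0))"
proof -
  have *: "is_countable x \<longleftrightarrow> (\<exists>f\<in>W. fn f x \<omega> \<and> injective f)" for x
    by (auto simp: is_countable_def fn_def is_set_def)
  show ?thesis unfolding * by (intro def_intros class_subsets)
qed

lemmas def_is_countable [def_intros] = Def_subst1[of M E K is_countable, OF def_is_countable_0]

lemma def_is_trancl_0: "Def M E K (\<lambda>e. is_trancl (e 0) (e (Suc 0)))"
proof -
  have *: "is_trancl x T \<longleftrightarrow> transitive T \<and> x \<in> elts T \<and>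
     (\<forall>U\<in>W. transitive U \<and> x \<in> elts U \<longrightarrow> elts T \<subseteq> elts U)" for x T
    by (auto simp: is_trancl_def transitive_def is_set_def)
  show ?thesis unfolding * by (intro def_intros class_subsets)
qed

lemmas def_is_trancl [def_intros] = Def_subst2[of M E K is_trancl, OF def_is_trancl_0]

lemma def_perms [def_intros]: "DT M E K s \<Longrightarrow> Def M E K (\<lambda>e. s e \<in> perms)"
  unfolding perms_def by (intro def_intros DT_A)

lemma def_acts_0: "Def M E K (\<lambda>e. acts (e 0) (e (Suc 0)) (e (Suc (Suc 0))))"
proof -
  have *: "acts \<pi> x y \<longleftrightarrow> (\<exists>T\<in>W. \<exists>g\<in>W. transitive T \<and> x \<in> elts T \<and> fn g T W \<and> app g x y \<and>
     (\<forall>t\<in>elts T. \<forall>u\<in>W. app g t u \<longrightarrow>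
        (if t \<in> elts A then app \<pi> t u else codes u {w. \<exists>s\<in>elts t. app g s w})))"
    for \<pi> x y
    by (simp only: acts_def all_app) (use transitive_in fn_in in blast)
  show ?thesis unfolding *
    by (intro def_intros class_subsets DT_A) (use app_in class_subset in auto)
qed

lemmas def_acts [def_intros] = Def_subst3[of M E K acts, OF def_acts_0]

lemma def_bits [def_intros]: "DT M E K s \<Longrightarrow> Def M E K (\<lambda>e. s e \<in> bits)"
  unfolding bits_def by (intro def_intros)

lemma def_Q_0: "Def M E K (\<lambda>e. e 0 \<in> Q)"
proof -
  have *: "h \<in> Q \<longleftrightarrow> (\<exists>d\<in>W. is_set d \<and> (\<forall>n\<in>elts d. n \<in> \<omega>) \<and> is_finite d \<and> fn h d bits)" for h
    by (auto simp: Q_def is_set_def)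
  show ?thesis unfolding * by (intro def_intros class_subsets)
qed

lemmas def_Q [def_intros] = Def_subst1[of M E K "\<lambda>h. h \<in> Q", OF def_Q_0]

lemma def_I_0: "Def M E K (\<lambda>e. e 0 \<in> I)"
proof -
  have *: "h \<in> I \<longleftrightarrow> h \<in> Q \<and> (\<exists>n\<in>\<omega>. \<exists>z\<in>W. is_zero z \<and> app h n z)" for h
    unfolding I_def using app_in by blast
  show ?thesis unfolding * by (intro def_intros class_subsets)
qed

lemmas def_I [def_intros] = Def_subst1[of M E K "\<lambda>h. h \<in> I", OF def_I_0]

lemma def_P_level_0: "Def M E K (\<lambda>e. e 0 \<in> P_level (e (Suc 0)))"
proof -
  have *: "f \<in> P_level n \<longleftrightarrow> fn f A Q \<and>
     (\<forall>a\<in>W. \<forall>h\<in>W. app f a h \<longrightarrow> fn h n bits) \<and>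
     (\<exists>c\<in>W. codes c {a \<in> elts A. \<exists>h\<in>I. app f a h} \<and> is_countable c) \<and>
     (\<forall>t\<in>W. fn t n bits \<longrightarrow> (\<exists>s\<in>W. codes s {a \<in> elts A. app f a t} \<and> \<not> is_finite s))"
    for f n
    by (simp only: P_level_def mem_Collect_eq all_app2 ex_codes all_fn)
  show ?thesis unfolding *
    by (intro def_intros class_subsets DT_A) (use AK KM subsetD[OF elts_subset_M] in auto)
qed

lemmas def_P_level [def_intros] = Def_subst2[of M E K "\<lambda>f n. f \<in> P_level n", OF def_P_level_0]

lemma def_P [def_intros]: "DT M E K s \<Longrightarrow> Def M E K (\<lambda>e. s e \<in> P)"
proof (rule Def_subst1[of M E K "\<lambda>h. h \<in> P"])
  have *: "f \<in> P \<longleftrightarrow> (\<exists>n\<in>\<omega>. f \<in> P_level n)" for f by (auto simp: P_def)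
  show "Def M E K (\<lambda>e. e 0 \<in> P)" unfolding * by (intro def_intros class_subsets)
qed

end

end

section \<open>Set theory in the universe\<close>

context zfa_choice
begin

sublocale V?: definable_class M E A M
proof
  show "Def M E {A} (\<lambda>e. e 0 \<in> M)" by (rule Def_carrier[OF DT_var])
qed (use atom_set in auto)

text \<open>Every element of the universe may serve as a parameter: these are the relations to which
  the axiom schemas apply.\<close>

abbreviation D :: "((nat \<Rightarrow> 'a) \<Rightarrow> bool) \<Rightarrow> bool" where "D \<equiv> Def M E M"
abbreviation DTM :: "((nat \<Rightarrow> 'a) \<Rightarrow> 'a) \<Rightarrow> bool" where "DTM \<equiv> DT M E M"

lemma is_set_A: "is_set A"
  using atom_set atoms_empty unfolding is_set_def by (metis empty_iff)

text \<open>The bridge from semantic definability to the schemas of separation and replacement,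
  which speak of formulas.\<close>

lemma D_sat:
  assumes "D (\<lambda>e. R (e 0) (e (Suc 0)))"
  shows "\<exists>\<phi> e. range e \<subseteq> M \<and> e 1 = A \<and> (\<forall>u\<in>M. \<forall>v\<in>M. sat M E \<phi> (e(0 := u, 1 := v)) = R u v)"
proof -
  obtain F where F: "finite F" "F \<subseteq> M" "Def M E F (\<lambda>e. R (e 0) (e (Suc 0)))"
    using Def_finite_parameters[OF assms] by blast
  \<comment> \<open>Including \<open>A\<close> makes the list nonempty, so that its periodic
    repetition \<open>c\<close> enumerates the parameters by all natural numbers.\<close>
  obtain xs where xs: "set xs = insert A F" using finite_list[of "insert A F"] F(1) by auto
  then have "xs \<noteq> []" by auto
  define c where "c i = xs ! (i mod length xs)" for i
  have c: "range c = insert A F"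
  proof -
    have "x \<in> range c" if "x \<in> set xs" for x
      using that by (metis c_def in_set_conv_nth mod_less rangeI)
    moreover have "c i \<in> set xs" for i using \<open>xs \<noteq> []\<close> by (simp add: c_def)
    ultimately show ?thesis using xs by blast
  qed
  \<comment> \<open>Variables 0 and 1 carry the arguments, the odd ones from 3 on the parameters;
    the even ones from 2 on remain for binding.\<close>
  define r where "r = case_nat (0::nat) (\<lambda>_. 1)"
  define q where "q j = 2 * j + (3::nat)" for j
  have "range (\<lambda>j. 2 * j + (2::nat)) \<subseteq> - (range r \<union> range q)"
    unfolding r_def q_def range_case_nat_eq by (auto; presburger)
  moreover have "infinite (range (\<lambda>j. 2 * j + (2::nat)))"
    by (simp add: finite_image_iff inj_on_def)
  ultimately have inf: "infinite (- (range r \<union> range q))" using finite_subset by blast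
  have "Def M E (range c) (\<lambda>e. R (e 0) (e (Suc 0)))" using Def_mono[OF F(3)] c by blast
  from Def_sat[OF this inf] obtain \<phi> where
    \<phi>: "\<And>\<rho>. range \<rho> \<subseteq> M \<Longrightarrow> (\<And>j. \<rho> (q j) = c j) \<Longrightarrow> sat M E \<phi> \<rho> = R (\<rho> 0) (\<rho> 1)"
    by (auto simp: r_def)
  define e where "e j = (if odd j \<and> j \<ge> 3 then c ((j - 3) div 2) else A)" for j
  have c_in: "c i \<in> M" for i using c F(2) atom_set rangeI[of c i] by auto
  then have e: "range e \<subseteq> M" using atom_set by (auto simp: e_def)
  have "sat M E \<phi> (e(0 := u, 1 := v)) = R u v" if "u \<in> M" "v \<in> M" for u v
    using e that \<phi>[of "e(0 := u, 1 := v)"] by (auto simp: q_def e_def c_in atom_set)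
  with e show ?thesis by (intro exI[of _ \<phi>] exI[of _ e]) (simp add: e_def)
qed

text \<open>\<open>St X\<close> is junk unless \<open>X\<close> is coded by a set.\<close>

definition setlike :: "'a set \<Rightarrow> bool" where "setlike X \<longleftrightarrow> (\<exists>x. codes x X)"
definition St :: "'a set \<Rightarrow> 'a" where "St X = (THE x. codes x X)"

lemma codes_unique: "codes x X \<Longrightarrow> codes y X \<Longrightarrow> x = y"
  using extensionality by (simp add: codes_def)

lemma St_eq: "codes x X \<Longrightarrow> St X = x"
  unfolding St_def using codes_unique by blast

lemma codes_St: "setlike X \<Longrightarrow> codes (St X) X"
  using St_eq setlike_def by auto

lemma elts_St [simp]: "setlike X \<Longrightarrow> elts (St X) = X"
  using codes_St by (simp add: codes_def)

lemma is_set_St [simp]: "setlike X \<Longrightarrow> is_set (St X)"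
  using codes_St by (simp add: codes_def)

lemma St_in [simp]: "setlike X \<Longrightarrow> St X \<in> M"
  using is_set_St is_set_in by blast

lemma codes_iff: "codes x X \<longleftrightarrow> setlike X \<and> x = St X"
  using codes_St St_eq setlike_def by blast

lemma setlike_elts [simp]: "is_set x \<Longrightarrow> setlike (elts x)"
  by (auto simp: setlike_def codes_def)

lemma St_elts [simp]: "is_set x \<Longrightarrow> St (elts x) = x"
  by (rule St_eq) (simp add: codes_def)

lemma atom_elts: "x \<in> M \<Longrightarrow> \<not> is_set x \<Longrightarrow> elts x = {} \<and> x \<in> elts A"
  using atoms_empty by (auto simp: is_set_def)

lemma elts_in: "x \<in> elts y \<Longrightarrow> x \<in> M"
  using elts_subset_M by blast

lemma setlike_empty [simp]: "setlike {}"
  using empty_set by (simp add: setlike_def)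

lemma setlike_elts' [simp]: "x \<in> M \<Longrightarrow> setlike (elts x)"
  using atom_elts setlike_empty setlike_elts by metis

lemma setlike_subset_M: "setlike X \<Longrightarrow> X \<subseteq> M"
  using elts_subset_M elts_St by metis

lemma setlike_pair [simp]: "x \<in> M \<Longrightarrow> y \<in> M \<Longrightarrow> setlike {x, y}"
  using pairing by (simp add: setlike_def)

lemma setlike_single [simp]: "x \<in> M \<Longrightarrow> setlike {x}"
  using setlike_pair[of x x] by simp

lemma setlike_UN: assumes "setlike X" shows "setlike (\<Union>y\<in>X. elts y)"
  using union[of "St X"] assms by (simp add: setlike_def)

lemma setlike_Un [simp]: assumes "setlike X" "setlike Y" shows "setlike (X \<union> Y)"
  using setlike_UN[of "{St X, St Y}"] assms by simp

lemma setlike_insert [simp]: "x \<in> M \<Longrightarrow> setlike X \<Longrightarrow> setlike (insert x X)"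
  using setlike_Un[of "{x}" X] by simp

lemma setlike_Pow: assumes "setlike X" shows "setlike {y. is_set y \<and> elts y \<subseteq> X}"
  using powerset[of "St X"] assms by (simp add: setlike_def)

lemma setlike_sep:
  assumes "setlike X" "D (\<lambda>e. R (e 0))"
  shows "setlike {u \<in> X. R u}"
proof -
  obtain \<phi> e where e: "range e \<subseteq> M" "e 1 = A" "\<And>u v. u \<in> M \<Longrightarrow> v \<in> M \<Longrightarrow> sat M E \<phi> (e(0 := u, 1 := v)) = R u"
    using D_sat[OF assms(2)] by blast
  have "sat M E \<phi> (e(0 := u)) = R u" if "u \<in> M" for u
  proof -
    \<comment> \<open>Separation changes variable 0 only. Variable 1 keeps its value
      \<open>A\<close>, which is why \<open>D_sat\<close> fixes \<open>e 1\<close>.\<close>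
    have "e(0 := u, 1 := A) = e(0 := u)" using e(2) by (auto simp: fun_eq_iff)
    then show ?thesis using e(3)[OF that atom_set] by simp
  qed
  then have "{u \<in> elts (St X). sat M E \<phi> (e(0 := u))} = {u \<in> X. R u}"
    using assms(1) setlike_subset_M by auto
  then show ?thesis using separation[OF e(1) St_in[OF assms(1)], of \<phi>] by (simp add: setlike_def)
qed

lemma setlike_subset:
  assumes "setlike X" "Y \<subseteq> X" "D (\<lambda>e. e 0 \<in> Y)"
  shows "setlike Y"
proof -
  have "{u \<in> X. u \<in> Y} = Y" using assms(2) by blast
  with setlike_sep[OF assms(1,3)] show ?thesis by simp
qed

lemma D_setlike: "setlike X \<Longrightarrow> DTM t \<Longrightarrow> D (\<lambda>e. t e \<in> X)"
  using def_elts[OF atom_set order_refl, of t "\<lambda>_. St X"] DT_param[of "St X" M M E] by simp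

lemma setlike_Diff: "setlike X \<Longrightarrow> setlike Y \<Longrightarrow> setlike (X - Y)"
  unfolding set_diff_eq by (intro setlike_sep Def_not D_setlike DT_var)

lemma setlike_replace:
  assumes "setlike X" "D (\<lambda>e. R (e 0) (e (Suc 0)))" "\<And>x. x \<in> X \<Longrightarrow> F x \<in> M"
    "\<And>x y. x \<in> X \<Longrightarrow> y \<in> M \<Longrightarrow> R x y \<longleftrightarrow> y = F x"
  shows "setlike (F ` X)"
proof -
  \<comment> \<open>Replacement asks for a relation which is functional on all of \<open>M\<close>;
    restricting its first argument to \<open>X\<close> achieves this.\<close>
  have "D (\<lambda>e. e 0 \<in> X \<and> R (e 0) (e (Suc 0)))"
    by (intro Def_conj assms(2) D_setlike DT_var assms(1))
  from D_sat[of "\<lambda>u v. u \<in> X \<and> R u v", OF this]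
  obtain \<phi> e where e: "range e \<subseteq> M"
    "\<And>u v. u \<in> M \<Longrightarrow> v \<in> M \<Longrightarrow> sat M E \<phi> (e(0 := u, 1 := v)) = (u \<in> X \<and> R u v)"
    by blast
  have "\<exists>z. codes z {v \<in> M. \<exists>u\<in>elts (St X). sat M E \<phi> (e(0 := u, 1 := v))}"
    by (rule replacement[OF e(1) St_in[OF assms(1)]]) (use e(2) assms(4) in auto)
  moreover have "{v \<in> M. \<exists>u\<in>elts (St X). sat M E \<phi> (e(0 := u, 1 := v))} = F ` X"
    (is "?L = _")
  proof
    show "?L \<subseteq> F ` X"
      using assms(1,4) e(2) setlike_subset_M[OF assms(1)] by auto
    show "F ` X \<subseteq> ?L"
    proof
      fix v assume "v \<in> F ` X"
      then obtain u where "u \<in> X" "v = F u" by blast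
      moreover have "sat M E \<phi> (e(0 := u, 1 := F u))"
        using assms(3)[OF calculation(1)] assms(4)[OF calculation(1)] e(2)[of u "F u"] calculation(1)
          setlike_subset_M[OF assms(1)] by auto
      ultimately show "v \<in> ?L" using assms(1,3) by auto
    qed
  qed
  ultimately show ?thesis by (simp add: setlike_def)
qed

lemma setlike_image:
  assumes "setlike X" "DTM (\<lambda>e. F (e 0))"
  shows "setlike (F ` X)"
proof (rule setlike_replace[OF assms(1), where R="\<lambda>x y. y = F x"])
  show "D (\<lambda>e. e (Suc 0) = F (e 0))"
    by (intro Def_eq DT_var assms(2))
  fix x assume "x \<in> X"
  then have "x \<in> M" using assms(1) setlike_subset_M by blast
  then show "F x \<in> M" using DT_in[OF assms(2), of "\<lambda>_. x"] by auto
qed simp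

lemma DT_St:
  assumes "\<And>e. range e \<subseteq> M \<Longrightarrow> setlike (X e)" "Def M E K (\<lambda>e. e 0 \<in> X (\<lambda>i. e (Suc i)))"
    "A \<in> K" "K \<subseteq> M"
  shows "DT M E K (\<lambda>e. St (X e))"
proof (rule DT_graph[where R="\<lambda>y e. codes y (X e)"])
  show "Def M E K (\<lambda>e. codes (e 0) (X (\<lambda>i. e (Suc i))))"
    using Def_shift[of M E K "\<lambda>y e. y \<in> X e" "\<lambda>e. e 0" "\<lambda>i. Suc (Suc i)", OF assms(2) DT_var]
    by (intro def_codes DT_var assms(3,4)) (assumption, rule setlike_subset_M, rule assms(1), auto)
qed (use assms(1) in \<open>auto simp: codes_iff\<close>)

section \<open>Ordered pairs and application as total operations\<close>

definition pr :: "'a \<Rightarrow> 'a \<Rightarrow> 'a" where "pr x y = St {St {x}, St {x, y}}"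

lemma is_pair_iff: "is_pair z x y \<longleftrightarrow> x \<in> M \<and> y \<in> M \<and> z = pr x y"
  by (auto simp: is_pair_def codes_iff pr_def)

lemma pr_in [simp]: "x \<in> M \<Longrightarrow> y \<in> M \<Longrightarrow> pr x y \<in> M"
  by (simp add: pr_def)

lemma St_inject: "setlike X \<Longrightarrow> setlike Y \<Longrightarrow> St X = St Y \<longleftrightarrow> X = Y"
  by (metis elts_St)

lemma pr_inject [simp]:
  "x \<in> M \<Longrightarrow> y \<in> M \<Longrightarrow> x' \<in> M \<Longrightarrow> y' \<in> M \<Longrightarrow> pr x y = pr x' y' \<longleftrightarrow> x = x' \<and> y = y'"
  by (auto simp: pr_def St_inject doubleton_eq_iff)

lemma is_set_pr: "x \<in> M \<Longrightarrow> y \<in> M \<Longrightarrow> is_set (pr x y)"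
  by (simp add: pr_def)

lemma DT_pr [def_intros]:
  assumes K: "A \<in> K" "K \<subseteq> M" and s: "DT M E K s" and t: "DT M E K t"
  shows "DT M E K (\<lambda>e. pr (s e) (t e))"
proof (rule DT_graph[where R="\<lambda>y e. is_pair y (s e) (t e)"])
  show "Def M E K (\<lambda>e. is_pair (e 0) (s (\<lambda>i. e (Suc i))) (t (\<lambda>i. e (Suc i))))"
    by (intro def_is_pair K DT_var DT_shift[OF s] DT_shift[OF t])
qed (use DT_in[OF s] DT_in[OF t] in \<open>auto simp: is_pair_iff\<close>)

lemma app_iff: "app f x y \<longleftrightarrow> x \<in> M \<and> y \<in> M \<and> pr x y \<in> elts f"
  by (auto simp: app_def is_pair_iff)

text \<open>The default value \<open>A\<close> makes \<open>ap\<close> a total definable function.\<close>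

definition ap :: "'a \<Rightarrow> 'a \<Rightarrow> 'a" where
  "ap f x = (if \<exists>!y. app f x y then THE y. app f x y else A)"

lemma ap_in [simp]: "ap f x \<in> M"
  using theI'[of "app f x"] atom_set by (auto simp: ap_def dest: app_in)

lemma DT_ap [def_intros]:
  assumes K: "A \<in> K" "K \<subseteq> M" and s: "DT M E K s" and t: "DT M E K t"
  shows "DT M E K (\<lambda>e. ap (s e) (t e))"
proof (rule DT_subst2[OF _ s t], rule DT_graph[where R="\<lambda>y e.
    (app (e 0) (e (Suc 0)) y \<and> (\<forall>z\<in>M. app (e 0) (e (Suc 0)) z \<longrightarrow> z = y)) \<or>
    (\<not> (\<exists>z\<in>M. app (e 0) (e (Suc 0)) z \<and> (\<forall>z'\<in>M. app (e 0) (e (Suc 0)) z' \<longrightarrow> z' = z)) \<and> y = A)"])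
  fix e :: "nat \<Rightarrow> 'a" and y assume y: "y \<in> M"
  let ?a = "app (e 0) (e (Suc 0))"
  have *: "(\<forall>z\<in>M. ?a z \<longrightarrow> z = y) \<longleftrightarrow> (\<forall>z. ?a z \<longrightarrow> z = y)" for y using app_in by blast
  have "(\<exists>z\<in>M. ?a z \<and> (\<forall>z'. ?a z' \<longrightarrow> z' = z)) \<longleftrightarrow> (\<exists>!z. ?a z)" using app_in unfolding Ex1_def by blast
  then show "?a y \<and> (\<forall>z\<in>M. ?a z \<longrightarrow> z = y) \<or>
      (\<not> (\<exists>z\<in>M. ?a z \<and> (\<forall>z'\<in>M. ?a z' \<longrightarrow> z' = z)) \<and> y = A) \<longleftrightarrow> y = ap (e 0) (e (Suc 0))"
    unfolding * ap_def using the1_equality[of ?a y] theI'[of ?a] by auto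
next
  show "Def M E K (\<lambda>e. (app (e (Suc 0)) (e (Suc (Suc 0))) (e 0) \<and>
        (\<forall>z\<in>M. app (e (Suc 0)) (e (Suc (Suc 0))) z \<longrightarrow> z = e 0)) \<or>
      (\<not> (\<exists>z\<in>M. app (e (Suc 0)) (e (Suc (Suc 0))) z \<and>
        (\<forall>z'\<in>M. app (e (Suc 0)) (e (Suc (Suc 0))) z' \<longrightarrow> z' = z)) \<and> e 0 = A))"
    by (intro def_intros K)
qed simp

section \<open>Natural numbers and recursion\<close>

lemma DT_if [def_intros]:
  assumes C: "Def M E K C" and s: "DT M E K s" and t: "DT M E K t"
  shows "DT M E K (\<lambda>e. if C e then s e else t e)"
proof (rule DT_graph[where R="\<lambda>y e. (C e \<longrightarrow> y = s e) \<and> (\<not> C e \<longrightarrow> y = t e)"])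
  have "Def M E K (\<lambda>e. C (\<lambda>i. e (Suc i)))"
    using Def_rename[OF C, of Suc] by (simp add: comp_def)
  then show "Def M E K (\<lambda>e. (C (\<lambda>i. e (Suc i)) \<longrightarrow> e 0 = s (\<lambda>i. e (Suc i))) \<and>
      (\<not> C (\<lambda>i. e (Suc i)) \<longrightarrow> e 0 = t (\<lambda>i. e (Suc i))))"
    by (intro Def_conj Def_imp Def_not Def_eq DT_var DT_shift[OF s] DT_shift[OF t])
qed (use DT_in[OF s] DT_in[OF t] in auto)

definition zero :: 'a where "zero = St {}"
definition sc :: "'a \<Rightarrow> 'a" where "sc x = St (insert x (elts x))"
definition one :: 'a where "one = sc zero"
definition om :: 'a where "om = St \<omega>"

lemma zero_in [simp]: "zero \<in> M" and elts_zero [simp]: "elts zero = {}" and is_set_zero [simp]: "is_set zero"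
  by (simp_all add: zero_def)

lemma sc_in [simp]: "x \<in> M \<Longrightarrow> sc x \<in> M" and elts_sc [simp]: "x \<in> M \<Longrightarrow> elts (sc x) = insert x (elts x)"
  and is_set_sc [simp]: "x \<in> M \<Longrightarrow> is_set (sc x)"
  by (simp_all add: sc_def)

lemma one_in [simp]: "one \<in> M"
  by (simp add: one_def)

lemma is_zero_iff: "is_zero x \<longleftrightarrow> x = zero"
  by (simp add: is_zero_def codes_iff zero_def)

lemma is_succ_iff: "is_succ y x \<longleftrightarrow> x \<in> M \<and> y = sc x"
  by (auto simp: is_succ_def codes_iff sc_def)

lemma is_one_iff: "is_one y \<longleftrightarrow> y = one"
  by (auto simp: is_one_def is_zero_iff is_succ_iff one_def)

lemma zero_neq_one: "zero \<noteq> one"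
  by (metis elts_sc elts_zero insert_not_empty one_def zero_in)

lemma bits_iff: "b \<in> bits \<longleftrightarrow> b = zero \<or> b = one"
  by (simp add: bits_def is_zero_iff is_one_iff)

lemma foundation_setlike: "setlike X \<Longrightarrow> X \<noteq> {} \<Longrightarrow> \<exists>y\<in>X. elts y \<inter> X = {}"
  using foundation[of "St X"] by simp

lemma mem_irrefl: "x \<notin> elts x"
proof
  assume "x \<in> elts x"
  then have "x \<in> M" by (rule elts_in)
  then have "setlike {x}" by simp
  from foundation_setlike[OF this] show False using \<open>x \<in> elts x\<close> by blast
qed

lemma mem_asym: "x \<in> elts y \<Longrightarrow> y \<notin> elts x"
proof
  assume xy: "x \<in> elts y" "y \<in> elts x"
  then have "setlike {x, y}" using elts_in by simp
  from foundation_setlike[OF this] show False using xy by blast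
qed

lemma sc_inject: "x \<in> M \<Longrightarrow> y \<in> M \<Longrightarrow> sc x = sc y \<Longrightarrow> x = y"
  by (metis (no_types) elts_sc insertE insertI1 mem_asym)

lemma sc_neq_zero [simp]: "x \<in> M \<Longrightarrow> sc x \<noteq> zero" "x \<in> M \<Longrightarrow> zero \<noteq> sc x"
  by (metis elts_sc elts_zero insert_not_empty)+

lemma omega_iff:
  "n \<in> \<omega> \<longleftrightarrow> is_set n \<and> (\<forall>y\<in>elts n. elts y \<subseteq> elts n \<and> transitive y) \<and>
    (\<forall>m\<in>insert n (elts n). m = zero \<or> (\<exists>k\<in>M. m = sc k))"
proof -
  have "n \<in> \<omega> \<longleftrightarrow> (transitive n \<and> (\<forall>y\<in>elts n. transitive y)) \<and>
      (\<forall>m\<in>insert n (elts n). m = zero \<or> (\<exists>k\<in>M. m = sc k))"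
    unfolding \<omega>_def is_ord_def mem_Collect_eq is_zero_iff is_succ_iff Bex_def ..
  then show ?thesis unfolding transitive_def[of n] by (simp only: ball_conj_distrib conj_assoc)
qed

lemma omega_in [simp]: "n \<in> \<omega> \<Longrightarrow> n \<in> M"
  using omega_subset by blast

lemma zero_omega [simp]: "zero \<in> \<omega>"
  by (rule iffD2[OF omega_iff]) simp

lemma omegaD:
  assumes "n \<in> \<omega>"
  shows "is_set n" "\<And>y. y \<in> elts n \<Longrightarrow> elts y \<subseteq> elts n" "\<And>y. y \<in> elts n \<Longrightarrow> transitive y"
    "\<And>m. m \<in> insert n (elts n) \<Longrightarrow> m = zero \<or> (\<exists>k\<in>M. m = sc k)"
proof -
  note * = iffD1[OF omega_iff assms]
  show "is_set n" "y \<in> elts n \<Longrightarrow> elts y \<subseteq> elts n" "y \<in> elts n \<Longrightarrow> transitive y" for y using * by simp_all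
  show "m \<in> insert n (elts n) \<Longrightarrow> m = zero \<or> (\<exists>k\<in>M. m = sc k)" for m
    using conjunct2[OF conjunct2[OF *]] by (rule bspec)
qed

lemma omega_trans: "n \<in> \<omega> \<Longrightarrow> m \<in> elts n \<Longrightarrow> k \<in> elts m \<Longrightarrow> k \<in> elts n"
  using omegaD(2) by blast

lemma omega_transitive: "n \<in> \<omega> \<Longrightarrow> transitive n"
  unfolding transitive_def using omegaD(1,2) by simp

lemma omega_mem: assumes "n \<in> \<omega>" "m \<in> elts n" shows "m \<in> \<omega>"
proof (rule iffD2[OF omega_iff], intro conjI ballI)
  note m = omegaD(2,3)[OF assms]
  show "is_set m" using m(2) by (simp add: transitive_def)
  show "elts y \<subseteq> elts m" if "y \<in> elts m" for y using m(2) that by (simp add: transitive_def)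
  show "transitive y" if "y \<in> elts m" for y using m(1) that omegaD(3)[OF assms(1)] by blast
  show "y = zero \<or> (\<exists>k\<in>M. y = sc k)" if "y \<in> insert m (elts m)" for y
    using m(1) that assms(2) by (intro omegaD(4)[OF assms(1)]) blast
qed

lemma sc_omega [simp]: assumes "n \<in> \<omega>" shows "sc n \<in> \<omega>"
proof (rule iffD2[OF omega_iff], intro conjI ballI)
  have n: "n \<in> M" "elts (sc n) = insert n (elts n)" using assms by auto
  note nD = omegaD[OF assms]
  show "is_set (sc n)" using n by simp
  show "elts y \<subseteq> elts (sc n)" if "y \<in> elts (sc n)" for y using that nD(2)[of y] unfolding n by blast
  show "transitive y" if "y \<in> elts (sc n)" for y
    using that nD(3)[of y] omega_transitive[OF assms] unfolding n by blast
  show "m = zero \<or> (\<exists>k\<in>M. m = sc k)" if "m \<in> insert (sc n) (elts (sc n))" for m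
    using that nD(4)[of m] n(1) unfolding n(2) by blast
qed

lemma one_omega [simp]: "one \<in> \<omega>"
  by (simp add: one_def)

lemma omega_cases: "n \<in> \<omega> \<Longrightarrow> n = zero \<or> (\<exists>k\<in>\<omega>. n = sc k)"
proof -
  assume n: "n \<in> \<omega>"
  show "n = zero \<or> (\<exists>k\<in>\<omega>. n = sc k)"
  proof (cases "n = zero")
    case False
    then obtain k where k: "k \<in> M" "n = sc k" using omegaD(4)[OF n, of n] by blast
    then have "k \<in> elts n" by simp
    then show ?thesis using omega_mem[OF n] k(2) by blast
  qed simp
qed

text \<open>Foundation yields a least counterexample inside the set
  \<open>insert n (elts n)\<close>. The argument does not presuppose that \<open>\<omega>\<close> is
  a set; that is derived from it.\<close>

lemma omega_subset_inductive:
  assumes "setlike X" "zero \<in> X" "\<And>k. k \<in> X \<Longrightarrow> sc k \<in> X"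
  shows "\<omega> \<subseteq> X"
proof (rule ccontr)
  assume "\<not> \<omega> \<subseteq> X"
  then obtain n where n: "n \<in> \<omega>" "n \<notin> X" by blast
  have "setlike (insert n (elts n) - X)" using n assms(1) by (intro setlike_Diff) auto
  moreover have "insert n (elts n) - X \<noteq> {}" using n by blast
  ultimately obtain m where m: "m \<in> insert n (elts n)" "m \<notin> X" "elts m \<inter> (insert n (elts n) - X) = {}"
    using foundation_setlike[of "insert n (elts n) - X"] by blast
  have "m \<in> \<omega>" using m(1) n(1) omega_mem by blast
  then obtain k where k: "k \<in> \<omega>" "m = sc k" using omega_cases m(2) assms(2) by blast
  then have "k \<in> elts m" by simp
  moreover have "k \<in> insert n (elts n)" using m(1) n(1) \<open>k \<in> elts m\<close> omega_trans by blast
  ultimately have "k \<in> X" using m(3) by blast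
  with assms(3) k m(2) show False by blast
qed

lemma setlike_omega [simp]: "setlike \<omega>"
proof -
  obtain w where w: "is_set w" "zero \<in> elts w" "\<And>x. x \<in> elts w \<Longrightarrow> sc x \<in> elts w"
  proof -
    from infinity obtain w where w: "is_set w" "\<forall>z. is_zero z \<longrightarrow> z \<in> elts w"
      "\<forall>x\<in>elts w. \<forall>y. is_succ y x \<longrightarrow> y \<in> elts w" by blast
    show thesis
    proof (rule that[OF w(1)])
      show "zero \<in> elts w" using w(2) by (simp add: is_zero_iff)
      show "sc x \<in> elts w" if "x \<in> elts w" for x
        using w(3) that elts_in[OF that] by (simp add: is_succ_iff)
    qed
  qed
  have "\<omega> \<subseteq> elts w" by (rule omega_subset_inductive[OF setlike_elts[OF w(1)] w(2,3)])
  with setlike_elts[OF w(1)] show ?thesis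
    by (rule setlike_subset) (intro def_omega DT_var atom_set order_refl)
qed

lemma om_in [simp]: "om \<in> M" and elts_om [simp]: "elts om = \<omega>" and is_set_om [simp]: "is_set om"
  by (simp_all add: om_def)

text \<open>The structure may have nonstandard numbers, so induction holds for definable
  \<open>R\<close> only; hence the case \<open>D\<close>.\<close>

lemma omega_induct [consumes 1, case_names D zero sc]:
  assumes "n \<in> \<omega>" "D (\<lambda>e. R (e 0))" "R zero" "\<And>k. k \<in> \<omega> \<Longrightarrow> R k \<Longrightarrow> R (sc k)"
  shows "R n"
proof -
  have "\<omega> \<subseteq> {n \<in> \<omega>. R n}"
    by (rule omega_subset_inductive[OF setlike_sep[OF setlike_omega assms(2)]])
      (use assms(3,4) in auto)
  with assms(1) show ?thesis by blast
qed

lemma DT_sc [def_intros]: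
  assumes K: "A \<in> K" "K \<subseteq> M" and t: "DT M E K t" shows "DT M E K (\<lambda>e. sc (t e))"
proof (rule DT_subst1[OF _ t])
  show "DT M E K (\<lambda>e. sc (e 0))"
    unfolding sc_def
  proof (rule DT_St[OF _ _ K])
    show "Def M E K (\<lambda>e. e 0 \<in> insert (e (Suc 0)) (elts (e (Suc 0))))" by (intro def_intros K)
  qed (auto simp: range_subsetD)
qed

text \<open>A value at \<open>n\<close> is certified by a set of pairs each of which is justified by another pair of the
  set.\<close>

lemma omega_recursion:
  assumes F: "DTM (\<lambda>e. F (e 0))" and x0: "x0 \<in> M"
  shows "\<exists>f. DTM (\<lambda>e. f (e 0)) \<and> f zero = x0 \<and> (\<forall>n\<in>\<omega>. f (sc n) = F (f n))"
proof -
  have F_in: "F x \<in> M" if "x \<in> M" for x using DT_in[OF F, of "\<lambda>_. x"] that by auto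
  define J where "J a \<longleftrightarrow> (\<forall>z\<in>elts a. z = pr zero x0 \<or>
    (\<exists>m\<in>\<omega>. \<exists>v\<in>M. z = pr (sc m) (F v) \<and> pr m v \<in> elts a))" for a
  define R where "R n y \<longleftrightarrow> (\<exists>a\<in>M. pr n y \<in> elts a \<and> J a)" for n y
  have Fe: "DTM (\<lambda>e. F (e i))" for i by (rule DT_subst1[OF F DT_var])
  have DR: "D (\<lambda>e. R (e 0) (e (Suc 0)))"
    unfolding R_def J_def
    by (intro def_intros Fe) (use x0 atom_set elts_subset_M omega_subset in auto)
  have R0: "R zero x0" unfolding R_def J_def
    using x0 by (intro bexI[of _ "St {pr zero x0}"]) auto
  have Rsc: "R (sc n) (F y)" if n: "n \<in> \<omega>" "y \<in> M" "R n y" for n y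
  proof -
    obtain a where a: "a \<in> M" "pr n y \<in> elts a" "J a" using n(3) unfolding R_def by blast
    let ?b = "St (insert (pr (sc n) (F y)) (elts a))"
    have b: "elts ?b = insert (pr (sc n) (F y)) (elts a)" using a(1) n F_in by simp
    have "J ?b" using a n unfolding J_def b by blast
    then show ?thesis unfolding R_def using b a(1) n F_in by (intro bexI[of _ ?b]) auto
  qed
  have ex: "\<exists>y\<in>M. R n y" if "n \<in> \<omega>" for n
    using that
  proof (induction rule: omega_induct)
    case D
    have "D (\<lambda>e. R (e (Suc 0)) (e 0))"
      by (rule Def_subst2[of M E M R, OF DR DT_var DT_var])
    then show ?case by (rule Def_ex)
  qed (use R0 x0 Rsc F_in in blast)+
  have uniq: "y = y'" if "n \<in> \<omega>" "y \<in> M" "y' \<in> M" "R n y" "R n y'" for n y y'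
  proof -
    have "\<forall>y\<in>M. \<forall>y'\<in>M. R n y \<longrightarrow> R n y' \<longrightarrow> y = y'"
      using that(1)
    proof (induction rule: omega_induct)
      case D
      have "D (\<lambda>e. R (e i) (e j))" for i j
        by (rule Def_subst2[of M E M R, OF DR DT_var DT_var])
      then show ?case by (intro def_intros)
    next
      case zero
      have "y = x0" if y: "R zero y" "y \<in> M" for y
      proof -
        obtain a where a: "pr zero y \<in> elts a" "J a" using y(1) unfolding R_def by blast
        then have "pr zero y = pr zero x0 \<or>
            (\<exists>m\<in>\<omega>. \<exists>v\<in>M. pr zero y = pr (sc m) (F v) \<and> pr m v \<in> elts a)"
          unfolding J_def by blast
        moreover have "pr zero y \<noteq> pr (sc m) (F v)" if "m \<in> \<omega>" "v \<in> M" for m v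
          using F_in[OF that(2)] that(1) y(2) by simp
        ultimately have "pr zero y = pr zero x0" by blast
        then show ?thesis using x0 y(2) by simp
      qed
      then show ?case by blast
    next
      case (sc k)
      have "\<exists>v\<in>M. R k v \<and> y = F v" if y: "R (sc k) y" "y \<in> M" for y
      proof -
        obtain a where a: "a \<in> M" "pr (sc k) y \<in> elts a" "J a" using y(1) unfolding R_def by blast
        then have "pr (sc k) y = pr zero x0 \<or>
            (\<exists>m\<in>\<omega>. \<exists>v\<in>M. pr (sc k) y = pr (sc m) (F v) \<and> pr m v \<in> elts a)"
          unfolding J_def by blast
        then obtain m v where m: "m \<in> \<omega>" "v \<in> M" "sc k = sc m" "y = F v" "pr m v \<in> elts a"
        proof
          assume "pr (sc k) y = pr zero x0"
          then show thesis using sc.hyps y(2) x0 by simp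
        next
          assume "\<exists>m\<in>\<omega>. \<exists>v\<in>M. pr (sc k) y = pr (sc m) (F v) \<and> pr m v \<in> elts a"
          then obtain m v where m: "m \<in> \<omega>" "v \<in> M" "pr (sc k) y = pr (sc m) (F v)" "pr m v \<in> elts a"
            by blast
          then have "sc k = sc m" "y = F v" using sc.hyps y(2) F_in[OF m(2)] by simp_all
          with m show thesis by (intro that)
        qed
        then have "m = k" using sc.hyps sc_inject[of m k] by simp
        with m a show ?thesis unfolding R_def by blast
      qed
      then show ?case using sc by blast
    qed
    then show ?thesis using that by blast
  qed
  \<comment> \<open>The default \<open>x0\<close> outside \<open>\<omega>\<close> keeps
    \<open>f\<close> total and definable.\<close>
  define f where "f n = (if n \<in> \<omega> then THE y. y \<in> M \<and> R n y else x0)" for n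
  have f: "f n \<in> M \<and> R n (f n)" if n: "n \<in> \<omega>" for n
  proof -
    have "\<exists>!y. y \<in> M \<and> R n y" using ex[OF n] uniq[OF n] by blast
    from theI'[OF this] show ?thesis using n by (simp add: f_def)
  qed
  have f_eq: "R n y \<longleftrightarrow> y = f n" if "n \<in> \<omega>" "y \<in> M" for n y
    using f[OF that(1)] uniq[OF that(1)] that by blast
  have "DTM (\<lambda>e. f (e 0))"
  proof (rule DT_graph[where R="\<lambda>y e. if e 0 \<in> \<omega> then R (e 0) y else y = x0"])
    have "D (\<lambda>e. R (e (Suc 0)) (e 0))"
      by (rule Def_subst2[of M E M R, OF DR DT_var DT_var])
    then show "D (\<lambda>e. if e (Suc 0) \<in> \<omega> then R (e (Suc 0)) (e 0) else e 0 = x0)"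
      by (intro def_intros) (use x0 atom_set in auto)
  qed (use f f_eq x0 in \<open>auto simp: f_def\<close>)
  moreover have "f zero = x0" using f_eq[of zero x0] R0 x0 by simp
  moreover have "f (sc n) = F (f n)" if "n \<in> \<omega>" for n
    using f_eq[of "sc n" "F (f n)"] Rsc[OF that] f[OF that] that F_in by auto
  ultimately show ?thesis by blast
qed

section \<open>Transitive closures, induction and recursion on membership\<close>

text \<open>The union of the iterated unions of \<open>{x}\<close>.\<close>

lemma ex_transitive: assumes "x \<in> M" shows "\<exists>T. transitive T \<and> x \<in> elts T"
proof -
  let ?F = "\<lambda>x. St (\<Union>y\<in>elts x. elts y)"
  have U: "setlike (\<Union>y\<in>elts x. elts y)" if "x \<in> M" for x
    using that by (intro setlike_UN) simp
  have "DTM (\<lambda>e. St {z. \<exists>y\<in>elts (e 0). z \<in> elts y})"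
  proof (rule DT_St[OF _ _ atom_set order_refl])
    show "D (\<lambda>e. e 0 \<in> {z. \<exists>y\<in>elts (e (Suc 0)). z \<in> elts y})"
      by (intro def_intros atom_set order_refl elts_subset_M)
    fix e :: "nat \<Rightarrow> 'a" assume "range e \<subseteq> M"
    then have "setlike (\<Union>y\<in>elts (e 0). elts y)" by (intro U) auto
    then show "setlike {z. \<exists>y\<in>elts (e 0). z \<in> elts y}" by (simp add: UNION_eq)
  qed
  then have "DTM (\<lambda>e. ?F (e 0))" by (simp only: UNION_eq)
  then obtain f where f: "DTM (\<lambda>e. f (e 0))" "f zero = St {x}" "\<forall>n\<in>\<omega>. f (sc n) = ?F (f n)"
    using omega_recursion[of ?F "St {x}"] assms by auto
  have f_in: "f n \<in> M" if "n \<in> \<omega>" for n using DT_in[OF f(1), of "\<lambda>_. n"] that by auto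
  have "setlike (\<Union>y\<in>f ` \<omega>. elts y)"
    by (intro setlike_UN setlike_image f(1) setlike_omega)
  then have T: "setlike (\<Union>n\<in>\<omega>. elts (f n))" (is "setlike ?T") by simp
  have "elts y \<subseteq> ?T" if y: "y \<in> ?T" for y
  proof -
    obtain n where n: "n \<in> \<omega>" "y \<in> elts (f n)" using y by blast
    then have "elts (f (sc n)) = (\<Union>y\<in>elts (f n). elts y)" using f(3) U[OF f_in[OF n(1)]] by simp
    then have "elts y \<subseteq> elts (f (sc n))" using n(2) by blast
    then show ?thesis using sc_omega[OF n(1)] by blast
  qed
  then have "transitive (St ?T)" using T by (simp add: transitive_def)
  moreover have "x \<in> ?T" using f(2) assms by (intro UN_I[of zero]) auto
  ultimately show ?thesis using T by (intro exI[of _ "St ?T"]) simp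
qed

lemma transitive_Int:
  "transitive T \<Longrightarrow> D (\<lambda>e. R (e 0)) \<Longrightarrow> (\<And>x y. x \<in> elts T \<Longrightarrow> R x \<Longrightarrow> y \<in> elts x \<Longrightarrow> R y) \<Longrightarrow>
    transitive (St {x \<in> elts T. R x}) \<and> elts (St {x \<in> elts T. R x}) = {x \<in> elts T. R x}"
  using setlike_sep[of "elts T" R] unfolding transitive_def by auto

lemma transitiveD: "transitive T \<Longrightarrow> x \<in> elts T \<Longrightarrow> y \<in> elts x \<Longrightarrow> y \<in> elts T"
  by (auto simp: transitive_def)

text \<open>The intersection of all transitive sets containing \<open>x\<close>, cut out of one of
  them by separation.\<close>

lemma ex_trancl: assumes "x \<in> M" shows "\<exists>T. is_trancl x T"
proof -
  obtain U where U: "transitive U" "x \<in> elts U" using ex_transitive[OF assms] by blast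
  let ?R = "\<lambda>z. \<forall>U\<in>M. transitive U \<and> x \<in> elts U \<longrightarrow> z \<in> elts U"
  have "D (\<lambda>e. ?R (e 0))"
    by (intro def_intros atom_set order_refl assms)
  from transitive_Int[OF U(1) this] have "transitive (St {z \<in> elts U. ?R z})"
    "elts (St {z \<in> elts U. ?R z}) = {z \<in> elts U. ?R z}" using transitiveD by blast+
  then show ?thesis using U transitive_in unfolding is_trancl_def
    by (intro exI[of _ "St {z \<in> elts U. ?R z}"]) auto
qed

text \<open>Foundation speaks of sets only. Inside a transitive set around a counterexample the
  counterexamples form a set, and a minimal one there is minimal outright, since its elements lie in
  the transitive set too.\<close>

lemma eps_induct:
  assumes "x \<in> M" "D (\<lambda>e. R (e 0))" "\<And>x. x \<in> M \<Longrightarrow> (\<And>y. y \<in> elts x \<Longrightarrow> R y) \<Longrightarrow> R x"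
  shows "R x"
proof (rule ccontr)
  assume x: "\<not> R x"
  obtain T where T: "transitive T" "x \<in> elts T" using ex_transitive[OF assms(1)] by blast
  have "setlike {z \<in> elts T. \<not> R z}"
    using T by (intro setlike_sep setlike_elts Def_not assms(2)) (simp add: transitive_def)
  from foundation_setlike[OF this] obtain y where
    y: "y \<in> elts T" "\<not> R y" "elts y \<inter> {z \<in> elts T. \<not> R z} = {}" using x T by blast
  then have "R z" if "z \<in> elts y" for z using that transitiveD[OF T(1) y(1)] by blast
  with assms(3)[of y] y(1,2) elts_in show False by blast
qed

text \<open>As for \<open>omega_recursion\<close>, a value at \<open>x\<close> is certified by a set of justified pairs.\<close>

lemma eps_recursion:
  assumes h: "DTM (\<lambda>e. h (e 0))" and \<alpha>: "DTM (\<lambda>e. \<alpha> (e 0))"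
  shows "\<exists>f. DTM (\<lambda>e. f (e 0)) \<and> (\<forall>x\<in>elts A. f x = \<alpha> x) \<and>
    (\<forall>x. is_set x \<longrightarrow> codes (f x) ((\<lambda>s. h (f s)) ` elts x))"
proof -
  have h_in: "h x \<in> M" if "x \<in> M" for x using DT_in[OF h, of "\<lambda>_. x"] that by auto
  have \<alpha>_in: "\<alpha> x \<in> M" if "x \<in> M" for x using DT_in[OF \<alpha>, of "\<lambda>_. x"] that by auto
  \<comment> \<open>\<open>C a x y\<close> justifies the value \<open>y\<close> at \<open>x\<close>
    by pairs found in \<open>a\<close>. It persists when \<open>a\<close> grows, so that
    certificates for different points can be merged.\<close>
  define C where "C a x y \<longleftrightarrow> (if x \<in> elts A then y = \<alpha> x else is_set y \<and>
    (\<forall>s\<in>elts x. \<exists>w\<in>M. pr s w \<in> elts a \<and> h w \<in> elts y) \<and>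
    (\<forall>v\<in>elts y. \<exists>s\<in>elts x. \<exists>w\<in>M. pr s w \<in> elts a \<and> v = h w))" for a x y
  define J where "J a \<longleftrightarrow> (\<forall>z\<in>elts a. \<exists>x\<in>M. \<exists>y\<in>M. z = pr x y \<and> C a x y)" for a
  define R where "R x y \<longleftrightarrow> (\<exists>a\<in>M. pr x y \<in> elts a \<and> J a)" for x y
  have he: "DTM (\<lambda>e. h (e i))" and ae: "DTM (\<lambda>e. \<alpha> (e i))" for i
    by (rule DT_subst1[OF h DT_var], rule DT_subst1[OF \<alpha> DT_var])
  have DR0: "D (\<lambda>e. R (e 0) (e (Suc 0)))"
    unfolding R_def J_def C_def
    by (intro def_intros he ae atom_set order_refl elts_subset_M)
  have DR: "D (\<lambda>e. R (e i) (e j))" for i j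
    by (rule Def_subst2[of M E M R, OF DR0 DT_var DT_var])
  have C_mono: "C b x y"
    if C: "C a x y" and sub: "\<And>s w. s \<in> elts x \<Longrightarrow> w \<in> M \<Longrightarrow> pr s w \<in> elts a \<Longrightarrow> pr s w \<in> elts b"
    for a b x y
  proof (cases "x \<in> elts A")
    case False
    then have "is_set y" "\<forall>s\<in>elts x. \<exists>w\<in>M. pr s w \<in> elts a \<and> h w \<in> elts y"
      "\<forall>v\<in>elts y. \<exists>s\<in>elts x. \<exists>w\<in>M. pr s w \<in> elts a \<and> v = h w" using C by (auto simp: C_def)
    then show ?thesis using False sub unfolding C_def by meson
  qed (use C in \<open>simp add: C_def\<close>)
  have RD: "\<exists>a\<in>M. J a \<and> C a x y" if "R x y" "x \<in> M" "y \<in> M" for x y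
  proof -
    obtain a where a: "a \<in> M" "pr x y \<in> elts a" "J a" using \<open>R x y\<close> unfolding R_def by blast
    then obtain x' y' where "x' \<in> M" "y' \<in> M" "pr x y = pr x' y'" "C a x' y'" unfolding J_def by blast
    then show ?thesis using that a by auto
  qed
  have RI: "R x y" if "a \<in> M" "pr x y \<in> elts a" "J a" for a x y
    using that unfolding R_def by blast
  have uniq: "\<forall>y\<in>M. \<forall>y'\<in>M. R x y \<longrightarrow> R x y' \<longrightarrow> y = y'" if "x \<in> M" for x
    using that
  proof (rule eps_induct)
    show "D (\<lambda>e. \<forall>y\<in>M. \<forall>y'\<in>M. R (e 0) y \<longrightarrow> R (e 0) y' \<longrightarrow> y = y')"
      by (intro def_intros DR)
    fix x assume x: "x \<in> M" and IH: "\<And>s. s \<in> elts x \<Longrightarrow> \<forall>y\<in>M. \<forall>y'\<in>M. R s y \<longrightarrow> R s y' \<longrightarrow> y = y'"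
    have sub: "elts y \<subseteq> elts y'"
      if y: "y \<in> M" "y' \<in> M" "R x y" "R x y'" "x \<notin> elts A" for y y'
    proof
      fix v assume v: "v \<in> elts y"
      obtain a where a: "a \<in> M" "J a" "C a x y" using RD[OF y(3) x y(1)] by blast
      obtain b where b: "b \<in> M" "J b" "C b x y'" using RD[OF y(4) x y(2)] by blast
      obtain s w where s: "s \<in> elts x" "w \<in> M" "pr s w \<in> elts a" "v = h w"
        using a(3) v y(5) unfolding C_def by auto
      obtain w' where w': "w' \<in> M" "pr s w' \<in> elts b" "h w' \<in> elts y'"
        using b(3) s(1) y(5) unfolding C_def by auto
      have "w = w'" using IH[OF s(1)] s(2) w'(1) RI[OF a(1) s(3) a(2)] RI[OF b(1) w'(2) b(2)] by blast
      then show "v \<in> elts y'" using s(4) w'(3) by simp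
    qed
    show "\<forall>y\<in>M. \<forall>y'\<in>M. R x y \<longrightarrow> R x y' \<longrightarrow> y = y'"
    proof (intro ballI impI)
      fix y y' assume y: "y \<in> M" "y' \<in> M" "R x y" "R x y'"
      obtain a b where "C a x y" "C b x y'" using RD[OF y(3) x y(1)] RD[OF y(4) x y(2)] by blast
      then show "y = y'"
        using sub[OF y] sub[OF y(2,1,4,3)] extensionality by (cases "x \<in> elts A") (auto simp: C_def)
    qed
  qed
  define g where "g x = (THE y. y \<in> M \<and> R x y)" for x
  have g_eq: "R x y \<longleftrightarrow> y = g x" if ex: "\<exists>y\<in>M. R x y" and xy: "x \<in> M" "y \<in> M" for x y
  proof -
    have "\<exists>!y. y \<in> M \<and> R x y" using ex uniq[OF xy(1)] by blast
    from theI'[OF this] have "g x \<in> M" "R x (g x)" by (simp_all add: g_def)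
    then show ?thesis using uniq[OF xy(1)] xy(2) by blast
  qed
  have g_in: "g x \<in> M" if "\<exists>y\<in>M. R x y" "x \<in> M" for x
    using that g_eq[OF that] by blast
  have ex: "\<exists>y\<in>M. R x y" if "x \<in> M" for x
    using that
  proof (rule eps_induct)
    show "D (\<lambda>e. \<exists>y\<in>M. R (e 0) y)"
      by (intro def_intros DR)
    fix x assume x: "x \<in> M" and IH: "\<And>s. s \<in> elts x \<Longrightarrow> \<exists>y\<in>M. R s y"
    obtain T where T: "transitive T" "x \<in> elts T" using ex_transitive[OF x] by blast
    let ?S = "{s \<in> elts T. \<exists>w\<in>M. R s w}"
    have S: "setlike ?S"
      using T(1) by (intro setlike_sep setlike_elts) (auto intro!: Def_ex DR simp: transitive_def)
    have S_D: "s \<in> M" "\<exists>w\<in>M. R s w" if "s \<in> ?S" for s using that elts_in by auto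
    \<comment> \<open>One certificate for all points of \<open>T\<close> that have a value: values
      are unique, so replacement makes the pairs a set, and transitivity of \<open>T\<close> keeps
      their justifications inside it. Adding a pair for \<open>x\<close> completes the step.\<close>
    let ?G = "(\<lambda>s. pr s (g s)) ` ?S"
    have a0: "setlike ?G"
    proof (rule setlike_replace[OF S, where R="\<lambda>s z. \<exists>w\<in>M. R s w \<and> z = pr s w"])
      show "D (\<lambda>e. \<exists>w\<in>M. R (e 0) w \<and> e (Suc 0) = pr (e 0) w)"
        by (intro def_intros DR atom_set order_refl)
      show "pr s (g s) \<in> M" if "s \<in> ?S" for s using that S_D[OF that] g_in by simp
      show "(\<exists>w\<in>M. R s w \<and> z = pr s w) \<longleftrightarrow> z = pr s (g s)" if "s \<in> ?S" "z \<in> M" for s z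
        using g_eq[OF S_D(2,1)[OF that(1)]] g_in[OF S_D(2,1)[OF that(1)]] by blast
    qed
    have in_a0: "pr s w \<in> ?G" if "s \<in> elts T" "w \<in> M" "R s w" for s w
      using that g_eq[of s w] elts_in by (intro image_eqI[of _ _ s]) auto
    have J0: "C (St ?G) s (g s)" if s: "s \<in> ?S" for s
    proof -
      have "R s (g s)" using g_eq[OF S_D(2,1)[OF s]] g_in[OF S_D(2,1)[OF s]] by blast
      from RD[OF this S_D(1)[OF s] g_in[OF S_D(2,1)[OF s]]]
      obtain a where a: "a \<in> M" "J a" "C a s (g s)" by blast
      from a(3) show ?thesis
      proof (rule C_mono)
        fix s' w assume "s' \<in> elts s" "w \<in> M" "pr s' w \<in> elts a"
        then have "pr s' w \<in> ?G" using s transitiveD[OF T(1)] RI[OF a(1) _ a(2)] by (intro in_a0) auto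
        then show "pr s' w \<in> elts (St ?G)" using a0 by simp
      qed
    qed
    define y where "y = (if x \<in> elts A then \<alpha> x else St ((\<lambda>s. h (g s)) ` elts x))"
    have Y: "setlike ((\<lambda>s. h (g s)) ` elts x)"
    proof (rule setlike_replace[where R="\<lambda>s z. \<exists>w\<in>M. R s w \<and> z = h w"])
      show "D (\<lambda>e. \<exists>w\<in>M. R (e 0) w \<and> e (Suc 0) = h w)"
        by (intro def_intros DR he)
      show "h (g s) \<in> M" if "s \<in> elts x" for s using that g_in IH h_in elts_in by blast
      show "(\<exists>w\<in>M. R s w \<and> z = h w) \<longleftrightarrow> z = h (g s)" if "s \<in> elts x" "z \<in> M" for s z
        using g_eq[OF IH elts_in] g_in[OF IH elts_in] that by blast
    qed (use x in simp)
    have y_in: "y \<in> M" using Y x \<alpha>_in by (simp add: y_def)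
    let ?a = "St (insert (pr x y) ?G)"
    have a: "elts ?a = insert (pr x y) ?G" "?a \<in> M" using a0 x y_in by auto
    have step: "pr s (g s) \<in> elts ?a" "g s \<in> M" if s: "s \<in> elts x" for s
    proof -
      have "R s (g s)" "g s \<in> M" using g_eq[OF IH elts_in] g_in[OF IH elts_in] s by blast+
      then show "pr s (g s) \<in> elts ?a" "g s \<in> M"
        using in_a0[of s "g s"] transitiveD[OF T s] unfolding a by auto
    qed
    have "C ?a x y"
    proof (cases "x \<in> elts A")
      case False
      then have y: "elts y = (\<lambda>s. h (g s)) ` elts x" "is_set y" using Y by (auto simp: y_def)
      have "\<forall>s\<in>elts x. \<exists>w\<in>M. pr s w \<in> elts ?a \<and> h w \<in> (\<lambda>s. h (g s)) ` elts x"
        "\<forall>v\<in>(\<lambda>s. h (g s)) ` elts x. \<exists>s\<in>elts x. \<exists>w\<in>M. pr s w \<in> elts ?a \<and> v = h w"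
        using step by blast+
      then show ?thesis unfolding C_def y(1) using False y(2) by simp
    qed (simp add: C_def y_def)
    moreover have "C ?a s (g s)" if s: "s \<in> ?S" for s
      using J0[OF s] by (rule C_mono) (simp add: a a0)
    ultimately have "J ?a" unfolding J_def a using x y_in S_D g_in by blast
    then have "R x y" using a by (intro RI[of ?a]) auto
    then show "\<exists>y\<in>M. R x y" using y_in by blast
  qed
  define f where "f x = (if x \<in> M then g x else A)" for x
  have f: "f x \<in> M" "R x y \<longleftrightarrow> y = f x" if "x \<in> M" "y \<in> M" for x y
    using that g_in[OF ex] g_eq[OF ex] by (auto simp: f_def)
  have "DTM (\<lambda>e. f (e 0))"
    by (rule DT_graph[where R="\<lambda>y e. R (e 0) y", OF _ DR]) (use f in \<open>auto simp: range_subsetD\<close>)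
  moreover have "f x = \<alpha> x" if "x \<in> elts A" for x
    using RD[of x "f x"] f[of x "f x"] that elts_in[OF that] by (auto simp: C_def f_def g_in[OF ex])
  moreover have "codes (f x) ((\<lambda>s. h (f s)) ` elts x)" if x: "is_set x" for x
  proof -
    have xM: "x \<in> M" "x \<notin> elts A" "f x \<in> M" using x f(1)[of x x] by (auto simp: is_set_def)
    then have "R x (f x)" using f(2)[of x "f x"] by blast
    from RD[OF this xM(1,3)] obtain a where a: "a \<in> M" "J a" "C a x (f x)" by blast
    have w: "w = f s" if "s \<in> elts x" "w \<in> M" "pr s w \<in> elts a" for s w
      using RI[OF a(1) that(3) a(2)] f(2)[of s w] that elts_in by blast
    have "is_set (f x)" "\<forall>s\<in>elts x. \<exists>w\<in>M. pr s w \<in> elts a \<and> h w \<in> elts (f x)"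
      "\<forall>v\<in>elts (f x). \<exists>s\<in>elts x. \<exists>w\<in>M. pr s w \<in> elts a \<and> v = h w"
      using a(3) xM(2) by (auto simp: C_def)
    then show ?thesis using w unfolding codes_def by blast
  qed
  ultimately show ?thesis by blast
qed

section \<open>Countable and infinite sets\<close>

text \<open>HOL functions given by a definable term. On a set such a function has a set as its
  graph, and \<open>ap f\<close> is one for every \<open>f\<close> in \<open>M\<close>, so coded
  functions and these can be exchanged.\<close>

definition tot :: "('a \<Rightarrow> 'a) \<Rightarrow> bool" where "tot F \<longleftrightarrow> DTM (\<lambda>e. F (e 0))"

lemma tot_in: "tot F \<Longrightarrow> x \<in> M \<Longrightarrow> F x \<in> M"
  using DT_in[of M E M "\<lambda>e. F (e 0)" "\<lambda>_. x"] by (auto simp: tot_def)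

lemma tot_term: "tot F \<Longrightarrow> DTM t \<Longrightarrow> DTM (\<lambda>e. F (t e))"
  unfolding tot_def by (rule DT_subst1)

lemma tot_comp: "tot F \<Longrightarrow> tot G \<Longrightarrow> tot (\<lambda>x. F (G x))"
  unfolding tot_def by (rule DT_subst1)

lemma tot_ap: "f \<in> M \<Longrightarrow> tot (ap f)"
  unfolding tot_def by (intro def_intros atom_set order_refl)

lemma tot_const: "c \<in> M \<Longrightarrow> tot (\<lambda>_. c)"
  unfolding tot_def by (intro DT_param order_refl)

lemma setlike_tot_image: "setlike X \<Longrightarrow> tot F \<Longrightarrow> setlike (F ` X)"
  unfolding tot_def by (rule setlike_image)

lemma omega_recursion_tot:
  assumes "tot F" "x0 \<in> M"
  obtains f where "tot f" "f zero = x0" "\<And>n. n \<in> \<omega> \<Longrightarrow> f (sc n) = F (f n)"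
  using omega_recursion[of F x0] assms unfolding tot_def by blast

lemma D_elts: "x \<in> M \<Longrightarrow> DTM t \<Longrightarrow> D (\<lambda>e. t e \<in> elts x)"
  by (intro def_intros atom_set order_refl)

definition graph :: "('a \<Rightarrow> 'a) \<Rightarrow> 'a set \<Rightarrow> 'a" where
  "graph F X = St ((\<lambda>x. pr x (F x)) ` X)"

lemma setlike_graph:
  assumes "tot F" "setlike X" shows "setlike ((\<lambda>x. pr x (F x)) ` X)"
  by (intro setlike_image DT_pr atom_set order_refl DT_var tot_term[OF assms(1) DT_var] assms(2))

lemma graph_in: "tot F \<Longrightarrow> setlike X \<Longrightarrow> graph F X \<in> M"
  by (simp add: graph_def setlike_graph)

lemma is_set_graph: "tot F \<Longrightarrow> setlike X \<Longrightarrow> is_set (graph F X)"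
  by (simp add: graph_def setlike_graph)

lemma elts_graph: "tot F \<Longrightarrow> setlike X \<Longrightarrow> elts (graph F X) = (\<lambda>x. pr x (F x)) ` X"
  by (simp add: graph_def setlike_graph)

lemma app_graph:
  assumes "tot F" "setlike X" shows "app (graph F X) x y \<longleftrightarrow> x \<in> X \<and> y = F x"
proof -
  have "X \<subseteq> M" using setlike_subset_M[OF assms(2)] .
  then show ?thesis unfolding app_iff elts_graph[OF assms] using tot_in[OF assms(1)] by auto
qed

lemma fn_graph:
  assumes "tot F" "setlike X" "elts d = X" "F ` X \<subseteq> Y" shows "fn (graph F X) d Y"
  unfolding fn_def app_graph[OF assms(1,2)] elts_graph[OF assms(1,2)] is_pair_iff assms(3)
  using is_set_graph[OF assms(1,2)] assms(4) setlike_subset_M[OF assms(2)] tot_in[OF assms(1)]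
  by blast

lemma fnD:
  assumes "fn f d Y"
  shows "is_set f" "f \<in> M" "x \<in> elts d \<Longrightarrow> ap f x \<in> Y" "app f x y \<longleftrightarrow> x \<in> elts d \<and> y = ap f x"
    "x \<in> elts d \<Longrightarrow> app f x (ap f x)"
proof -
  show "is_set f" "f \<in> M" using assms by (auto simp: fn_def is_set_def)
  have dom: "x \<in> elts d \<and> y \<in> Y" if "app f x y" for x y
  proof -
    have m: "x \<in> M" "y \<in> M" "pr x y \<in> elts f" using that by (auto simp: app_iff)
    then obtain x' y' where xy: "x' \<in> elts d" "y' \<in> Y" "is_pair (pr x y) x' y'"
      using assms unfolding fn_def by blast
    then have "x = x'" "y = y'" using m unfolding is_pair_iff by auto
    with xy show ?thesis by simp
  qed
  have ap: "app f x (ap f x)" if "x \<in> elts d" for x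
  proof -
    have ex: "\<exists>!y. app f x y" using assms that by (simp add: fn_def)
    then show ?thesis using theI'[OF ex] by (simp add: ap_def)
  qed
  show "x \<in> elts d \<Longrightarrow> app f x (ap f x)" "x \<in> elts d \<Longrightarrow> ap f x \<in> Y" using ap dom by blast+
  show "app f x y \<longleftrightarrow> x \<in> elts d \<and> y = ap f x"
  proof
    assume a: "app f x y"
    then have "x \<in> elts d" using dom by blast
    then have "\<exists>!y. app f x y" using assms by (simp add: fn_def)
    then show "x \<in> elts d \<and> y = ap f x" using a ap[OF \<open>x \<in> elts d\<close>] \<open>x \<in> elts d\<close> by blast
  qed (use ap in blast)
qed

lemma fn_elts: assumes "fn f d Y" shows "elts f = (\<lambda>x. pr x (ap f x)) ` elts d"
proof (rule set_eqI)
  fix z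
  show "z \<in> elts f \<longleftrightarrow> z \<in> (\<lambda>x. pr x (ap f x)) ` elts d"
  proof
    assume z: "z \<in> elts f"
    then obtain x y where "x \<in> elts d" "x \<in> M" "y \<in> M" "z = pr x y"
      using assms unfolding fn_def is_pair_iff by blast
    then have "app f x y" using z by (simp add: app_iff)
    then have "z = pr x (ap f x)" using fnD(4)[OF assms] \<open>z = pr x y\<close> by simp
    then show "z \<in> (\<lambda>x. pr x (ap f x)) ` elts d" using \<open>x \<in> elts d\<close> by blast
  next
    assume "z \<in> (\<lambda>x. pr x (ap f x)) ` elts d"
    then show "z \<in> elts f" using fnD(5)[OF assms] by (auto simp: app_iff)
  qed
qed

lemma injective_iff: "fn f d Y \<Longrightarrow> injective f \<longleftrightarrow> inj_on (ap f) (elts d)"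
  unfolding injective_def inj_on_def by (auto simp: fnD(4))

lemma bijection_iff: "fn f x (elts y) \<Longrightarrow> bijection f x y \<longleftrightarrow> bij_betw (ap f) (elts x) (elts y)"
  unfolding bijection_def bij_betw_def using injective_iff[of f x "elts y"] fnD(3)[of f x "elts y"]
  by (auto simp: fnD(4))

lemma ap_graph: "tot F \<Longrightarrow> setlike X \<Longrightarrow> x \<in> X \<Longrightarrow> ap (graph F X) x = F x"
  using fnD(4)[OF fn_graph[of F X "St X" "F ` X"], of x "F x"] app_graph[of F X x "F x"] by simp

text \<open>Countability through class functions, which compose freely;
  \<open>is_countable_iff\<close> returns to coded functions.\<close>

definition ctb :: "'a set \<Rightarrow> bool" where
  "ctb X \<longleftrightarrow> (\<exists>F. tot F \<and> F ` X \<subseteq> \<omega> \<and> inj_on F X)"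

text \<open>Dedekind infinity, the form in which infinite sets can be split. By choice in the
  universe it is the negation of finiteness; see \<open>infin_not_finite\<close> and
  \<open>not_finite_infin\<close>.\<close>

definition infin :: "'a set \<Rightarrow> bool" where
  "infin X \<longleftrightarrow> (\<exists>F. tot F \<and> F ` \<omega> \<subseteq> X \<and> inj_on F \<omega>)"

lemma ctbI: "tot F \<Longrightarrow> (\<And>x. x \<in> X \<Longrightarrow> F x \<in> \<omega>) \<Longrightarrow> inj_on F X \<Longrightarrow> ctb X"
  unfolding ctb_def by (intro exI[of _ F] conjI image_subsetI)

lemma ctbE:
  assumes "ctb X"
  obtains F where "tot F" "\<And>x. x \<in> X \<Longrightarrow> F x \<in> \<omega>" "inj_on F X"
  using assms unfolding ctb_def by (elim exE conjE) (simp add: image_subset_iff)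

lemma infinI: "tot F \<Longrightarrow> (\<And>n. n \<in> \<omega> \<Longrightarrow> F n \<in> X) \<Longrightarrow> inj_on F \<omega> \<Longrightarrow> infin X"
  unfolding infin_def by (intro exI[of _ F] conjI image_subsetI)

lemma infinE:
  assumes "infin X"
  obtains F where "tot F" "\<And>n. n \<in> \<omega> \<Longrightarrow> F n \<in> X" "inj_on F \<omega>"
  using assms unfolding infin_def by (elim exE conjE) (simp add: image_subset_iff)

lemma is_countable_iff: assumes "x \<in> M" shows "is_countable x \<longleftrightarrow> ctb (elts x)"
proof
  assume "is_countable x"
  then obtain f where f: "fn f x \<omega>" "injective f" by (auto simp: is_countable_def)
  then show "ctb (elts x)"
    using injective_iff[OF f(1)] by (intro ctbI[of "ap f"] tot_ap fnD(2,3)[OF f(1)]) simp_all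
next
  assume "ctb (elts x)"
  then obtain F where F: "tot F" "\<And>y. y \<in> elts x \<Longrightarrow> F y \<in> \<omega>" "inj_on F (elts x)" by (rule ctbE) (rule that; blast) 
  have fn: "fn (graph F (elts x)) x \<omega>" using F assms by (intro fn_graph) auto
  moreover have "injective (graph F (elts x))"
    unfolding injective_iff[OF fn] using F assms by (simp add: inj_on_def ap_graph)
  ultimately show "is_countable x" by (auto simp: is_countable_def)
qed

lemma is_finite_iff:
  assumes "x \<in> M" shows "is_finite x \<longleftrightarrow> (\<exists>n\<in>\<omega>. \<exists>F. tot F \<and> bij_betw F (elts x) (elts n))"
proof
  assume "is_finite x"
  then obtain n f where f: "n \<in> \<omega>" "bijection f x n" by (auto simp: is_finite_def)
  then have "fn f x (elts n)" by (simp add: bijection_def)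
  then show "\<exists>n\<in>\<omega>. \<exists>F. tot F \<and> bij_betw F (elts x) (elts n)"
    using tot_ap[OF fnD(2)] bijection_iff f by blast
next
  assume "\<exists>n\<in>\<omega>. \<exists>F. tot F \<and> bij_betw F (elts x) (elts n)"
  then obtain n F where F: "n \<in> \<omega>" "tot F" "bij_betw F (elts x) (elts n)" by blast
  have fn: "fn (graph F (elts x)) x (elts n)"
    using F assms by (intro fn_graph) (auto simp: bij_betw_def)
  have "bij_betw (ap (graph F (elts x))) (elts x) (elts n)"
    using F(3) by (rule iffD1[OF bij_betw_cong, rotated]) (simp add: ap_graph F assms)
  then show "is_finite x" using bijection_iff[OF fn] F(1) by (auto simp: is_finite_def)
qed

text \<open>The graph with its pairs reversed is a set by replacement, and \<open>ap\<close> reads a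
  total definable function off it.\<close>

lemma tot_inverse:
  assumes "setlike X" "tot F" "inj_on F X" shows "\<exists>G. tot G \<and> (\<forall>x\<in>X. G (F x) = x)"
proof -
  let ?g = "(\<lambda>x. pr (F x) x) ` X"
  have g: "setlike ?g"
    by (intro setlike_image DT_pr atom_set order_refl DT_var tot_term[OF assms(2) DT_var] assms(1))
  have XM: "X \<subseteq> M" using setlike_subset_M[OF assms(1)] .
  have app: "app (St ?g) (F x) y \<longleftrightarrow> y = x" if "x \<in> X" for x y
  proof
    assume "app (St ?g) (F x) y"
    then obtain x' where x': "x' \<in> X" "pr (F x) y = pr (F x') x'" "y \<in> M" using g by (auto simp: app_iff)
    moreover have "x \<in> M" "x' \<in> M" using x'(1) that XM by auto
    ultimately have "F x = F x'" "y = x'" using tot_in[OF assms(2)] by auto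
    then show "y = x" using inj_onD[OF assms(3)] that x'(1) by blast
  next
    assume "y = x"
    then show "app (St ?g) (F x) y" using g that XM tot_in[OF assms(2)] by (auto simp: app_iff)
  qed
  have "ap (St ?g) (F x) = x" if "x \<in> X" for x
  proof -
    have "app (St ?g) (F x) = (\<lambda>y. y = x)" using app[OF that] by blast
    then show ?thesis by (simp add: ap_def)
  qed
  then show ?thesis using tot_ap[OF St_in[OF g]] by blast
qed

text \<open>Doubling, and doubling plus one. The even and odd numbers serve to merge two
  enumerations and to split one.\<close>

lemma ex_doubling:
  "\<exists>F G. tot F \<and> tot G \<and> F ` \<omega> \<subseteq> \<omega> \<and> G ` \<omega> \<subseteq> \<omega> \<and> inj_on F \<omega> \<and> inj_on G \<omega> \<and> F ` \<omega> \<inter> G ` \<omega> = {}"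
proof -
  have "tot (\<lambda>n. sc (sc n))" unfolding tot_def by (intro def_intros atom_set order_refl)
  from omega_recursion_tot[OF this zero_in] obtain F where
    F: "tot F" "F zero = zero" "\<And>n. n \<in> \<omega> \<Longrightarrow> F (sc n) = sc (sc (F n))" by blast
  have Fe: "DTM (\<lambda>e. F (e i))" for i by (rule tot_term[OF F(1) DT_var])
  let ?G = "\<lambda>n. sc (F n)"
  have G: "tot ?G" unfolding tot_def by (intro def_intros atom_set order_refl Fe)
  have F_om: "F n \<in> \<omega>" if "n \<in> \<omega>" for n
    using that
  proof (induction rule: omega_induct)
    case D
    show ?case by (intro def_intros atom_set order_refl Fe)
  qed (simp_all add: F)
  have F_inj: "\<forall>m\<in>\<omega>. F n = F m \<longrightarrow> n = m" if "n \<in> \<omega>" for n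
    using that
  proof (induction rule: omega_induct)
    case D
    show ?case by (intro def_intros atom_set order_refl Fe class_subsets)
  next
    case zero
    show ?case
    proof (intro ballI impI)
      fix m assume m: "m \<in> \<omega>" "F zero = F m"
      show "zero = m" using omega_cases[OF m(1)] m(2) F F_om by auto
    qed
  next
    case (sc n)
    show ?case
    proof (intro ballI impI)
      fix m assume m: "m \<in> \<omega>" "F (sc n) = F m"
      show "sc n = m" using omega_cases[OF m(1)]
      proof
        assume "m = zero"
        then show ?thesis using m F sc.hyps F_om[OF sc.hyps] by simp
      next
        assume "\<exists>k\<in>\<omega>. m = sc k"
        then obtain k where k: "k \<in> \<omega>" "m = sc k" by blast
        then have "sc (sc (F n)) = sc (sc (F k))" using m F sc.hyps by simp
        then have "F n = F k"
          using sc_inject[of "sc (F n)" "sc (F k)"] sc_inject[of "F n" "F k"] F_om k(1) sc.hyps by simp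
        then show ?thesis using sc.IH k by blast
      qed
    qed
  qed
  have disj: "\<forall>m\<in>\<omega>. F n \<noteq> sc (F m)" if "n \<in> \<omega>" for n
    using that
  proof (induction rule: omega_induct)
    case D
    show ?case by (intro def_intros atom_set order_refl Fe class_subsets)
  next
    case zero
    then show ?case using F F_om by simp
  next
    case (sc n)
    show ?case
    proof (intro ballI notI)
      fix m assume m: "m \<in> \<omega>" "F (sc n) = sc (F m)"
      then have "sc (F n) = F m"
        using sc_inject[of "sc (F n)" "F m"] F F_om sc.hyps by simp
      show False using omega_cases[OF m(1)]
      proof
        assume "m = zero"
        then show ?thesis using \<open>sc (F n) = F m\<close> F sc.hyps F_om[OF sc.hyps] by simp
      next
        assume "\<exists>k\<in>\<omega>. m = sc k"
        then obtain k where k: "k \<in> \<omega>" "m = sc k" by blast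
        then have "sc (F n) = sc (sc (F k))" using \<open>sc (F n) = F m\<close> F by simp
        then have "F n = sc (F k)" using sc_inject[of "F n" "sc (F k)"] F_om k(1) sc.hyps by simp
        then show ?thesis using sc.IH k(1) by blast
      qed
    qed
  qed
  have "inj_on F \<omega>" using F_inj by (auto simp: inj_on_def)
  moreover have "inj_on ?G \<omega>"
  proof (rule inj_onI)
    fix x y assume "x \<in> \<omega>" "y \<in> \<omega>" "sc (F x) = sc (F y)"
    then show "x = y" using sc_inject[of "F x" "F y"] F_inj[of x] F_om by simp
  qed
  moreover have "F ` \<omega> \<inter> ?G ` \<omega> = {}" using disj by blast
  ultimately show ?thesis using F(1) G F_om sc_omega by (intro exI[of _ F] exI[of _ ?G]) auto
qed

lemma ctb_subset: "ctb X \<Longrightarrow> Y \<subseteq> X \<Longrightarrow> ctb Y"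
  unfolding ctb_def by (meson image_mono inj_on_subset subset_trans)

lemma ctb_single: "ctb {a}"
  unfolding ctb_def by (intro exI[of _ "\<lambda>_. zero"] conjI tot_const) auto

text \<open>Even codes for \<open>X\<close>, odd codes for the rest; membership in the set
  \<open>X\<close> is a definable case distinction.\<close>

lemma ctb_Un: assumes "setlike X" "ctb X" "ctb Y" shows "ctb (X \<union> Y)"
proof -
  obtain F G where FG: "tot F" "tot G" "F ` \<omega> \<subseteq> \<omega>" "G ` \<omega> \<subseteq> \<omega>" "inj_on F \<omega>" "inj_on G \<omega>"
    "F ` \<omega> \<inter> G ` \<omega> = {}" using ex_doubling by (elim exE conjE) (rule that)
  obtain f where f: "tot f" "\<And>x. x \<in> X \<Longrightarrow> f x \<in> \<omega>" "inj_on f X" using assms(2) by (rule ctbE) (rule that; blast)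
  obtain g where g: "tot g" "\<And>x. x \<in> Y \<Longrightarrow> g x \<in> \<omega>" "inj_on g Y" using assms(3) by (rule ctbE) (rule that; blast)
  note fg = f g
  let ?h = "\<lambda>x. if x \<in> X then F (f x) else G (g x)"
  have h: "F (f x) \<in> \<omega>" "f x \<in> \<omega>" if "x \<in> X" for x using image_subset_iff[THEN iffD1, OF FG(3)] fg(2)[OF that] by auto
  have g: "G (g y) \<in> \<omega>" "g y \<in> \<omega>" if "y \<in> Y" for y using image_subset_iff[THEN iffD1, OF FG(4)] fg(5)[OF that] by auto
  have "tot ?h"
    unfolding tot_def
    by (intro DT_if D_setlike[OF assms(1)] DT_var tot_term[OF FG(1)] tot_term[OF FG(2)]
        tot_term[OF fg(1)] tot_term[OF fg(4)])
  moreover have "?h ` (X \<union> Y) \<subseteq> \<omega>"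
  proof
    fix z assume "z \<in> ?h ` (X \<union> Y)"
    then obtain x where "x \<in> X \<union> Y" "z = ?h x" by blast
    then show "z \<in> \<omega>" using h(1)[of x] g(1)[of x] by (cases "x \<in> X") simp_all
  qed
  moreover have "inj_on ?h (X \<union> Y)"
  proof (rule inj_onI)
    fix x y assume xy: "x \<in> X \<union> Y" "y \<in> X \<union> Y" and eq: "?h x = ?h y"
    have disj: "F (f x) \<noteq> G (g y)" if "x \<in> X" "y \<in> Y" for x y
      using that h(2) g(2) FG(7) by blast
    consider "x \<in> X" "y \<in> X" "F (f x) = F (f y)" | "x \<in> Y" "y \<in> Y" "G (g x) = G (g y)"
      | "x \<in> X" "y \<in> Y" "F (f x) = G (g y)" | "y \<in> X" "x \<in> Y" "F (f y) = G (g x)"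
      using xy eq by (cases "x \<in> X"; cases "y \<in> X") simp_all
    then show "x = y"
    proof cases
      case 1
      then have "f x = f y" using inj_onD[OF FG(5)] h(2) by blast
      then show ?thesis using inj_onD[OF fg(3)] 1 by blast
    next
      case 2
      then have "g x = g y" using inj_onD[OF FG(6)] g(2) by blast
      then show ?thesis using inj_onD[OF fg(6)] 2 by blast
    qed (use disj in blast)+
  qed
  ultimately show ?thesis unfolding ctb_def by (intro exI[of _ ?h] conjI)
qed

lemma infin_mono: "infin X \<Longrightarrow> X \<subseteq> Y \<Longrightarrow> infin Y"
  unfolding infin_def by (meson subset_trans)

text \<open>Of an injective sequence in \<open>X\<close>, the terms with even index form
  \<open>S\<close> and those with odd index stay outside.\<close>

lemma infin_split:
  assumes "infin X" shows "\<exists>S \<subseteq> X. setlike S \<and> ctb S \<and> infin S \<and> infin (X - S)"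
proof -
  obtain F G where FG: "tot F" "tot G" "F ` \<omega> \<subseteq> \<omega>" "G ` \<omega> \<subseteq> \<omega>" "inj_on F \<omega>" "inj_on G \<omega>"
    "F ` \<omega> \<inter> G ` \<omega> = {}" using ex_doubling by (elim exE conjE) (rule that)
  obtain d where d: "tot d" "\<And>n. n \<in> \<omega> \<Longrightarrow> d n \<in> X" "inj_on d \<omega>" using assms by (rule infinE) (rule that; blast)
  have F: "F n \<in> \<omega>" and G: "G n \<in> \<omega>" if "n \<in> \<omega>" for n using FG(3,4) that by auto
  let ?S = "(\<lambda>n. d (F n)) ` \<omega>"
  have S: "setlike ?S" by (intro setlike_tot_image setlike_omega tot_comp[OF d(1) FG(1)])
  have inj: "inj_on (\<lambda>n. d (F n)) \<omega>" "inj_on (\<lambda>n. d (G n)) \<omega>"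
    using comp_inj_on[OF FG(5) inj_on_subset[OF d(3) FG(3)]]
      comp_inj_on[OF FG(6) inj_on_subset[OF d(3) FG(4)]] by (simp_all add: comp_def)
  have "infin ?S" by (rule infinI[OF tot_comp[OF d(1) FG(1)] _ inj(1)]) blast
  moreover have "d (G n) \<notin> ?S" if "n \<in> \<omega>" for n
  proof
    assume "d (G n) \<in> ?S"
    then obtain m where "m \<in> \<omega>" "d (G n) = d (F m)" by blast
    then have "G n = F m" using inj_onD[OF d(3) _ G[OF that] F[of m]] by simp
    then show False using FG(7) \<open>m \<in> \<omega>\<close> that by blast
  qed
  then have "infin (X - ?S)"
    by (intro infinI[OF tot_comp[OF d(1) FG(2)] _ inj(2)] DiffI d(2) G)
  moreover have "ctb ?S"
  proof -
    obtain H where H: "tot H" "\<forall>n\<in>\<omega>. H (d (F n)) = n"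
      using tot_inverse[OF setlike_omega tot_comp[OF d(1) FG(1)] inj(1)] by blast
    then show ?thesis by (intro ctbI[OF H(1)]) (auto simp: inj_on_def)
  qed
  moreover have "?S \<subseteq> X" using d(2) F by auto
  ultimately show ?thesis using S by (intro exI[of _ ?S] conjI)
qed

text \<open>Of two disjoint infinite parts, at least one does not contain \<open>b\<close>.\<close>

lemma infin_remove: assumes "infin X" shows "infin (X - {b})"
proof -
  obtain S where S: "S \<subseteq> X" "infin S" "infin (X - S)" using infin_split[OF assms] by blast
  show ?thesis
  proof (cases "b \<in> S")
    case True
    then show ?thesis by (intro infin_mono[OF S(3)]) blast
  next
    case False
    then show ?thesis by (intro infin_mono[OF S(2)]) (use S(1) in blast)
  qed
qed

text \<open>\<open>infin\<close> quantifies over HOL functions. Coding the sequence by its graph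
  replaces it by an element of \<open>M\<close>, which makes the property definable for
  sets.\<close>

lemma infin_elts_iff: assumes "x \<in> M" shows "infin (elts x) \<longleftrightarrow> (\<exists>f\<in>M. fn f om (elts x) \<and> injective f)"
proof
  assume "infin (elts x)"
  then obtain F where F: "tot F" "\<And>n. n \<in> \<omega> \<Longrightarrow> F n \<in> elts x" "inj_on F \<omega>" by (rule infinE) (rule that; blast)
  have fn: "fn (graph F \<omega>) om (elts x)" using F by (intro fn_graph) auto
  moreover have "injective (graph F \<omega>)"
    unfolding injective_iff[OF fn] using F by (simp add: inj_on_def ap_graph)
  ultimately show "\<exists>f\<in>M. fn f om (elts x) \<and> injective f" using fnD(2) by blast
next
  assume "\<exists>f\<in>M. fn f om (elts x) \<and> injective f"
  then obtain f where f: "fn f om (elts x)" "injective f" by blast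
  then show "infin (elts x)"
    using injective_iff[OF f(1)] fnD(3)[OF f(1)] by (intro infinI[of "ap f"] tot_ap fnD(2)[OF f(1)]) simp_all
qed

lemma D_infin: "DTM t \<Longrightarrow> D (\<lambda>e. infin (elts (t e)))"
proof (rule Def_subst1[of M E M "\<lambda>x. infin (elts x)"])
  have "D (\<lambda>e. \<exists>f\<in>M. fn f om (elts (e 0)) \<and> injective f)"
    by (intro def_intros atom_set order_refl om_in elts_subset_M)
  then show "D (\<lambda>e. infin (elts (e 0)))"
    by (rule Def.cong) (simp add: infin_elts_iff range_subsetD)
qed

text \<open>In the induction step an infinite \<open>sc n\<close> would stay infinite after removal
  of its last element \<open>n\<close>.\<close>

lemma not_infin_omega: assumes "n \<in> \<omega>" shows "\<not> infin (elts n)"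
  using assms
proof (induction rule: omega_induct)
  case D
  show ?case by (intro Def_not D_infin DT_var)
next
  case zero
  have "\<omega> \<noteq> {}" using zero_omega by blast
  then show ?case by (simp add: infin_def)
next
  case (sc n)
  show ?case
  proof
    assume "infin (elts (sc n))"
    then have "infin (insert n (elts n))" using sc.hyps by simp
    from infin_remove[OF this, of n] have "infin (elts n)" by (rule infin_mono) blast
    with sc.IH show False by simp
  qed
qed

lemma infin_not_finite: assumes "x \<in> M" "infin (elts x)" shows "\<not> is_finite x"
proof
  assume "is_finite x"
  then obtain n F where F: "n \<in> \<omega>" "tot F" "bij_betw F (elts x) (elts n)"
    unfolding is_finite_iff[OF assms(1)] by blast
  obtain d where d: "tot d" "\<And>n. n \<in> \<omega> \<Longrightarrow> d n \<in> elts x" "inj_on d \<omega>"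
    using assms(2) by (rule infinE) (rule that; blast)
  have "inj_on F (d ` \<omega>)"
    by (rule inj_on_subset[OF bij_betw_imp_inj_on[OF F(3)]]) (use d(2) in blast)
  from comp_inj_on[OF d(3) this] have "inj_on (\<lambda>n. F (d n)) \<omega>" by (simp add: comp_def)
  then have "infin (elts n)"
    using bij_betw_apply[OF F(3)] d(2) by (intro infinI[OF tot_comp[OF F(2) d(1)]]) blast+
  with not_infin_omega[OF F(1)] show False by simp
qed

text \<open>Used to pass from injectivity on each number to injectivity on
  \<open>\<omega>\<close>.\<close>

lemma omega_directed: assumes "m \<in> \<omega>" "n \<in> \<omega>" shows "\<exists>k\<in>\<omega>. m \<in> elts k \<and> n \<in> elts k"
proof -
  have mono: "\<forall>m\<in>elts k. sc m \<in> elts (sc k)" if "k \<in> \<omega>" for k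
    using that
  proof (induction rule: omega_induct)
    case D
    show ?case by (intro def_intros atom_set order_refl elts_subset_M)
  next
    case (sc k)
    then show ?case by auto
  qed simp
  have pos: "zero \<in> elts (sc k)" if "k \<in> \<omega>" for k
    using that
  proof (induction rule: omega_induct)
    case D
    show ?case by (intro def_intros atom_set order_refl zero_in)
  qed auto
  show ?thesis using assms(1)
  proof (induction rule: omega_induct)
    case D
    show ?case by (intro def_intros atom_set order_refl class_subsets omega_in assms(2))
  next
    case zero
    show ?case using pos[OF assms(2)] assms(2) by (intro bexI[of _ "sc n"]) auto
  next
    case (sc m)
    then obtain k where k: "k \<in> \<omega>" "m \<in> elts k" "n \<in> elts k" by blast
    then show ?case using mono[OF k(1)] by (intro bexI[of _ "sc k"]) auto
  qed
qed

text \<open>A choice function on the nonempty subsets of \<open>x\<close> picks a new element as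
  long as the earlier ones do not exhaust \<open>x\<close>. The recursion runs through the sets
  \<open>s n\<close> of elements picked before stage \<open>n\<close>, because
  \<open>omega_recursion\<close> hands on only the preceding value.\<close>

lemma not_finite_infin: assumes x: "x \<in> M" "\<not> is_finite x" shows "infin (elts x)"
proof -
  let ?Z = "{y. is_set y \<and> elts y \<subseteq> elts x} - {zero}"
  have Z: "setlike ?Z" by (intro setlike_Diff setlike_Pow) (use x in simp_all)
  have "\<forall>y\<in>elts (St ?Z). elts y \<noteq> {}"
  proof
    fix y assume "y \<in> elts (St ?Z)"
    then have "is_set y" "y \<noteq> zero" unfolding elts_St[OF Z] by simp_all
    then show "elts y \<noteq> {}" using extensionality[OF _ is_set_zero, of y] by auto
  qed
  from choice[OF is_set_St[OF Z] this] obtain c where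
    c: "fn c (St ?Z) M" "\<forall>y\<in>?Z. \<exists>z\<in>elts y. app c y z" unfolding elts_St[OF Z] by blast
  have cM: "c \<in> M" using fnD(2)[OF c(1)] .
  let ?C = "\<lambda>s. St {z. z \<in> elts x \<and> z \<notin> elts s}"
  have C: "setlike {z. z \<in> elts x \<and> z \<notin> elts s}" if "s \<in> M" for s
    using setlike_Diff[of "elts x" "elts s"] x that by (simp add: set_diff_eq)
  let ?d = "\<lambda>s. ap c (?C s)"
  have d_tot: "tot ?d" unfolding tot_def
  proof (intro DT_ap atom_set order_refl DT_param cM DT_St)
    show "D (\<lambda>e. e 0 \<in> {z. z \<in> elts x \<and> z \<notin> elts (e (Suc 0))})"
      by (intro def_intros atom_set order_refl x)
  qed (simp_all add: C range_subsetD)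
  let ?F = "\<lambda>s. St (insert (?d s) (elts s))"
  have "tot ?F" unfolding tot_def
  proof (intro DT_St atom_set order_refl)
    have "DTM (\<lambda>e. ?d (e i))" for i by (rule tot_term[OF d_tot DT_var])
    from this[of "Suc 0"] show "D (\<lambda>e. e 0 \<in> insert (?d (e (Suc 0))) (elts (e (Suc 0))))"
      by (intro Def_insert Def_disj Def_eq[OF DT_var] def_elts[OF atom_set order_refl DT_var DT_var])
  qed (simp add: range_subsetD)
  from omega_recursion_tot[OF this zero_in] obtain s where
    s: "tot s" "s zero = zero" "\<And>n. n \<in> \<omega> \<Longrightarrow> s (sc n) = ?F (s n)" by blast
  define d where "d n = ?d (s n)" for n
  have d: "tot d" unfolding d_def by (rule tot_comp[OF d_tot s(1)])
  have de: "DTM (\<lambda>e. d (e i))" "DTM (\<lambda>e. s (e i))" for i by (rule tot_term[OF d DT_var], rule tot_term[OF s(1) DT_var])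
  have s_in: "s n \<in> M" if "n \<in> \<omega>" for n using tot_in[OF s(1)] that by simp
  have s_eq: "elts (s n) = d ` elts n" if "n \<in> \<omega>" for n
  proof -
    have "\<forall>z\<in>M. z \<in> elts (s n) \<longleftrightarrow> (\<exists>k\<in>elts n. z = d k)"
      using that
    proof (induction rule: omega_induct)
      case D
      show ?case by (intro def_intros atom_set order_refl de elts_subset_M)
    next
      case (sc n)
      then show ?case using s(3)[OF sc.hyps] s_in[OF sc.hyps] by (simp add: d_def)
    qed (simp add: s)
    moreover have "d k \<in> M" if "k \<in> elts n" for k using tot_in[OF d] elts_in[OF that] .
    ultimately show ?thesis using elts_in[of _ "s n"] by (intro set_eqI) (metis image_iff)
  qed
  have main: "(\<forall>k\<in>elts n. d k \<in> elts x) \<and> (\<forall>k\<in>elts n. \<forall>l\<in>elts n. d k = d l \<longrightarrow> k = l)" if "n \<in> \<omega>" for n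
    using that
  proof (induction rule: omega_induct)
    case D
    show ?case by (intro def_intros atom_set order_refl de elts_subset_M x)
  next
    case (sc n)
    have inj: "inj_on d (elts n)" and sub: "d ` elts n \<subseteq> elts x" using sc.IH by (auto simp: inj_on_def)
    obtain G where G: "tot G" "\<forall>k\<in>elts n. G (d k) = k"
      using tot_inverse[OF _ d inj] sc.hyps by auto
    \<comment> \<open>Otherwise the inverse of \<open>d\<close> would be a bijection of
      \<open>x\<close> with \<open>n\<close>.\<close>
    have "elts x \<noteq> d ` elts n"
    proof
      assume eq: "elts x = d ` elts n"
      have "bij_betw G (elts x) (elts n)" unfolding eq
        using G(2) by (intro bij_betw_byWitness[where f'=d]) auto
      then show False using x(2) G(1) sc.hyps unfolding is_finite_iff[OF x(1)] by blast
    qed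
    with sub have "\<not> elts x \<subseteq> d ` elts n" by (simp add: set_eq_subset)
    then obtain y where y: "y \<in> elts x" "y \<notin> d ` elts n" by blast
    have CE: "elts (?C (s n)) = {z. z \<in> elts x \<and> z \<notin> d ` elts n}"
      by (rule trans[OF elts_St[OF C[OF s_in[OF sc.hyps]]]]) (simp only: s_eq[OF sc.hyps])
    have "y \<in> elts (?C (s n))" unfolding CE using y by simp
    then have "elts (?C (s n)) \<noteq> {}" by (metis empty_iff)
    then have "?C (s n) \<noteq> zero" using elts_zero by metis
    moreover have "is_set (?C (s n))" "elts (?C (s n)) \<subseteq> elts x"
      using C[OF s_in[OF sc.hyps]] unfolding CE by auto
    ultimately have "?C (s n) \<in> ?Z" by simp
    then obtain z where "z \<in> elts (?C (s n))" "app c (?C (s n)) z" using c(2) by blast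
    then have "d n \<in> elts (?C (s n))" using fnD(4)[OF c(1)] by (simp add: d_def)
    then have "d n \<in> elts x" "d n \<notin> d ` elts n"
      unfolding CE by simp_all
    then have "inj_on d (insert n (elts n))" "d ` insert n (elts n) \<subseteq> elts x"
      using inj sub by (simp_all add: inj_on_insert mem_irrefl)
    then show ?case
      unfolding elts_sc[OF omega_in[OF sc.hyps]] inj_on_def image_subset_iff by blast
  qed simp
  have "d k \<in> elts x" if "k \<in> \<omega>" for k using main[of "sc k"] that by simp
  moreover have "inj_on d \<omega>"
  proof (rule inj_onI)
    fix k l assume kl: "k \<in> \<omega>" "l \<in> \<omega>" "d k = d l"
    obtain m where "m \<in> \<omega>" "k \<in> elts m" "l \<in> elts m" using omega_directed[OF kl(1,2)] by blast
    then show "k = l" using main[of m] kl(3) by blast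
  qed
  ultimately show ?thesis by (intro infinI[OF d])
qed

section \<open>Permutations of the atoms\<close>

lemma setlike_Times: assumes "setlike X" "setlike Y" shows "setlike {z. \<exists>x\<in>X. \<exists>y\<in>Y. z = pr x y}"
proof -
  let ?P = "{y. is_set y \<and> elts y \<subseteq> X \<union> Y}"
  let ?PP = "{y. is_set y \<and> elts y \<subseteq> ?P}"
  have XY: "X \<subseteq> M" "Y \<subseteq> M" using setlike_subset_M assms by auto
  have PP: "setlike ?PP" by (intro setlike_Pow setlike_Un assms)
  have "pr x y \<in> ?PP" if "x \<in> X" "y \<in> Y" for x y
  proof -
    have xy: "x \<in> M" "y \<in> M" using that XY by auto
    then have "elts (pr x y) = {St {x}, St {x, y}}" by (simp add: pr_def)
    then show ?thesis using that xy by (simp add: is_set_pr)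
  qed
  then have "{z. \<exists>x\<in>X. \<exists>y\<in>Y. z = pr x y} = {z \<in> ?PP. \<exists>x\<in>X. \<exists>y\<in>Y. z = pr x y}" by blast
  also have "setlike \<dots>"
    by (rule setlike_sep[OF PP])
      (intro Def_Bex_class D_setlike assms DT_var XY Def_eq DT_pr atom_set order_refl)
  finally show ?thesis .
qed

lemma permsD:
  assumes "\<pi> \<in> perms"
  shows "fn \<pi> A (elts A)" "\<pi> \<in> M" "bij_betw (ap \<pi>) (elts A) (elts A)"
proof -
  have b: "bijection \<pi> A A" using assms by (simp add: perms_def)
  then show fn: "fn \<pi> A (elts A)" by (simp add: bijection_def)
  show "\<pi> \<in> M" using fnD(2)[OF fn] .
  show "bij_betw (ap \<pi>) (elts A) (elts A)" using b bijection_iff[OF fn] by simp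
qed

lemma perm_graph:
  assumes "tot F" "bij_betw F (elts A) (elts A)"
  shows "graph F (elts A) \<in> perms" "a \<in> elts A \<Longrightarrow> ap (graph F (elts A)) a = F a"
proof -
  have A: "setlike (elts A)" using atom_set by simp
  show eq: "ap (graph F (elts A)) a = F a" if "a \<in> elts A" for a
    by (rule ap_graph[OF assms(1) A that])
  have fn: "fn (graph F (elts A)) A (elts A)"
    by (rule fn_graph[OF assms(1) A refl]) (use assms(2) in \<open>auto simp: bij_betw_def\<close>)
  have "bij_betw (ap (graph F (elts A))) (elts A) (elts A)"
    using assms(2) by (rule iffD1[OF bij_betw_cong, rotated]) (simp add: eq)
  then show "graph F (elts A) \<in> perms" using bijection_iff[OF fn] by (simp add: perms_def)
qed

lemma setlike_perms: "setlike perms"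
proof (rule setlike_subset)
  show "setlike {f. is_set f \<and> elts f \<subseteq> {z. \<exists>x\<in>elts A. \<exists>y\<in>elts A. z = pr x y}}"
    by (intro setlike_Pow setlike_Times setlike_elts' atom_set)
  show "perms \<subseteq> {f. is_set f \<and> elts f \<subseteq> {z. \<exists>x\<in>elts A. \<exists>y\<in>elts A. z = pr x y}}"
  proof
    fix \<pi> assume \<pi>: "\<pi> \<in> perms"
    show "\<pi> \<in> {f. is_set f \<and> elts f \<subseteq> {z. \<exists>x\<in>elts A. \<exists>y\<in>elts A. z = pr x y}}"
      unfolding mem_Collect_eq fn_elts[OF permsD(1)[OF \<pi>]]
      using fnD(1,3)[OF permsD(1)[OF \<pi>]] by blast
  qed
  show "D (\<lambda>e. e 0 \<in> perms)" by (intro def_perms atom_set order_refl DT_var)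
qed

lemma perm_inverse:
  assumes "\<pi> \<in> perms"
  shows "\<exists>\<rho>\<in>perms. \<forall>a\<in>elts A. ap \<rho> (ap \<pi> a) = a \<and> ap \<pi> (ap \<rho> a) = a"
proof -
  note b = permsD(3)[OF assms]
  obtain G where G: "tot G" "\<forall>a\<in>elts A. G (ap \<pi> a) = a"
    using tot_inverse[OF setlike_elts'[OF atom_set] tot_ap[OF permsD(2)[OF assms]]
      bij_betw_imp_inj_on[OF b]] by blast
  have img: "ap \<pi> ` elts A = elts A" using b by (simp add: bij_betw_def)
  have GG: "G a \<in> elts A \<and> ap \<pi> (G a) = a" if a: "a \<in> elts A" for a
  proof -
    obtain c where "c \<in> elts A" "a = ap \<pi> c" using img a by blast
    then show ?thesis using G(2) by simp
  qed
  have bG: "bij_betw G (elts A) (elts A)"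
    by (rule bij_betw_byWitness[where f'="ap \<pi>"]) (use G(2) GG img in auto)
  show ?thesis
  proof (intro bexI ballI)
    fix a assume a: "a \<in> elts A"
    then have "ap \<pi> a \<in> elts A" using img by blast
    then show "ap (graph G (elts A)) (ap \<pi> a) = a \<and> ap \<pi> (ap (graph G (elts A)) a) = a"
      using perm_graph(2)[OF G(1) bG] a GG[OF a] G(2) by simp
  qed (rule perm_graph(1)[OF G(1) bG])
qed

section \<open>The action of permutations on the universe\<close>

definition act :: "'a \<Rightarrow> 'a \<Rightarrow> 'a" where
  "act \<pi> = (SOME f. tot f \<and> (\<forall>x\<in>elts A. f x = ap \<pi> x) \<and> (\<forall>x. is_set x \<longrightarrow> codes (f x) (f ` elts x)))"

lemma act_ex:
  assumes "\<pi> \<in> M"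
  shows "tot (act \<pi>) \<and> (\<forall>x\<in>elts A. act \<pi> x = ap \<pi> x) \<and>
    (\<forall>x. is_set x \<longrightarrow> codes (act \<pi> x) (act \<pi> ` elts x))"
proof -
  \<comment> \<open>The instance of \<open>eps_recursion\<close> in which the values at the elements
    are collected unchanged.\<close>
  have "\<exists>f. tot f \<and> (\<forall>x\<in>elts A. f x = ap \<pi> x) \<and> (\<forall>x. is_set x \<longrightarrow> codes (f x) (f ` elts x))"
    using eps_recursion[of "\<lambda>x. x" "ap \<pi>", OF DT_var] tot_ap[OF assms] unfolding tot_def by simp
  from someI_ex[OF this] show ?thesis unfolding act_def .
qed

lemma act_tot: "\<pi> \<in> M \<Longrightarrow> tot (act \<pi>)"
  using act_ex by blast

lemma act_term: "\<pi> \<in> M \<Longrightarrow> DTM t \<Longrightarrow> DTM (\<lambda>e. act \<pi> (t e))"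
  by (rule tot_term[OF act_tot])

lemma act_in: "\<pi> \<in> M \<Longrightarrow> x \<in> M \<Longrightarrow> act \<pi> x \<in> M"
  using tot_in[OF act_tot] .

lemma act_atom: "\<pi> \<in> M \<Longrightarrow> a \<in> elts A \<Longrightarrow> act \<pi> a = ap \<pi> a"
  using act_ex by blast

lemma act_set: "\<pi> \<in> M \<Longrightarrow> is_set x \<Longrightarrow> codes (act \<pi> x) (act \<pi> ` elts x)"
  using act_ex by blast

lemma act_elts: "\<pi> \<in> M \<Longrightarrow> is_set x \<Longrightarrow> elts (act \<pi> x) = act \<pi> ` elts x"
  using act_set by (simp add: codes_def)

lemma is_set_or_atom: "x \<in> M \<Longrightarrow> is_set x \<or> x \<in> elts A"
  by (simp add: is_set_def)

text \<open>Both sides solve the same recursion. Any witness \<open>g\<close> of \<open>acts\<close>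
  agrees with \<open>act \<pi>\<close> by induction within its transitive domain; conversely the
  graph of \<open>act \<pi>\<close> on a transitive set is a witness.\<close>

lemma acts_iff:
  assumes \<pi>: "\<pi> \<in> perms" and x: "x \<in> M"
  shows "acts \<pi> x y \<longleftrightarrow> y = act \<pi> x"
proof
  note fn = permsD(1)[OF \<pi>] and piM = permsD(2)[OF \<pi>]
  assume "acts \<pi> x y"
  then obtain T g where T: "transitive T" "x \<in> elts T" "fn g T M" "app g x y" and
    rec: "\<And>t u. t \<in> elts T \<Longrightarrow> app g t u \<Longrightarrow>
        (if t \<in> elts A then app \<pi> t u else codes u {w. \<exists>s\<in>elts t. app g s w})"
    unfolding acts_def by blast
  have gM: "g \<in> M" "T \<in> M" using fnD(2)[OF T(3)] transitive_in[OF T(1)] by auto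
  have "t \<in> elts T \<longrightarrow> ap g t = act \<pi> t" if "t \<in> M" for t
    using that
  proof (rule eps_induct)
    show "D (\<lambda>e. e 0 \<in> elts T \<longrightarrow> ap g (e 0) = act \<pi> (e 0))"
      by (intro Def_imp D_elts gM DT_var Def_eq tot_term[OF tot_ap[OF gM(1)]] act_term piM)
    fix t assume tM: "t \<in> M" and IH: "\<And>s. s \<in> elts t \<Longrightarrow> s \<in> elts T \<longrightarrow> ap g s = act \<pi> s"
    show "t \<in> elts T \<longrightarrow> ap g t = act \<pi> t"
    proof
      assume t: "t \<in> elts T"
      note r = rec[OF t fnD(5)[OF T(3) t]]
      show "ap g t = act \<pi> t"
      proof (cases "t \<in> elts A")
        case True
        then show ?thesis using r fnD(4)[OF fn] act_atom[OF piM] by simp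
      next
        case False
        then have "is_set t" using tM is_set_or_atom by blast
        have "{w. \<exists>s\<in>elts t. app g s w} = act \<pi> ` elts t"
          using IH transitiveD[OF T(1) t] fnD(4)[OF T(3)] by auto
        then have "codes (ap g t) (act \<pi> ` elts t)" using r False by simp
        then show ?thesis using codes_unique act_set[OF piM \<open>is_set t\<close>] by blast
      qed
    qed
  qed
  then show "y = act \<pi> x" using x T(2) fnD(4)[OF T(3)] T(4) by simp
next
  note fn = permsD(1)[OF \<pi>] and piM = permsD(2)[OF \<pi>]
  assume y: "y = act \<pi> x"
  obtain T where T: "transitive T" "x \<in> elts T" using ex_transitive[OF x] by blast
  have Ts: "setlike (elts T)" using T(1) by (simp add: transitive_def)
  let ?g = "graph (act \<pi>) (elts T)"
  note app = app_graph[OF act_tot[OF piM] Ts]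
  have "if t \<in> elts A then app \<pi> t u else codes u {w. \<exists>s\<in>elts t. app ?g s w}"
    if t: "t \<in> elts T" and u: "app ?g t u" for t u
  proof (cases "t \<in> elts A")
    case True
    then show ?thesis using u app fnD(5)[OF fn True] act_atom[OF piM True] by simp
  next
    case False
    then have "is_set t" using t elts_in is_set_or_atom by blast
    moreover have "{w. \<exists>s\<in>elts t. app ?g s w} = act \<pi> ` elts t"
      using transitiveD[OF T(1) t] app by auto
    ultimately show ?thesis using False u app act_set[OF piM] by simp
  qed
  moreover have "fn ?g T M"
    by (rule fn_graph[OF act_tot[OF piM] Ts refl]) (use act_in[OF piM] elts_in in blast)
  ultimately show "acts \<pi> x y" unfolding acts_def using T app y by blast
qed

lemma act_comp:
  assumes "\<pi> \<in> perms" "\<sigma> \<in> perms" "\<rho> \<in> perms" "\<And>a. a \<in> elts A \<Longrightarrow> ap \<rho> a = ap \<pi> (ap \<sigma> a)" "x \<in> M"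
  shows "act \<rho> x = act \<pi> (act \<sigma> x)"
  using assms(5)
proof (rule eps_induct)
  note [simp] = permsD(2)[OF assms(1)] permsD(2)[OF assms(2)] permsD(2)[OF assms(3)]
  show "D (\<lambda>e. act \<rho> (e 0) = act \<pi> (act \<sigma> (e 0)))"
    by (intro Def_eq act_term DT_var) simp_all
  fix x assume x: "x \<in> M" and IH: "\<And>y. y \<in> elts x \<Longrightarrow> act \<rho> y = act \<pi> (act \<sigma> y)"
  show "act \<rho> x = act \<pi> (act \<sigma> x)"
  proof (cases "x \<in> elts A")
    case True
    then have "ap \<sigma> x \<in> elts A" using fnD(3)[OF permsD(1)[OF assms(2)]] by blast
    then show ?thesis using True by (simp add: act_atom assms(4))
  next
    case False
    then have s: "is_set x" using x is_set_or_atom by blast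
    have "codes (act \<sigma> x) (act \<sigma> ` elts x)" by (rule act_set) (use s in simp_all)
    then have "is_set (act \<sigma> x)" "elts (act \<sigma> x) = act \<sigma> ` elts x" by (simp_all add: codes_def)
    then have "codes (act \<pi> (act \<sigma> x)) (act \<pi> ` act \<sigma> ` elts x)" using act_set[of \<pi> "act \<sigma> x"] by simp
    moreover have "act \<pi> ` act \<sigma> ` elts x = act \<rho> ` elts x" using IH by force
    moreover have "codes (act \<rho> x) (act \<rho> ` elts x)" using s by (intro act_set) simp_all
    ultimately show ?thesis using codes_unique by metis
  qed
qed

lemma act_pointwise_fixed:
  assumes "\<pi> \<in> M" "is_set x" "\<And>y. y \<in> elts x \<Longrightarrow> act \<pi> y = y" shows "act \<pi> x = x"
proof -
  have "act \<pi> ` elts x = elts x" using assms(3) by force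
  then have "codes (act \<pi> x) (elts x)" using act_set[OF assms(1,2)] by simp
  then show ?thesis using assms(2) St_eq St_elts by metis
qed

lemma act_id:
  assumes "\<iota> \<in> M" "\<And>a. a \<in> elts A \<Longrightarrow> ap \<iota> a = a" "x \<in> M"
  shows "act \<iota> x = x"
  using assms(3)
proof (rule eps_induct)
  show "D (\<lambda>e. act \<iota> (e 0) = e 0)" by (intro Def_eq act_term DT_var assms)
  fix x assume x: "x \<in> M" and IH: "\<And>y. y \<in> elts x \<Longrightarrow> act \<iota> y = y"
  show "act \<iota> x = x"
    using is_set_or_atom[OF x] assms(2) act_atom[OF assms(1)] act_pointwise_fixed[OF assms(1) _ IH] by auto
qed

lemma perm_identity: "\<exists>\<iota>\<in>perms. \<forall>a\<in>elts A. ap \<iota> a = a"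
proof -
  have t: "tot (\<lambda>x. x)" unfolding tot_def by (rule DT_var)
  have b: "bij_betw (\<lambda>x. x) (elts A) (elts A)" by (simp add: bij_betw_def)
  show ?thesis using perm_graph[OF t b] by blast
qed

lemma act_inverse:
  assumes "\<pi> \<in> perms" "\<rho> \<in> perms" "\<And>a. a \<in> elts A \<Longrightarrow> ap \<rho> (ap \<pi> a) = a" "x \<in> M"
  shows "act \<rho> (act \<pi> x) = x"
proof -
  obtain \<iota> where \<iota>: "\<iota> \<in> perms" "\<And>a. a \<in> elts A \<Longrightarrow> ap \<iota> a = a" using perm_identity by blast
  have "act \<iota> x = act \<rho> (act \<pi> x)"
    by (rule act_comp[OF assms(2,1) \<iota>(1) _ assms(4)]) (simp add: \<iota>(2) assms(3))
  then show ?thesis using act_id[OF permsD(2)[OF \<iota>(1)] \<iota>(2) assms(4)] by simp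
qed

lemma act_bij: assumes "\<pi> \<in> perms" shows "bij_betw (act \<pi>) M M"
proof -
  obtain \<rho> where \<rho>: "\<rho> \<in> perms" "\<forall>a\<in>elts A. ap \<rho> (ap \<pi> a) = a \<and> ap \<pi> (ap \<rho> a) = a"
    using perm_inverse[OF assms] by blast
  show ?thesis
    by (rule bij_betw_byWitness[where f'="act \<rho>"])
      (use act_inverse[OF assms \<rho>(1)] act_inverse[OF \<rho>(1) assms] \<rho>(2)
        act_in[OF permsD(2)[OF assms]] act_in[OF permsD(2)[OF \<rho>(1)]] in auto)
qed

lemma act_inj: "\<pi> \<in> perms \<Longrightarrow> x \<in> M \<Longrightarrow> y \<in> M \<Longrightarrow> act \<pi> x = act \<pi> y \<Longrightarrow> x = y"
  using bij_betw_imp_inj_on[OF act_bij] by (auto dest: inj_onD)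

text \<open>Together with \<open>act_bij\<close> this makes \<open>act \<pi>\<close> an
  automorphism. Atoms are no exception: they are empty and go to atoms.\<close>

lemma act_mem:
  assumes "\<pi> \<in> perms" "x \<in> M" "y \<in> M"
  shows "E (act \<pi> x) (act \<pi> y) = E x y"
proof -
  note piM = permsD(2)[OF assms(1)]
  have E: "E u v \<longleftrightarrow> u \<in> elts v" if "u \<in> M" for u v using that by (simp add: elts_def)
  have "act \<pi> x \<in> elts (act \<pi> y) \<longleftrightarrow> x \<in> elts y"
  proof (cases "is_set y")
    case True
    then show ?thesis unfolding act_elts[OF piM True]
      using act_inj[OF assms(1) assms(2)] elts_in by blast
  next
    case False
    then have "y \<in> elts A" using assms(3) is_set_or_atom by blast
    then have "act \<pi> y \<in> elts A" using act_atom[OF piM] fnD(3)[OF permsD(1)[OF assms(1)]] by simp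
    then show ?thesis using \<open>y \<in> elts A\<close> atoms_empty by simp
  qed
  then show ?thesis using E act_in[OF piM] assms by simp
qed

lemma act_A: assumes "\<pi> \<in> perms" shows "act \<pi> A = A"
proof -
  note piM = permsD(2)[OF assms]
  have "act \<pi> ` elts A = ap \<pi> ` elts A" by (rule image_cong) (simp_all add: act_atom piM)
  also have "\<dots> = elts A" using permsD(3)[OF assms] by (simp add: bij_betw_def)
  finally have "codes (act \<pi> A) (elts A)" using act_set[OF piM is_set_A] by simp
  then show ?thesis using St_eq St_elts[OF is_set_A] by metis
qed

lemma act_invariant:
  assumes "\<pi> \<in> perms" "Def M E K R" "K \<subseteq> M" "\<And>c. c \<in> K \<Longrightarrow> act \<pi> c = c" "range e \<subseteq> M"
  shows "R (act \<pi> \<circ> e) = R e"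
  by (rule Def_invariant[OF assms(2) act_bij[OF assms(1)] act_mem[OF assms(1)] assms(4,5,3)])

lemma act_invariant1:
  assumes "\<pi> \<in> perms" "Def M E K (\<lambda>e. R (e 0))" "K \<subseteq> M" "\<And>c. c \<in> K \<Longrightarrow> act \<pi> c = c" "x \<in> M"
  shows "R (act \<pi> x) = R x"
  using act_invariant[OF assms(1-4), of "\<lambda>_. x"] assms(5) by (simp add: comp_def)

lemma act_pr:
  assumes "\<pi> \<in> perms" "x \<in> M" "y \<in> M" shows "act \<pi> (pr x y) = pr (act \<pi> x) (act \<pi> y)"
proof -
  note piM = permsD(2)[OF assms(1)]
  have St: "act \<pi> (St X) = St (act \<pi> ` X)" if "setlike X" for X
    using act_set[OF piM is_set_St[OF that]] that by (simp add: codes_iff)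
  show ?thesis unfolding pr_def using assms by (simp add: St)
qed

text \<open>All elements of numbers are numbers, so no atom enters the induction.\<close>

lemma act_omega: assumes "\<pi> \<in> M" "n \<in> \<omega>" shows "act \<pi> n = n"
proof -
  have "n \<in> \<omega> \<longrightarrow> act \<pi> n = n"
  proof (rule eps_induct[OF omega_in[OF assms(2)]])
    show "D (\<lambda>e. e 0 \<in> \<omega> \<longrightarrow> act \<pi> (e 0) = e 0)"
      by (intro Def_imp def_omega atom_set order_refl DT_var Def_eq act_term assms(1))
    fix x assume IH: "\<And>y. y \<in> elts x \<Longrightarrow> y \<in> \<omega> \<longrightarrow> act \<pi> y = y"
    show "x \<in> \<omega> \<longrightarrow> act \<pi> x = x"
    proof
      assume x: "x \<in> \<omega>"
      show "act \<pi> x = x"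
        by (rule act_pointwise_fixed[OF assms(1) omegaD(1)[OF x]]) (use IH omega_mem[OF x] in blast)
    qed
  qed
  with assms(2) show ?thesis by blast
qed

section \<open>The permutation model\<close>

text \<open>The supports: at most countable sets of atoms.\<close>

definition cset :: "'a \<Rightarrow> bool" where
  "cset C \<longleftrightarrow> is_set C \<and> elts C \<subseteq> elts A \<and> ctb (elts C)"

definition supports :: "'a \<Rightarrow> 'a \<Rightarrow> bool" where
  "supports C x \<longleftrightarrow> (\<forall>\<pi>\<in>perms. (\<forall>c\<in>elts C. ap \<pi> c = c) \<longrightarrow> act \<pi> x = x)"

lemma perm_app: "\<pi> \<in> perms \<Longrightarrow> app \<pi> a b \<longleftrightarrow> a \<in> elts A \<and> b = ap \<pi> a"
  using fnD(4)[OF permsD(1)] by blast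

lemma perm_ap_in: "\<pi> \<in> perms \<Longrightarrow> a \<in> elts A \<Longrightarrow> ap \<pi> a \<in> elts A"
  using fnD(3)[OF permsD(1)] by blast

lemma symm_iff: "x \<in> M \<Longrightarrow> symm x = {\<pi> \<in> perms. act \<pi> x = x}"
  unfolding symm_def using acts_iff by auto

text \<open>The filter consists of subgroups that are sets of the structure; for
  \<open>symm x\<close> this has to be known in addition to a support.\<close>

lemma perm_subgroup_symm: assumes x: "x \<in> M" shows "perm_subgroup (symm x)"
  unfolding perm_subgroup_def
proof (intro conjI)
  have "setlike {\<pi> \<in> perms. acts \<pi> x x}"
    by (intro setlike_sep[OF setlike_perms] def_acts atom_set order_refl DT_var DT_param x)
  then show "\<exists>h. codes h (symm x)" by (simp add: symm_def setlike_def)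
  show "symm x \<subseteq> perms" by (auto simp: symm_def)
  show "\<forall>\<iota>\<in>perms. (\<forall>a\<in>elts A. app \<iota> a a) \<longrightarrow> \<iota> \<in> symm x"
  proof (intro ballI impI)
    fix \<iota> assume \<iota>: "\<iota> \<in> perms" "\<forall>a\<in>elts A. app \<iota> a a"
    then have "ap \<iota> a = a" if "a \<in> elts A" for a using that perm_app[OF \<iota>(1)] by metis
    then show "\<iota> \<in> symm x" using act_id[OF permsD(2)[OF \<iota>(1)] _ x] \<iota>(1) symm_iff[OF x] by simp
  qed
  show "\<forall>\<pi>\<in>symm x. \<forall>\<sigma>\<in>symm x. \<forall>\<rho>\<in>perms.
      (\<forall>a b c. app \<sigma> a b \<and> app \<pi> b c \<longrightarrow> app \<rho> a c) \<longrightarrow> \<rho> \<in> symm x"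
  proof (intro ballI impI)
    fix \<pi> \<sigma> \<rho>
    assume "\<pi> \<in> symm x" "\<sigma> \<in> symm x" and \<rho>: "\<rho> \<in> perms"
      and comp: "\<forall>a b c. app \<sigma> a b \<and> app \<pi> b c \<longrightarrow> app \<rho> a c"
    then have p: "\<pi> \<in> perms" "act \<pi> x = x" "\<sigma> \<in> perms" "act \<sigma> x = x" unfolding symm_iff[OF x] by auto
    have "ap \<rho> a = ap \<pi> (ap \<sigma> a)" if a: "a \<in> elts A" for a
    proof -
      have "app \<sigma> a (ap \<sigma> a)" "app \<pi> (ap \<sigma> a) (ap \<pi> (ap \<sigma> a))"
        unfolding perm_app[OF p(1)] perm_app[OF p(3)] using a perm_ap_in[OF p(3)] by auto
      then have "app \<rho> a (ap \<pi> (ap \<sigma> a))" using comp by blast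
      then show ?thesis unfolding perm_app[OF \<rho>] by simp
    qed
    from act_comp[OF p(1,3) \<rho> this x] show "\<rho> \<in> symm x" unfolding symm_iff[OF x] using p \<rho> by simp
  qed
  show "\<forall>\<pi>\<in>symm x. \<forall>\<rho>\<in>perms. (\<forall>a b. app \<pi> a b \<longrightarrow> app \<rho> b a) \<longrightarrow> \<rho> \<in> symm x"
  proof (intro ballI impI)
    fix \<pi> \<rho>
    assume "\<pi> \<in> symm x" and \<rho>: "\<rho> \<in> perms" and inv: "\<forall>a b. app \<pi> a b \<longrightarrow> app \<rho> b a"
    then have p: "\<pi> \<in> perms" "act \<pi> x = x" unfolding symm_iff[OF x] by auto
    have "ap \<rho> (ap \<pi> a) = a" if a: "a \<in> elts A" for a
    proof -
      have "app \<pi> a (ap \<pi> a)" unfolding perm_app[OF p(1)] using a by simp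
      then have "app \<rho> (ap \<pi> a) a" using inv by blast
      then show ?thesis unfolding perm_app[OF \<rho>] by simp
    qed
    from act_inverse[OF p(1) \<rho> this x] show "\<rho> \<in> symm x" unfolding symm_iff[OF x] using p \<rho> by simp
  qed
qed

lemma symmetric_iff:
  assumes x: "x \<in> M" shows "symmetric x \<longleftrightarrow> (\<exists>C. cset C \<and> supports C x)"
proof -
  have "pointwise_stabilizer C = {\<pi> \<in> perms. \<forall>c\<in>elts C. ap \<pi> c = c}" if "elts C \<subseteq> elts A" for C
    unfolding pointwise_stabilizer_def using that by (auto simp: perm_app)
  then have "is_set C \<and> elts C \<subseteq> elts A \<and> is_countable C \<and> pointwise_stabilizer C \<subseteq> symm x \<longleftrightarrow>
      cset C \<and> supports C x" for C
    unfolding cset_def supports_def symm_iff[OF x] using is_countable_iff is_set_in by auto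
  then show ?thesis unfolding symmetric_def perm_filter_def using perm_subgroup_symm[OF x] by simp
qed

text \<open>\<open>cset\<close> and \<open>supports\<close> rest on HOL functions, so definability
  is read off the coded notions \<open>is_countable\<close> and \<open>acts\<close>.\<close>

lemma def_symmetric_0:
  assumes "A \<in> K" "K \<subseteq> M" shows "Def M E K (\<lambda>e. symmetric (e 0))"
proof (rule Def.cong)
  show "Def M E K (\<lambda>e. \<exists>C\<in>M. is_set C \<and> elts C \<subseteq> elts A \<and> is_countable C \<and>
      (\<forall>\<pi>\<in>perms. (\<forall>c\<in>elts C. app \<pi> c c) \<longrightarrow> acts \<pi> (e 0) (e 0)))"
    by (intro def_intros assms DT_A class_subsets)
  fix e :: "nat \<Rightarrow> 'a" assume "range e \<subseteq> M"
  then have x: "e 0 \<in> M" by auto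
  have "cset C \<and> supports C (e 0) \<longleftrightarrow> C \<in> M \<and> is_set C \<and> elts C \<subseteq> elts A \<and> is_countable C \<and>
      (\<forall>\<pi>\<in>perms. (\<forall>c\<in>elts C. app \<pi> c c) \<longrightarrow> acts \<pi> (e 0) (e 0))" for C
  proof (cases "elts C \<subseteq> elts A \<and> is_set C")
    case True
    have "app \<pi> c c \<longleftrightarrow> ap \<pi> c = c" if "\<pi> \<in> perms" "c \<in> elts C" for \<pi> c
      unfolding perm_app[OF that(1)] using True that(2) by auto
    moreover have "acts \<pi> (e 0) (e 0) \<longleftrightarrow> act \<pi> (e 0) = e 0" if "\<pi> \<in> perms" for \<pi>
      unfolding acts_iff[OF that x] by auto
    ultimately have "supports C (e 0) \<longleftrightarrow> (\<forall>\<pi>\<in>perms. (\<forall>c\<in>elts C. app \<pi> c c) \<longrightarrow> acts \<pi> (e 0) (e 0))"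
      unfolding supports_def by (simp cong: ball_cong)
    moreover have "cset C \<longleftrightarrow> C \<in> M \<and> is_set C \<and> elts C \<subseteq> elts A \<and> is_countable C"
      unfolding cset_def using True is_countable_iff[of C] is_set_in[of C] by blast
    ultimately show ?thesis by blast
  next
    case False
    then show ?thesis unfolding cset_def by blast
  qed
  then show "symmetric (e 0) \<longleftrightarrow> (\<exists>C\<in>M. is_set C \<and> elts C \<subseteq> elts A \<and> is_countable C \<and>
      (\<forall>\<pi>\<in>perms. (\<forall>c\<in>elts C. app \<pi> c c) \<longrightarrow> acts \<pi> (e 0) (e 0)))"
    unfolding symmetric_iff[OF x] by blast
qed

abbreviation B :: "'a set" where "B \<equiv> perm_model"

lemma B_subset: "B \<subseteq> M"
  by (auto simp: perm_model_def)

lemma B_in: "x \<in> B \<Longrightarrow> x \<in> M"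
  using B_subset by blast

lemma is_trancl_in: "is_trancl x T \<Longrightarrow> x \<in> M \<and> T \<in> M"
  unfolding is_trancl_def using transitive_in elts_in by blast

lemma def_B:
  assumes "A \<in> K" "K \<subseteq> M" shows "Def M E K (\<lambda>e. e 0 \<in> B)"
proof -
  have *: "x \<in> B \<longleftrightarrow> (\<exists>T\<in>M. is_trancl x T \<and> (\<forall>t\<in>elts T. symmetric t))" for x
    unfolding perm_model_def using is_trancl_in by blast
  note [def_intros] = Def_subst1[of M E K symmetric, OF def_symmetric_0[OF assms]]
  show ?thesis unfolding * by (intro def_intros assms class_subsets)
qed

section \<open>Criteria for membership in the permutation model\<close>

lemma is_trancl_unique: "is_trancl x T \<Longrightarrow> is_trancl x U \<Longrightarrow> elts T = elts U"
  unfolding is_trancl_def by blast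

lemma B_mem: assumes "x \<in> B" "y \<in> elts x" shows "y \<in> B"
proof -
  obtain T where T: "is_trancl x T" "\<forall>t\<in>elts T. symmetric t" using assms(1) by (auto simp: perm_model_def)
  have tr: "transitive T" "x \<in> elts T" using T(1) by (auto simp: is_trancl_def)
  obtain U where U: "is_trancl y U" using ex_trancl[OF elts_in[OF assms(2)]] by blast
  have "y \<in> elts T" using transitiveD[OF tr assms(2)] .
  then have "elts U \<subseteq> elts T" using U tr(1) unfolding is_trancl_def by blast
  then show ?thesis using U T(2) elts_in[OF assms(2)] unfolding perm_model_def by blast
qed

lemma B_symmetric: assumes "x \<in> B" shows "\<exists>C. cset C \<and> supports C x"
proof -
  obtain T where "is_trancl x T" "\<forall>t\<in>elts T. symmetric t" using assms by (auto simp: perm_model_def)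
  then have "symmetric x" by (auto simp: is_trancl_def)
  then show ?thesis using symmetric_iff[OF B_in[OF assms]] by blast
qed

text \<open>Those members of the transitive closure that are \<open>x\<close> itself or lie in
  \<open>B\<close> form a transitive set containing \<open>x\<close>. By minimality this is the
  whole closure, and all its members are symmetric.\<close>

lemma supported_in_perm_model:
  assumes x: "x \<in> M" and sub: "elts x \<subseteq> B" and C: "cset C" "supports C x"
  shows "x \<in> B"
proof -
  obtain T where T: "is_trancl x T" using ex_trancl[OF x] by blast
  have tr: "transitive T" "x \<in> elts T" using T by (auto simp: is_trancl_def)
  let ?R = "\<lambda>z. z = x \<or> z \<in> B"
  have "D (\<lambda>e. ?R (e 0))"
    by (intro Def_disj Def_eq DT_var DT_param x def_B atom_set order_refl)
  note U = transitive_Int[OF tr(1) this]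
  have step: "?R y" if "?R z" "y \<in> elts z" for y z
  proof (cases "z = x")
    case True
    then show ?thesis using that(2) sub by blast
  next
    case False
    then show ?thesis using that B_mem by blast
  qed
  have U: "transitive (St {z \<in> elts T. ?R z})" "elts (St {z \<in> elts T. ?R z}) = {z \<in> elts T. ?R z}"
    using U step by blast+
  have "x \<in> elts (St {z \<in> elts T. ?R z})" using tr(2) unfolding U(2) by simp
  then have "elts T \<subseteq> elts (St {z \<in> elts T. ?R z})"
    using T U(1) unfolding is_trancl_def by blast
  then have "elts T \<subseteq> {z \<in> elts T. ?R z}" unfolding U(2) .
  moreover have "symmetric z" if "?R z" for z
  proof (cases "z = x")
    case True
    then show ?thesis using C symmetric_iff[OF x] by blast
  next
    case False
    then have "z \<in> B" using that by blast
    then show ?thesis using B_symmetric symmetric_iff[OF B_in] by blast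
  qed
  ultimately have "\<forall>t\<in>elts T. symmetric t" by blast
  then show ?thesis using T x unfolding perm_model_def by blast
qed

lemma cset_zero: "cset zero"
  unfolding cset_def using ctbI[OF tot_const[OF zero_in], of "{}"] by simp

lemma supports_mono: "supports C x \<Longrightarrow> elts C \<subseteq> elts C' \<Longrightarrow> supports C' x"
  unfolding supports_def by blast

lemma cset_Un: assumes "cset C" "cset C'" shows "cset (St (elts C \<union> elts C'))"
  using assms ctb_Un[of "elts C" "elts C'"] by (simp add: cset_def)

text \<open>Supports are joined by union, and a union of two countable sets is countable.\<close>

lemma common_support:
  assumes "finite K" "K \<subseteq> B" shows "\<exists>C. cset C \<and> (\<forall>c\<in>K. supports C c)"
  using assms
proof (induction rule: finite_induct)
  case empty
  then show ?case using cset_zero by blast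
next
  case (insert c K)
  then obtain C C' where C: "cset C" "\<forall>c\<in>K. supports C c" "cset C'" "supports C' c"
    using B_symmetric by blast
  then have e: "elts (St (elts C \<union> elts C')) = elts C \<union> elts C'" by (simp add: cset_def)
  have "supports (St (elts C \<union> elts C')) d" if "d \<in> insert c K" for d
  proof (cases "d = c")
    case True
    then show ?thesis using supports_mono[OF C(4)] e by simp
  next
    case False
    then have "supports C d" using that C(2) by blast
    then show ?thesis by (rule supports_mono) (simp add: e)
  qed
  then show ?case using cset_Un[OF C(1,3)] by blast
qed

text \<open>One inclusion is enough to check, since the inverse permutation fixes \<open>C\<close>
  pointwise as well.\<close>

lemma supportsI:
  assumes C: "cset C" and x: "is_set x"
    and inv: "\<And>\<pi> z. \<pi> \<in> perms \<Longrightarrow> (\<forall>c\<in>elts C. ap \<pi> c = c) \<Longrightarrow> z \<in> elts x \<Longrightarrow> act \<pi> z \<in> elts x"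
  shows "supports C x"
  unfolding supports_def
proof (intro ballI impI)
  fix \<pi> assume \<pi>: "\<pi> \<in> perms" "\<forall>c\<in>elts C. ap \<pi> c = c"
  obtain \<rho> where \<rho>: "\<rho> \<in> perms" "\<forall>a\<in>elts A. ap \<rho> (ap \<pi> a) = a \<and> ap \<pi> (ap \<rho> a) = a"
    using perm_inverse[OF \<pi>(1)] by blast
  have \<rho>C: "\<forall>c\<in>elts C. ap \<rho> c = c"
  proof
    fix c assume "c \<in> elts C"
    then have "ap \<pi> c = c" "c \<in> elts A" using \<pi>(2) C by (auto simp: cset_def)
    then show "ap \<rho> c = c" using \<rho>(2) by metis
  qed
  have "act \<pi> ` elts x = elts x"
  proof
    show "act \<pi> ` elts x \<subseteq> elts x" using inv[OF \<pi>] by blast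
    show "elts x \<subseteq> act \<pi> ` elts x"
    proof
      fix z assume z: "z \<in> elts x"
      have "z = act \<pi> (act \<rho> z)"
        using act_inverse[OF \<rho>(1) \<pi>(1), of z] \<rho>(2) elts_in[OF z] by simp
      then show "z \<in> act \<pi> ` elts x" using inv[OF \<rho>(1) \<rho>C z] by blast
    qed
  qed
  then have "codes (act \<pi> x) (elts x)" using act_set[OF permsD(2)[OF \<pi>(1)] x] by simp
  then show "act \<pi> x = x" using St_eq St_elts[OF x] by metis
qed

lemma atoms_B: assumes a: "a \<in> elts A" shows "a \<in> B"
proof (rule supported_in_perm_model)
  have aM: "a \<in> M" using elts_in[OF a] .
  have C: "cset (St {a})" using aM a ctb_single by (simp add: cset_def)
  show "cset (St {a})" by (rule C)
  show "supports (St {a}) a" unfolding supports_def using aM act_atom[OF permsD(2) a] by simp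
  show "elts a \<subseteq> B" using atoms_empty[OF a] by simp
  show "a \<in> M" by (rule aM)
qed

lemma A_in_B: "A \<in> B"
  by (rule supported_in_perm_model[OF atom_set _ cset_zero]) (auto simp: atoms_B supports_def act_A)

lemma definable_in_perm_model:
  assumes X: "setlike X" "X \<subseteq> B" and K: "finite K" "K \<subseteq> B" and R: "Def M E K (\<lambda>e. e 0 \<in> X)"
  shows "St X \<in> B"
proof -
  obtain C where C: "cset C" "\<forall>c\<in>K. supports C c" using common_support[OF K] by blast
  show ?thesis
  proof (rule supported_in_perm_model[OF St_in[OF X(1)] _ C(1)])
    show "elts (St X) \<subseteq> B" using X by simp
    show "supports C (St X)"
    proof (rule supportsI[OF C(1) is_set_St[OF X(1)]])
      fix \<pi> z assume \<pi>: "\<pi> \<in> perms" "\<forall>c\<in>elts C. ap \<pi> c = c" and z: "z \<in> elts (St X)"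
      have "act \<pi> c = c" if "c \<in> K" for c using C(2) that \<pi> unfolding supports_def by blast
      from act_invariant1[OF \<pi>(1) R _ this] z X(1) K(2) B_subset elts_in[OF z]
      show "act \<pi> z \<in> elts (St X)" by auto
    qed
  qed
qed

lemma fixed_in_perm_model:
  assumes "is_set x" "elts x \<subseteq> B" "cset C"
    "\<And>\<pi> z. \<pi> \<in> perms \<Longrightarrow> (\<forall>c\<in>elts C. ap \<pi> c = c) \<Longrightarrow> z \<in> elts x \<Longrightarrow> act \<pi> z = z"
  shows "x \<in> B"
  by (rule supported_in_perm_model[OF is_set_in[OF assms(1)] assms(2,3)], rule supportsI[OF assms(3,1)]) (simp add: assms(4))

lemma pr_B: assumes "x \<in> B" "y \<in> B" shows "pr x y \<in> B"
proof -
  have S: "St {u, v} \<in> B" if "u \<in> B" "v \<in> B" for u v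
  proof (rule definable_in_perm_model[where K="{A, u, v}"])
    show "Def M E {A, u, v} (\<lambda>e. e 0 \<in> {u, v})"
      by (intro def_intros) (use that B_in atom_set in auto)
  qed (use that B_in A_in_B in auto)
  show ?thesis unfolding pr_def using S[OF S[OF assms(1,1)] S[OF assms]] by simp
qed

lemma omega_B: assumes "n \<in> \<omega>" shows "n \<in> B"
proof -
  have "n \<in> \<omega> \<longrightarrow> n \<in> B"
  proof (rule eps_induct[OF omega_in[OF assms]])
    show "D (\<lambda>e. e 0 \<in> \<omega> \<longrightarrow> e 0 \<in> B)"
      by (intro Def_imp def_omega def_B atom_set order_refl DT_var)
    fix x assume IH: "\<And>y. y \<in> elts x \<Longrightarrow> y \<in> \<omega> \<longrightarrow> y \<in> B"
    show "x \<in> \<omega> \<longrightarrow> x \<in> B"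
    proof
      assume x: "x \<in> \<omega>"
      show "x \<in> B"
        by (rule fixed_in_perm_model[OF omegaD(1)[OF x] _ cset_zero])
          (use IH omega_mem[OF x] act_omega permsD(2) in blast)+
    qed
  qed
  with assms show ?thesis by blast
qed

text \<open>With this the definability rules apply to the notions as evaluated in the permutation
  model, which are called \<open>Bm\<close> below.\<close>

lemma B_class: "definable_class B E A M"
  by (unfold_locales) (use B_subset A_in_B def_B[of "{A}"] atom_set in auto)

section \<open>Absoluteness\<close>

interpretation Bm: definable_class B E A M
  by (rule B_class)

lemma Bm_elts: "x \<in> B \<Longrightarrow> Bm.elts x = elts x"
  using B_mem B_in unfolding Bm.elts_def elts_def by blast

lemma Bm_is_set: "Bm.is_set x \<longleftrightarrow> x \<in> B \<and> is_set x"
  unfolding Bm.is_set_def is_set_def Bm_elts[OF A_in_B] using B_in by blast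

lemma Bm_codes: "Bm.codes x X \<longleftrightarrow> x \<in> B \<and> codes x X"
  unfolding Bm.codes_def codes_def Bm_is_set using Bm_elts by auto

lemma Bm_transitive: "Bm.transitive x \<longleftrightarrow> x \<in> B \<and> transitive x"
proof (cases "x \<in> B")
  case True
  have "Bm.elts y = elts y" if "y \<in> elts x" for y using Bm_elts B_mem[OF True that] by blast
  then show ?thesis
    unfolding Bm.transitive_def transitive_def Bm_is_set Bm_elts[OF True] using True by simp
qed (simp add: Bm.transitive_def Bm_is_set)

lemma doubleton_B: assumes "u \<in> B" "v \<in> B" shows "St {u, v} \<in> B"
proof (rule definable_in_perm_model[where K="{A, u, v}"])
  show "Def M E {A, u, v} (\<lambda>e. e 0 \<in> {u, v})"
    by (intro def_intros) (use assms B_in atom_set in auto)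
qed (use assms B_in A_in_B in auto)

lemma Bm_is_pair: "Bm.is_pair z x y \<longleftrightarrow> x \<in> B \<and> y \<in> B \<and> z = pr x y"
proof -
  have "x \<in> B \<Longrightarrow> y \<in> B \<Longrightarrow> St {x} \<in> B \<and> St {x, y} \<in> B \<and> pr x y \<in> B"
    using doubleton_B[of x x] doubleton_B[of x y] pr_B by simp
  then show ?thesis
    unfolding Bm.is_pair_def Bm_codes codes_iff pr_def using B_in by auto
qed

text \<open>\<open>B\<close> is closed under elements, so it contains both components of every pair
  in \<open>f\<close>.\<close>

lemma Bm_app: "f \<in> B \<Longrightarrow> Bm.app f x y \<longleftrightarrow> app f x y"
proof -
  assume f: "f \<in> B"
  have "x \<in> B \<and> y \<in> B" if xy: "x \<in> M" "y \<in> M" "pr x y \<in> elts f"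
  proof -
    have p: "pr x y \<in> B" using B_mem[OF f xy(3)] .
    have "St {x, y} \<in> elts (pr x y)" unfolding pr_def using xy by simp
    then have "St {x, y} \<in> B" using B_mem[OF p] by blast
    then show ?thesis using B_mem[of "St {x, y}"] xy by simp
  qed
  then show ?thesis
    unfolding Bm.app_def app_iff Bm_elts[OF f] Bm_is_pair using B_in by blast
qed

lemma app_B: "f \<in> B \<Longrightarrow> app f x y \<Longrightarrow> x \<in> B \<and> y \<in> B"
  using Bm_app Bm.app_in by blast

lemma Bm_fn: assumes d: "d \<in> B" shows "Bm.fn f d X \<longleftrightarrow> f \<in> B \<and> fn f d X"
proof (cases "f \<in> B")
  case True
  have pair: "Bm.is_pair z x y \<longleftrightarrow> is_pair z x y" if "z \<in> elts f" for z x y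
  proof
    assume "is_pair z x y"
    then have "app f x y" using that unfolding app_def by blast
    then show "Bm.is_pair z x y"
      using app_B[OF True] \<open>is_pair z x y\<close> unfolding Bm_is_pair is_pair_iff by blast
  qed (use B_in in \<open>simp add: Bm_is_pair is_pair_iff\<close>)
  then show ?thesis
    unfolding Bm.fn_def fn_def Bm_is_set Bm_elts[OF d] Bm_elts[OF True] Bm_app[OF True]
    using True by (simp cong: ball_cong)
qed (auto simp: Bm.fn_def Bm_is_set)

lemma Bm_injective: "f \<in> B \<Longrightarrow> Bm.injective f \<longleftrightarrow> injective f"
  unfolding Bm.injective_def injective_def using Bm_app by simp

lemma Bm_bijection: assumes "x \<in> B" "y \<in> B" shows "Bm.bijection f x y \<longleftrightarrow> f \<in> B \<and> bijection f x y"
  unfolding Bm.bijection_def bijection_def Bm_fn[OF assms(1)] Bm_elts[OF assms(1)] Bm_elts[OF assms(2)]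
  using Bm_injective[of f] Bm_app[of f] by auto

lemma Bm_is_zero: "Bm.is_zero x \<longleftrightarrow> x = zero"
  unfolding Bm.is_zero_def Bm_codes codes_iff zero_def[symmetric] using omega_B[OF zero_omega] by auto

lemma sc_B: assumes x: "x \<in> B" shows "sc x \<in> B"
  unfolding sc_def
proof (rule definable_in_perm_model[where K="{A, x}"])
  show "Def M E {A, x} (\<lambda>e. e 0 \<in> insert x (elts x))"
    by (intro Def_insert Def_disj Def_eq DT_var DT_param def_elts) (use x B_in atom_set in auto)
qed (use x B_in A_in_B B_mem in auto)

lemma Bm_is_succ: "Bm.is_succ y x \<longleftrightarrow> x \<in> B \<and> y = sc x"
  unfolding Bm.is_succ_def Bm_codes codes_iff sc_def[symmetric]
  using sc_B[of x] B_in[of x] Bm_elts[of x] by (auto simp: sc_def)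

lemma Bm_is_one: "Bm.is_one y \<longleftrightarrow> y = one"
  unfolding Bm.is_one_def Bm_is_zero Bm_is_succ one_def using omega_B[OF zero_omega] by auto

lemma Bm_bits: "Bm.bits = bits"
  by (auto simp: Bm.bits_def Bm_is_zero Bm_is_one bits_iff)

text \<open>Being a number is decided by the number and its elements; the predecessor asked for is
  itself an element of the number and hence lies in \<open>B\<close>.\<close>

lemma Bm_omega: "Bm.\<omega> = \<omega>"
proof -
  have "n \<in> Bm.\<omega> \<longleftrightarrow> n \<in> \<omega>" for n
  proof (cases "n \<in> B")
    case True
    have "transitive y \<longleftrightarrow> Bm.transitive y" if "y \<in> elts n" for y
      using B_mem[OF True that] Bm_transitive by blast
    then have ord: "Bm.is_ord n \<longleftrightarrow> is_ord n"
      unfolding Bm.is_ord_def is_ord_def Bm_elts[OF True] using Bm_transitive True by simp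
    have succ: "(\<exists>k. Bm.is_succ m k) \<longleftrightarrow> (\<exists>k. is_succ m k)" if "m \<in> B" for m
    proof -
      have "k \<in> B" if "k \<in> M" "m = sc k" for k using B_mem[OF \<open>m \<in> B\<close>, of k] that by simp
      then show ?thesis unfolding Bm_is_succ is_succ_iff using B_in by blast
    qed
    have "m \<in> B" if "m \<in> insert n (elts n)" for m using that True B_mem by blast
    then show ?thesis
      unfolding Bm.\<omega>_def \<omega>_def Bm_elts[OF True] mem_Collect_eq ord Bm_is_zero is_zero_iff
      using succ by (meson)
  next
    case False
    then show ?thesis using omega_B Bm.omega_subset by blast
  qed
  then show ?thesis by blast
qed

lemma cset_B: assumes "cset C" shows "C \<in> B"
proof (rule fixed_in_perm_model[OF _ _ assms])
  show "is_set C" "elts C \<subseteq> B" using assms atoms_B by (auto simp: cset_def)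
  show "act \<pi> z = z" if "\<pi> \<in> perms" "\<forall>c\<in>elts C. ap \<pi> c = c" "z \<in> elts C" for \<pi> z
    using that act_atom[OF permsD(2)[OF that(1)]] assms by (auto simp: cset_def)
qed

text \<open>A permutation fixing \<open>C\<close> pointwise fixes every pair of an element of
  \<open>C\<close> and a number, so \<open>C\<close> supports each map from it to
  \<open>\<omega>\<close>. Countability of sets of atoms is absolute for this reason.\<close>

lemma graph_into_omega_B:
  assumes C: "cset C" and F: "tot F" "\<And>c. c \<in> elts C \<Longrightarrow> F c \<in> \<omega>"
  shows "graph F (elts C) \<in> B"
proof -
  have Cs: "setlike (elts C)" "elts C \<subseteq> elts A" using C by (auto simp: cset_def)
  show ?thesis
  proof (rule fixed_in_perm_model[OF is_set_graph[OF F(1) Cs(1)] _ C]; unfold elts_graph[OF F(1) Cs(1)])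
    show "(\<lambda>x. pr x (F x)) ` elts C \<subseteq> B"
      using pr_B atoms_B omega_B F(2) Cs(2) by blast
    fix \<pi> z assume \<pi>: "\<pi> \<in> perms" "\<forall>c\<in>elts C. ap \<pi> c = c" and "z \<in> (\<lambda>x. pr x (F x)) ` elts C"
    then obtain c where c: "c \<in> elts C" "z = pr c (F c)" by blast
    then have "act \<pi> c = c" using \<pi> act_atom[OF permsD(2)[OF \<pi>(1)]] Cs(2) by auto
    then show "act \<pi> z = z"
      using c act_pr[OF \<pi>(1) elts_in[OF c(1)] omega_in[OF F(2)[OF c(1)]]]
        act_omega[OF permsD(2)[OF \<pi>(1)] F(2)[OF c(1)]] by simp
  qed
qed

lemma Bm_is_countable: assumes "is_set x" "elts x \<subseteq> elts A" "x \<in> B"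
  shows "Bm.is_countable x \<longleftrightarrow> ctb (elts x)"
proof
  assume "Bm.is_countable x"
  then obtain f where "Bm.fn f x \<omega>" "Bm.injective f" unfolding Bm.is_countable_def Bm_omega by blast
  then have "fn f x \<omega>" "injective f" using Bm_fn[OF assms(3)] Bm_injective by auto
  then show "ctb (elts x)" using is_countable_iff[OF B_in[OF assms(3)]] is_countable_def by blast
next
  assume "ctb (elts x)"
  then obtain F where F: "tot F" "\<And>y. y \<in> elts x \<Longrightarrow> F y \<in> \<omega>" "inj_on F (elts x)" by (rule ctbE) (rule that; blast)
  have s: "setlike (elts x)" using assms(1) by simp
  have fn: "fn (graph F (elts x)) x \<omega>" using F by (intro fn_graph[OF _ s]) auto
  have "injective (graph F (elts x))"
    unfolding injective_iff[OF fn] using F(3) by (simp add: inj_on_def ap_graph[OF F(1) s])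
  moreover have "graph F (elts x) \<in> B"
    using \<open>ctb (elts x)\<close> assms by (intro graph_into_omega_B F) (auto simp: cset_def)
  ultimately show "Bm.is_countable x"
    unfolding Bm.is_countable_def Bm_omega using fn Bm_fn[OF assms(3)] Bm_injective by blast
qed

text \<open>A finite set of atoms is countable, so it supports its bijection with a number as it
  would an enumeration.\<close>

lemma Bm_is_finite: assumes "is_set x" "elts x \<subseteq> elts A" "x \<in> B"
  shows "Bm.is_finite x \<longleftrightarrow> is_finite x"
proof
  assume "Bm.is_finite x"
  then show "is_finite x"
    unfolding Bm.is_finite_def is_finite_def Bm_omega using Bm_bijection[OF assms(3) omega_B] by blast
next
  assume "is_finite x"
  then obtain n F where F: "n \<in> \<omega>" "tot F" "bij_betw F (elts x) (elts n)"
    unfolding is_finite_iff[OF B_in[OF assms(3)]] by blast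
  have s: "setlike (elts x)" using assms(1) by simp
  have Fn: "F y \<in> elts n" if "y \<in> elts x" for y using bij_betw_apply[OF F(3) that] .
  have fn: "fn (graph F (elts x)) x (elts n)" using Fn by (intro fn_graph[OF F(2) s]) auto
  have "ctb (elts x)"
    using Fn omega_mem[OF F(1)] by (intro ctbI[OF F(2) _ bij_betw_imp_inj_on[OF F(3)]]) blast
  then have "graph F (elts x) \<in> B"
    using assms Fn omega_mem[OF F(1)] by (intro graph_into_omega_B F(2)) (auto simp: cset_def)
  moreover have "bij_betw (ap (graph F (elts x))) (elts x) (elts n)"
    using F(3) by (rule iffD1[OF bij_betw_cong, rotated]) (simp add: ap_graph[OF F(2) s])
  ultimately show "Bm.is_finite x"
    unfolding Bm.is_finite_def Bm_omega
    using F(1) bijection_iff[OF fn] Bm_bijection[OF assms(3) omega_B[OF F(1)]] by blast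
qed

lemma bits_omega: "b \<in> bits \<Longrightarrow> b \<in> \<omega>"
  unfolding bits_iff using zero_omega one_omega by blast

lemma graph_omega_B:
  assumes n: "n \<in> \<omega>" and f: "fn f n Y" "Y \<subseteq> \<omega>" shows "f \<in> B"
proof (rule fixed_in_perm_model[OF fnD(1)[OF f(1)] _ cset_zero]; unfold fn_elts[OF f(1)])
  have fk: "k \<in> \<omega> \<and> ap f k \<in> \<omega>" if "k \<in> elts n" for k
    using fnD(3)[OF f(1) that] f(2) omega_mem[OF n that] by blast
  then show "(\<lambda>x. pr x (ap f x)) ` elts n \<subseteq> B" using pr_B omega_B by blast
  fix \<pi> z assume \<pi>: "\<pi> \<in> perms" and "z \<in> (\<lambda>x. pr x (ap f x)) ` elts n"
  then obtain k where k: "k \<in> elts n" "z = pr k (ap f k)" by blast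
  then show "act \<pi> z = z"
    using fk[OF k(1)] act_pr[OF \<pi>] act_omega[OF permsD(2)[OF \<pi>]] by simp
qed

lemma fn_bits_B: "n \<in> \<omega> \<Longrightarrow> fn h n bits \<Longrightarrow> h \<in> B"
  by (rule graph_omega_B) (use bits_omega in blast)+

lemma fn_bits_Q: assumes n: "n \<in> \<omega>" and h: "fn h n bits" shows "h \<in> Bm.Q"
proof -
  have nB: "n \<in> B" using omega_B[OF n] .
  have s: "setlike (elts n)" using n by simp
  \<comment> \<open>The identity is to witness, inside \<open>B\<close>, that \<open>n\<close> is
    finite.\<close>
  have t: "tot (\<lambda>x. x)" unfolding tot_def by (rule DT_var)
  have fn: "fn (graph (\<lambda>x. x) (elts n)) n (elts n)" by (rule fn_graph[OF t s]) auto
  have "bij_betw (ap (graph (\<lambda>x. x) (elts n))) (elts n) (elts n)"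
    by (rule iffD1[OF bij_betw_cong bij_betw_id]) (simp add: ap_graph[OF t s] id_def)
  then have "bijection (graph (\<lambda>x. x) (elts n)) n n" using bijection_iff[OF fn] by simp
  moreover have "graph (\<lambda>x. x) (elts n) \<in> B"
    by (rule graph_omega_B[OF n fn]) (use omega_mem[OF n] in blast)
  ultimately have "Bm.is_finite n" unfolding Bm.is_finite_def Bm_omega using Bm_bijection[OF nB nB] n by blast
  moreover have "Bm.is_set n" "Bm.elts n \<subseteq> \<omega>"
    using nB omegaD(1)[OF n] omega_mem[OF n] by (auto simp: Bm_is_set Bm_elts)
  moreover have "Bm.fn h n bits" using Bm_fn[OF nB] fn_bits_B[OF n h] h by blast
  ultimately show ?thesis unfolding Bm.Q_def Bm_omega Bm_bits by blast
qed

lemma I_iff: assumes n: "n \<in> \<omega>" and h: "fn h n bits" shows "h \<in> Bm.I \<longleftrightarrow> (\<exists>k\<in>elts n. ap h k = zero)"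
proof -
  have "Bm.app h k zero \<longleftrightarrow> k \<in> elts n \<and> ap h k = zero" for k
    unfolding Bm_app[OF fn_bits_B[OF n h]] fnD(4)[OF h] by auto
  then show ?thesis
    unfolding Bm.I_def Bm_omega Bm_is_zero using fn_bits_Q[OF n h] omega_mem[OF n] by auto
qed

lemma atoms_subset_B:
  assumes "setlike X" "X \<subseteq> elts A" "finite K" "K \<subseteq> B" "Def M E K (\<lambda>e. e 0 \<in> X)"
  shows "St X \<in> B"
  by (rule definable_in_perm_model[OF assms(1) _ assms(3,4,5)]) (use assms(2) atoms_B in blast)

lemma fn_codomain:
  assumes "fn f d X" "\<And>a h. app f a h \<Longrightarrow> h \<in> Y" shows "fn f d Y"
proof -
  have "\<exists>x\<in>elts d. \<exists>y\<in>Y. is_pair z x y" if z: "z \<in> elts f" for z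
  proof -
    obtain x y where xy: "x \<in> elts d" "is_pair z x y" using assms(1) z unfolding fn_def by blast
    then have "app f x y" using z unfolding app_def by blast
    then show ?thesis using assms(2) xy by blast
  qed
  then show ?thesis using assms(1) by (simp add: fn_def)
qed

text \<open>Translates the conditions of the model into statements of the universe. Functions from a
  number to bits lie in \<open>B\<close> anyway; the remaining clauses are about sets of atoms,
  where countability and finiteness are absolute, and choice in the universe turns non-finiteness
  into \<open>infin\<close>.\<close>

lemma P_level_iff:
  assumes n: "n \<in> \<omega>"
  shows "f \<in> Bm.P_level n \<longleftrightarrow> f \<in> B \<and> fn f A {h. fn h n bits} \<and>
    ctb {a \<in> elts A. \<exists>k\<in>elts n. ap (ap f a) k = zero} \<and>
    (\<forall>t. fn t n bits \<longrightarrow> infin {a \<in> elts A. ap f a = t})" (is "_ \<longleftrightarrow> ?R")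
proof -
  have main: "f \<in> Bm.P_level n \<longleftrightarrow> ctb {a \<in> elts A. \<exists>k\<in>elts n. ap (ap f a) k = zero} \<and>
    (\<forall>t. fn t n bits \<longrightarrow> infin {a \<in> elts A. ap f a = t})" if f: "f \<in> B" "fn f A {h. fn h n bits}"
  proof -
    have fa: "fn (ap f a) n bits" if "a \<in> elts A" for a using fnD(3)[OF f(2) that] by simp
    have app: "Bm.app f a h \<longleftrightarrow> a \<in> elts A \<and> h = ap f a" for a h
      unfolding Bm_app[OF f(1)] fnD(4)[OF f(2)] ..
    have fM: "f \<in> M" using f(1) B_in by blast
    have "Bm.fn f A Bm.Q"
    proof -
      have "fn f A Bm.Q" by (rule fn_codomain[OF f(2)]) (use fn_bits_Q[OF n] fa fnD(4)[OF f(2)] in auto)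
      then show ?thesis using Bm_fn[OF A_in_B] f(1) by blast
    qed
    moreover have "\<forall>a h. Bm.app f a h \<longrightarrow> Bm.fn h n bits"
      unfolding app Bm_fn[OF omega_B[OF n]] using fa fn_bits_B[OF n] by blast
    moreover have "(\<exists>c. Bm.codes c {a \<in> elts A. \<exists>h\<in>Bm.I. Bm.app f a h} \<and> Bm.is_countable c) \<longleftrightarrow>
        ctb {a \<in> elts A. \<exists>k\<in>elts n. ap (ap f a) k = zero}"
    proof -
      let ?X = "{a \<in> elts A. \<exists>k\<in>elts n. ap (ap f a) k = zero}"
      have "(\<exists>h\<in>Bm.I. Bm.app f a h) \<longleftrightarrow> (\<exists>k\<in>elts n. ap (ap f a) k = zero)" if "a \<in> elts A" for a
        unfolding app using I_iff[OF n fa[OF that]] that by auto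
      then have eq: "{a \<in> elts A. \<exists>h\<in>Bm.I. Bm.app f a h} = ?X" by blast
      have X: "setlike ?X"
        by (rule setlike_sep[OF setlike_elts'[OF atom_set]])
          (intro def_intros atom_set order_refl elts_subset_M omega_in[OF n] fM zero_in)
      \<comment> \<open>A code in the model is demanded together with countability; a countable set
        of atoms supports itself and so has one.\<close>
      have "St ?X \<in> B" if "ctb ?X"
        by (rule cset_B) (use X that in \<open>auto simp: cset_def\<close>)
      moreover have "Bm.is_countable (St ?X) \<longleftrightarrow> ctb ?X" if "St ?X \<in> B"
        using Bm_is_countable[of "St ?X"] X that by auto
      ultimately show ?thesis unfolding eq Bm_codes codes_iff using X by blast
    qed
    moreover have "(\<exists>s. Bm.codes s {a \<in> elts A. Bm.app f a t} \<and> \<not> Bm.is_finite s) \<longleftrightarrow>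
        infin {a \<in> elts A. ap f a = t}" if t: "fn t n bits" for t
    proof -
      let ?X = "{a \<in> elts A. ap f a = t}"
      have tB: "t \<in> B" by (rule fn_bits_B[OF n t])
      have eq: "{a \<in> elts A. Bm.app f a t} = ?X" unfolding app by blast
      have sub: "{A, f, t} \<subseteq> M" using atom_set fM B_in[OF tB] by blast
      \<comment> \<open>A fibre of \<open>f\<close> may be uncountable and then is not its own
        support; it lies in the model because \<open>f\<close> and \<open>t\<close> define
        it.\<close>
      have Def: "Def M E {A, f, t} (\<lambda>e. e 0 \<in> ?X)"
        by (intro def_intros sub) simp_all
      have X: "setlike ?X"
        by (rule setlike_subset[OF setlike_elts'[OF atom_set] _ Def_mono[OF Def sub]]) blast
      have XB: "St ?X \<in> B"
        by (rule atoms_subset_B[OF X _ _ _ Def]) (use A_in_B f(1) tB in auto)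
      have "Bm.is_finite (St ?X) \<longleftrightarrow> is_finite (St ?X)"
        using Bm_is_finite[OF is_set_St[OF X] _ XB] X by auto
      moreover have "is_finite (St ?X) \<longleftrightarrow> \<not> infin ?X"
        using not_finite_infin[OF St_in[OF X]] infin_not_finite[OF St_in[OF X]] elts_St[OF X] by auto
      ultimately show ?thesis unfolding eq Bm_codes codes_iff using X XB by blast
    qed
    moreover have "Bm.fn t n bits \<longleftrightarrow> fn t n bits" for t
      using Bm_fn[OF omega_B[OF n]] fn_bits_B[OF n] by blast
    ultimately show ?thesis
      unfolding Bm.P_level_def Bm_bits Bm_elts[OF A_in_B] mem_Collect_eq by (simp cong: imp_cong)
  qed
  have "f \<in> B \<and> fn f A {h. fn h n bits}" if "f \<in> Bm.P_level n"
  proof -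
    have f: "f \<in> B" "fn f A Bm.Q" "\<And>a h. Bm.app f a h \<Longrightarrow> Bm.fn h n bits"
      using that Bm_fn[OF A_in_B] unfolding Bm.P_level_def Bm_bits by auto
    have "fn h n bits" if "app f a h" for a h
      using f(3)[of a h] that Bm_app[OF f(1)] Bm_fn[OF omega_B[OF n]] by blast
    then show ?thesis using f(1) fn_codomain[OF f(2), of "{h. fn h n bits}"] by simp
  qed
  then show ?thesis using main by blast
qed

section \<open>Density\<close>

lemma fn_eq:
  assumes "fn f d X" "fn g d Y" "\<And>x. x \<in> elts d \<Longrightarrow> ap f x = ap g x" shows "f = g"
proof -
  have "elts f = elts g" unfolding fn_elts[OF assms(1)] fn_elts[OF assms(2)] using assms(3) by simp
  then show ?thesis using extensionality fnD(1)[OF assms(1)] fnD(1)[OF assms(2)] by blast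
qed

definition extend :: "'a \<Rightarrow> 'a \<Rightarrow> 'a \<Rightarrow> 'a" where
  "extend n t b = St (insert (pr n b) (elts t))"

lemma extend:
  assumes n: "n \<in> \<omega>" and t: "fn t n X" and b: "b \<in> X" "b \<in> M"
  shows "fn (extend n t b) (sc n) X" "k \<in> elts n \<Longrightarrow> ap (extend n t b) k = ap t k" "ap (extend n t b) n = b"
    "elts t \<subseteq> elts (extend n t b)"
proof -
  have nM: "n \<in> M" using n by simp
  have tM: "t \<in> M" using fnD(2)[OF t] .
  let ?F = "\<lambda>k. if k = n then b else ap t k"
  have F: "tot ?F" unfolding tot_def
    by (intro DT_if Def_eq DT_var DT_param nM b order_refl tot_term[OF tot_ap[OF tM]])
  have s: "setlike (elts (sc n))" using nM by simp
  have F_n: "?F k = ap t k" if "k \<in> elts n" for k using that mem_irrefl by auto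
  have "(\<lambda>k. pr k (?F k)) ` elts (sc n) = insert (pr n b) ((\<lambda>k. pr k (?F k)) ` elts n)"
    using nM by simp
  also have "(\<lambda>k. pr k (?F k)) ` elts n = elts t"
    unfolding fn_elts[OF t] by (rule image_cong) (simp_all add: F_n)
  finally have eq: "extend n t b = graph ?F (elts (sc n))" unfolding extend_def graph_def by simp
  show "fn (extend n t b) (sc n) X"
    unfolding eq
  proof (rule fn_graph[OF F s refl], rule image_subsetI)
    fix k assume "k \<in> elts (sc n)"
    then show "?F k \<in> X" using b(1) fnD(3)[OF t] nM by auto
  qed
  have ap: "ap (extend n t b) k = ?F k" if "k \<in> elts (sc n)" for k
    unfolding eq by (rule ap_graph[OF F s that])
  show "k \<in> elts n \<Longrightarrow> ap (extend n t b) k = ap t k" using ap[of k] F_n[of k] nM by simp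
  show "ap (extend n t b) n = b" using ap[of n] nM by simp
  have "setlike (insert (pr n b) (elts t))" using tM nM b(2) by simp
  then show "elts t \<subseteq> elts (extend n t b)" unfolding extend_def by auto
qed

text \<open>Every function on \<open>sc n\<close> arises by \<open>extend\<close>, so a fibre of an
  extended condition can be located within a fibre of the original one.\<close>

lemma extend_restrict:
  assumes n: "n \<in> \<omega>" and t: "fn t (sc n) X"
  shows "\<exists>t0. fn t0 n X \<and> t = extend n t0 (ap t n)"
proof -
  have nM: "n \<in> M" using n by simp
  have T: "tot (ap t)" using tot_ap[OF fnD(2)[OF t]] .
  have s: "setlike (elts n)" using nM by simp
  have t0: "fn (graph (ap t) (elts n)) n X"
    by (rule fn_graph[OF T s refl]) (use fnD(3)[OF t] nM in auto)
  have X: "ap t n \<in> X" using fnD(3)[OF t, of n] nM by simp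
  note e = extend[OF n t0 X ap_in]
  have "t = extend n (graph (ap t) (elts n)) (ap t n)"
  proof (rule fn_eq[OF t e(1)])
    fix k assume "k \<in> elts (sc n)"
    then consider "k = n" | "k \<in> elts n" using nM by auto
    then show "ap t k = ap (extend n (graph (ap t) (elts n)) (ap t n)) k"
    proof cases
      case 1
      then show ?thesis using e(3) by simp
    next
      case 2
      then show ?thesis using e(2) ap_graph[OF T s] by simp
    qed
  qed
  then show ?thesis using t0 by blast
qed

lemma setlike_bits: "setlike bits"
proof -
  have "bits = {zero, one}" using bits_iff by blast
  then show ?thesis by simp
qed

lemma setlike_functions:
  assumes "d \<in> M" "setlike X" shows "setlike {h. fn h d X}"
proof (rule setlike_subset)
  show "setlike {f. is_set f \<and> elts f \<subseteq> {z. \<exists>x\<in>elts d. \<exists>y\<in>X. z = pr x y}}"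
    by (intro setlike_Pow setlike_Times setlike_elts' assms)
  show "{h. fn h d X} \<subseteq> {f. is_set f \<and> elts f \<subseteq> {z. \<exists>x\<in>elts d. \<exists>y\<in>X. z = pr x y}}"
  proof
    fix h assume "h \<in> {h. fn h d X}"
    then have h: "fn h d X" by simp
    show "h \<in> {f. is_set f \<and> elts f \<subseteq> {z. \<exists>x\<in>elts d. \<exists>y\<in>X. z = pr x y}}"
      unfolding mem_Collect_eq fn_elts[OF h] using fnD(1,3)[OF h] by blast
  qed
  have "X \<subseteq> M" using setlike_subset_M[OF assms(2)] .
  then show "D (\<lambda>e. e 0 \<in> {h. fn h d X})"
    by (intro Def_Collect def_fn atom_set order_refl DT_var DT_param assms D_setlike)
qed

text \<open>By choice, each fibre of \<open>f\<close> is split by a countable set into two infinite parts. Only the fibre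
  of the constant function \<open>1\<close> can be uncountable, so the union of these countable sets is countable.\<close>

lemma splitting:
  assumes n: "n \<in> \<omega>" and f: "f \<in> Bm.P_level n" and a: "a \<in> elts A" and ab: "a \<noteq> b"
  shows "\<exists>S. cset S \<and> a \<in> elts S \<and> b \<notin> elts S \<and> (\<forall>t. fn t n bits \<longrightarrow>
    infin {c \<in> elts S. ap f c = t} \<and> infin {c \<in> elts A. ap f c = t \<and> c \<notin> elts S})"
proof -
  have f: "f \<in> B" "fn f A {h. fn h n bits}" "ctb {a \<in> elts A. \<exists>k\<in>elts n. ap (ap f a) k = zero}"
    "\<And>t. fn t n bits \<Longrightarrow> infin {a \<in> elts A. ap f a = t}"
    using f unfolding P_level_iff[OF n] by blast+
  have fM: "f \<in> M" using f(1) B_in by blast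
  have nM: "n \<in> M" using n by simp
  have fa: "fn (ap f c) n bits" if "c \<in> elts A" for c using fnD(3)[OF f(2) that] by simp
  let ?T = "{t. fn t n bits}"
  have T: "setlike ?T" by (rule setlike_functions[OF nM setlike_bits])
  \<comment> \<open>What the fibre of \<open>t\<close> retains outside \<open>s\<close>.\<close>
  define R where "R s t = {c. c \<in> elts A \<and> ap f c = t \<and> c \<notin> elts s}" for s t
  have R: "setlike (R s t)" if "s \<in> M" "t \<in> M" for s t
    unfolding R_def
    by (rule setlike_sep[OF setlike_elts'[OF atom_set]]) (intro def_intros atom_set order_refl fM that)
  define ZP where "ZP s t \<longleftrightarrow> is_set s \<and> elts s \<subseteq> elts A \<and> (\<forall>c\<in>elts s. ap f c = t) \<and> is_countable s \<and>
    infin (elts s) \<and> infin (elts (St (R s t)))" for s t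
  have DR: "DTM (\<lambda>e. St (R (e i) (e j)))" for i j
  proof (rule DT_St[OF _ _ atom_set order_refl])
    show "D (\<lambda>e. e 0 \<in> R (e (Suc i)) (e (Suc j)))" unfolding R_def
      by (intro def_intros atom_set order_refl fM)
    show "setlike (R (e i) (e j))" if "range e \<subseteq> M" for e :: "nat \<Rightarrow> 'a"
      using that by (intro R) auto
  qed
  have DZ: "D (\<lambda>e. ZP (e i) (e j))" for i j unfolding ZP_def
    by (intro Def_conj def_is_set def_subset_elts Def_Ball def_elts Def_eq DT_ap def_is_countable D_infin DR
        atom_set order_refl fM DT_var DT_param elts_subset_M)
  \<comment> \<open>The candidates among which to choose. The first two clauses, repeated from
    \<open>ZP\<close>, exhibit \<open>Z t\<close> as cut out of the power set of
    \<open>A\<close>.\<close>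
  define Z where "Z t = {s. (is_set s \<and> elts s \<subseteq> elts A) \<and> ZP s t}" for t
  have Z: "setlike (Z t)" if "t \<in> M" for t
  proof -
    have "D (\<lambda>e. ZP (e 0) t)"
      by (rule Def_subst2[of M E M ZP, OF DZ DT_var DT_param[OF that order_refl]])
    from setlike_sep[OF setlike_Pow[OF setlike_elts'[OF atom_set]] this]
    show ?thesis unfolding Z_def by (simp only: mem_Collect_eq)
  qed
  have Zt: "tot (\<lambda>t. St (Z t))" unfolding tot_def
  proof (rule DT_St[OF _ _ atom_set order_refl])
    show "D (\<lambda>e. e 0 \<in> Z (e (Suc 0)))" unfolding Z_def
      by (intro Def_Collect Def_conj DZ def_is_set def_subset_elts DT_var DT_param atom_set order_refl)
  qed (simp add: Z range_subsetD)
  let ?ZZ = "(\<lambda>t. St (Z t)) ` ?T"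
  have ZZ: "setlike ?ZZ" by (rule setlike_tot_image[OF T Zt])
  have T_M: "t \<in> M" if "t \<in> ?T" for t using that fnD(2) by blast
  have "Z t \<noteq> {}" if t: "t \<in> ?T" for t
  proof -
    obtain S where S: "S \<subseteq> {c \<in> elts A. ap f c = t}" "setlike S" "ctb S" "infin S" "infin ({c \<in> elts A. ap f c = t} - S)"
      using infin_split[OF f(4)] t by blast
    have "{c \<in> elts A. ap f c = t} - S = R (St S) t" unfolding R_def using S(2) by auto
    then have "ZP (St S) t"
      unfolding ZP_def is_countable_iff[OF St_in[OF S(2)]] elts_St[OF R[OF St_in[OF S(2)] T_M[OF t]]] elts_St[OF S(2)]
      using S by auto
    then have "St S \<in> Z t" unfolding Z_def using ZP_def by blast
    then show ?thesis by blast
  qed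
  then have "\<forall>y\<in>elts (St ?ZZ). elts y \<noteq> {}"
    unfolding elts_St[OF ZZ] using Z T_M by simp
  from choice[OF is_set_St[OF ZZ] this] obtain g where
    g: "fn g (St ?ZZ) M" "\<forall>y\<in>?ZZ. \<exists>z\<in>elts y. app g y z" unfolding elts_St[OF ZZ] by blast
  define \<sigma> where "\<sigma> t = ap g (St (Z t))" for t
  have \<sigma>: "ZP (\<sigma> t) t" if t: "t \<in> ?T" for t
  proof -
    obtain z where "z \<in> elts (St (Z t))" "app g (St (Z t)) z" using g(2) t by blast
    then have "\<sigma> t \<in> Z t" using fnD(4)[OF g(1)] Z[OF T_M[OF t]] by (simp add: \<sigma>_def)
    then show ?thesis by (simp add: Z_def)
  qed
  have \<sigma>D: "is_set (\<sigma> t)" "elts (\<sigma> t) \<subseteq> elts A" "\<And>c. c \<in> elts (\<sigma> t) \<Longrightarrow> ap f c = t" "ctb (elts (\<sigma> t))"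
    "infin (elts (\<sigma> t))" "infin (R (\<sigma> t) t)" if t: "t \<in> ?T" for t
  proof -
    have M: "\<sigma> t \<in> M" by (simp add: \<sigma>_def)
    show "is_set (\<sigma> t)" "elts (\<sigma> t) \<subseteq> elts A" "\<And>c. c \<in> elts (\<sigma> t) \<Longrightarrow> ap f c = t" "infin (elts (\<sigma> t))"
      "ctb (elts (\<sigma> t))" "infin (R (\<sigma> t) t)"
      using \<sigma>[OF t] unfolding ZP_def is_countable_iff[OF M] elts_St[OF R[OF M T_M[OF t]]] by auto
  qed
  let ?S' = "\<Union>t\<in>?T. elts (\<sigma> t)"
  have "tot \<sigma>" unfolding \<sigma>_def by (rule tot_comp[OF tot_ap[OF fnD(2)[OF g(1)]] Zt])
  then have "setlike (\<Union>y\<in>\<sigma> ` ?T. elts y)" by (intro setlike_UN setlike_tot_image T)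
  then have S': "setlike ?S'" by simp
  \<comment> \<open>One point more or less destroys neither infinite part of a fibre, by
    \<open>infin_remove\<close>, and \<open>a \<noteq> b\<close> makes the two changes
    compatible.\<close>
  let ?S = "({a} \<union> ?S') - {b}"
  have aM: "a \<in> M" using elts_in[OF a] .
  have S: "setlike ?S"
  \<comment> \<open>For \<open>b\<close> outside \<open>M\<close> there is nothing to
    remove.\<close>
  proof (cases "b \<in> M")
    case True
    then show ?thesis using aM S' by (intro setlike_Diff setlike_Un) simp_all
  next
    case False
    then have "b \<notin> {a} \<union> ?S'" using aM elts_in by blast
    then have "?S = {a} \<union> ?S'" by blast
    then show ?thesis using aM S' by (simp only: setlike_Un setlike_single)
  qed
  have S'A: "?S' \<subseteq> elts A" using \<sigma>D(2) by blast
  let ?X = "{c \<in> elts A. \<exists>k\<in>elts n. ap (ap f c) k = zero}"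
  \<comment> \<open>Where \<open>f\<close> has no zero its value is the constant function 1, so this
    part of the union lies in the one countable set chosen for that fibre. The rest is inside the
    countable \<open>?X\<close>; no countable union of countable sets has to be formed.\<close>
  let ?Y = "{c \<in> ?S'. c \<notin> ?X}"
  have "ctb ?Y"
  proof (cases "?Y = {}")
    case True
    then show ?thesis using ctb_subset[OF ctb_single] by blast
  next
    case False
    then obtain c0 where c0: "c0 \<in> ?Y" by blast
    have "?Y \<subseteq> elts (\<sigma> (ap f c0))"
    proof
      fix c assume c: "c \<in> ?Y"
      have ones: "ap (ap f c) k = one" if "c \<in> ?Y" "k \<in> elts n" for c k
      proof -
        have "c \<in> elts A" using that S'A by blast
        then have "ap (ap f c) k \<noteq> zero" using that by blast
        then show ?thesis using fnD(3)[OF fa[OF \<open>c \<in> elts A\<close>] that(2)] unfolding bits_iff by blast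
      qed
      have "ap f c = ap f c0"
        by (rule fn_eq[OF fa fa]) (use ones[OF c] ones[OF c0] c c0 S'A in auto)
      moreover obtain t where "t \<in> ?T" "c \<in> elts (\<sigma> t)" using c by blast
      ultimately show "c \<in> elts (\<sigma> (ap f c0))" using \<sigma>D(3) by metis
    qed
    moreover have "ap f c0 \<in> ?T" using fa c0 S'A by blast
    ultimately show ?thesis using ctb_subset[OF \<sigma>D(4)] by blast
  qed
  moreover have "setlike ?X"
    by (rule setlike_sep[OF setlike_elts'[OF atom_set]])
      (intro def_intros atom_set order_refl elts_subset_M nM fM zero_in)
  ultimately have "ctb (?X \<union> ?Y)" using f(3) by (intro ctb_Un)
  then have "ctb ({a} \<union> (?X \<union> ?Y))" by (rule ctb_Un[OF setlike_single[OF aM] ctb_single])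
  then have S_ctb: "ctb ?S" by (rule ctb_subset) blast
  have "cset (St ?S)" unfolding cset_def elts_St[OF S] using S_ctb S S'A a by auto
  moreover have "infin {c \<in> ?S. ap f c = t}" "infin {c \<in> elts A. ap f c = t \<and> c \<notin> ?S}" if t: "fn t n bits" for t
  proof -
    have t': "t \<in> ?T" using t by simp
    show "infin {c \<in> ?S. ap f c = t}"
      by (rule infin_mono[OF infin_remove[OF \<sigma>D(5)[OF t'], of b]]) (use \<sigma>D(3)[OF t'] t' in blast)
    \<comment> \<open>The sets chosen in other fibres do not meet this one, so at most
      \<open>a\<close> is lost.\<close>
    have "c \<notin> ?S" if c: "c \<in> R (\<sigma> t) t - {a}" for c
    proof
      assume "c \<in> ?S"
      then obtain t1 where "t1 \<in> ?T" "c \<in> elts (\<sigma> t1)" using c by blast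
      then have "t1 = t" using \<sigma>D(3)[of t1 c] c by (simp add: R_def)
      then show False using \<open>c \<in> elts (\<sigma> t1)\<close> c by (simp add: R_def)
    qed
    then show "infin {c \<in> elts A. ap f c = t \<and> c \<notin> ?S}"
      by (intro infin_mono[OF infin_remove[OF \<sigma>D(6)[OF t'], of a]]) (auto simp: R_def)
  qed
  ultimately show ?thesis
    using ab by (intro exI[of _ "St ?S"]) (simp only: elts_St[OF S], blast)
qed

lemma density:
  assumes n: "n \<in> \<omega>" and f: "f \<in> Bm.P_level n" and a: "a \<in> elts A" and b: "b \<in> elts A" and ab: "a \<noteq> b"
  shows "\<exists>f'\<in>Bm.P_level (sc n). (\<forall>c\<in>elts A. elts (ap f c) \<subseteq> elts (ap f' c)) \<and>
    app (ap f' a) n zero \<and> app (ap f' b) n one"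
proof -
  obtain S where S: "cset S" "a \<in> elts S" "b \<notin> elts S"
    "\<And>t. fn t n bits \<Longrightarrow> infin {c \<in> elts S. ap f c = t}"
    "\<And>t. fn t n bits \<Longrightarrow> infin {c \<in> elts A. ap f c = t \<and> c \<notin> elts S}"
    using splitting[OF n f a ab] by blast
  have f: "f \<in> B" "fn f A {h. fn h n bits}" "ctb {c \<in> elts A. \<exists>k\<in>elts n. ap (ap f c) k = zero}"
    using f unfolding P_level_iff[OF n] by blast+
  have SB: "S \<in> B" using cset_B[OF S(1)] .
  have SA: "elts S \<subseteq> elts A" "ctb (elts S)" "setlike (elts S)" using S(1) by (auto simp: cset_def)
  have zB: "zero \<in> B" "one \<in> B" "n \<in> B" using omega_B zero_omega one_omega n by auto
  let ?K = "{A, f, S, n, zero, one}"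
  have KB: "?K \<subseteq> B" using A_in_B f(1) SB zB by blast
  then have KM: "?K \<subseteq> M" using B_subset by blast
  have M: "f \<in> M" "S \<in> M" "n \<in> M" using KM by auto
  have fa: "fn (ap f c) n bits" if "c \<in> elts A" for c using fnD(3)[OF f(2) that] by simp
  \<comment> \<open>New zeros occur only on the countable set \<open>S\<close>, so the atoms with a
    zero remain countable; \<open>a\<close> gets 0 and \<open>b\<close> gets 1.\<close>
  define i where "i c = (if c \<in> elts S then zero else one)" for c
  have i: "i c \<in> bits" "i c \<in> M" for c by (auto simp: i_def bits_iff)
  define F where "F c = extend n (ap f c) (i c)" for c
  \<comment> \<open>Needed for two sets of parameters: \<open>?K\<close> puts the new condition into
    \<open>B\<close>, and all of \<open>M\<close> makes \<open>F\<close> a total definable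
    function.\<close>
  have DTF: "DT M E K (\<lambda>e. F (e j))" if K: "?K \<subseteq> K" "K \<subseteq> M" for K j
    unfolding F_def extend_def i_def
  proof (rule DT_St)
    show "Def M E K (\<lambda>e. e 0 \<in> insert (pr n (if e (Suc j) \<in> elts S then zero else one)) (elts (ap f (e (Suc j)))))"
      by (intro Def_insert Def_disj Def_eq DT_pr DT_if def_elts DT_ap DT_var DT_param K(2)) (use K(1) in auto)
    show "A \<in> K" "K \<subseteq> M" using K by auto
  qed (use M(3) in simp)
  have F: "tot F" unfolding tot_def by (rule DTF[OF KM order_refl])
  have As: "setlike (elts A)" using atom_set by simp
  have Fc: "fn (F c) (sc n) bits" "elts (ap f c) \<subseteq> elts (F c)" "ap (F c) n = i c"
    "\<And>k. k \<in> elts n \<Longrightarrow> ap (F c) k = ap (ap f c) k" if "c \<in> elts A" for c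
    unfolding F_def using extend[OF n fa[OF that] i] by auto
  define f' where "f' = graph F (elts A)"
  have ap: "ap f' c = F c" if "c \<in> elts A" for c unfolding f'_def by (rule ap_graph[OF F As that])
  have fn: "fn f' A {h. fn h (sc n) bits}"
    unfolding f'_def by (rule fn_graph[OF F As refl]) (use Fc(1) in auto)
  have scn: "sc n \<in> \<omega>" using n by simp
  have "f' \<in> B" unfolding f'_def graph_def
  proof (rule definable_in_perm_model[OF setlike_graph[OF F As] _ _ KB])
    show "(\<lambda>c. pr c (F c)) ` elts A \<subseteq> B"
      using pr_B atoms_B fn_bits_B[OF scn Fc(1)] by blast
    have eq: "(\<lambda>c. pr c (F c)) ` elts A = {z. \<exists>c\<in>elts A. z = pr c (F c)}" by blast
    show "Def M E ?K (\<lambda>e. e 0 \<in> (\<lambda>c. pr c (F c)) ` elts A)" unfolding eq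
      by (intro Def_Collect Def_Bex Def_eq def_elts DT_pr DTF DT_var DT_param KM elts_subset_M) simp_all
  qed simp
  moreover have "ctb {c \<in> elts A. \<exists>k\<in>elts (sc n). ap (ap f' c) k = zero}"
  proof (rule ctb_subset[OF ctb_Un[OF SA(3,2) f(3)]], rule subsetI)
    fix c assume "c \<in> {c \<in> elts A. \<exists>k\<in>elts (sc n). ap (ap f' c) k = zero}"
    then have "\<exists>k. (k = n \<or> k \<in> elts n) \<and> ap (F c) k = zero" and c: "c \<in> elts A" using ap M(3) by auto
    then obtain k where k: "c \<in> elts A" "k = n \<or> k \<in> elts n" "ap (F c) k = zero" by blast
    show "c \<in> elts S \<union> {c \<in> elts A. \<exists>k\<in>elts n. ap (ap f c) k = zero}"
    proof (cases "k = n")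
      case True
      then have "c \<in> elts S" using k Fc(3) zero_neq_one by (auto simp: i_def split: if_splits)
      then show ?thesis by blast
    next
      case False
      then show ?thesis using k Fc(4)[OF k(1)] by auto
    qed
  qed
  moreover have "infin {c \<in> elts A. ap f' c = t}" if t: "fn t (sc n) bits" for t
  proof -
    \<comment> \<open>The last bit of \<open>t\<close> decides on which side of \<open>S\<close> to
      look: both halves of the fibre of \<open>t0\<close> are infinite.\<close>
    obtain t0 where t0: "fn t0 n bits" "t = extend n t0 (ap t n)" using extend_restrict[OF n t] by blast
    have "ap t n \<in> bits" using fnD(3)[OF t, of n] M(3) by simp
    then consider "ap t n = zero" | "ap t n = one" unfolding bits_iff by blast
    then show ?thesis
    proof cases
      case 1
      show ?thesis
      proof (rule infin_mono[OF S(4)[OF t0(1)]], rule subsetI)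
        fix c assume "c \<in> {c \<in> elts S. ap f c = t0}"
        then show "c \<in> {c \<in> elts A. ap f' c = t}" using ap SA(1) t0(2) 1 by (auto simp: F_def i_def)
      qed
    next
      case 2
      show ?thesis
      proof (rule infin_mono[OF S(5)[OF t0(1)]], rule subsetI)
        fix c assume "c \<in> {c \<in> elts A. ap f c = t0 \<and> c \<notin> elts S}"
        then show "c \<in> {c \<in> elts A. ap f' c = t}" using ap t0(2) 2 by (auto simp: F_def i_def)
      qed
    qed
  qed
  ultimately have "f' \<in> Bm.P_level (sc n)" unfolding P_level_iff[OF scn] using fn by blast
  moreover have "app (ap f' a) n zero" "app (ap f' b) n one"
    using fnD(4)[OF Fc(1)[OF a]] fnD(4)[OF Fc(1)[OF b]] Fc(3)[OF a] Fc(3)[OF b] S(2,3) M(3) ap[OF a] ap[OF b]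
    by (simp_all add: i_def)
  moreover have "\<forall>c\<in>elts A. elts (ap f c) \<subseteq> elts (ap f' c)" using ap Fc(2) by simp
  ultimately show ?thesis by blast
qed

lemma Bm_P_iff: "f \<in> Bm.P \<longleftrightarrow> (\<exists>n\<in>\<omega>. f \<in> Bm.P_level n)"
  unfolding Bm.P_def Bm_omega by blast

lemma P_fn:
  assumes "f \<in> Bm.P_level n" "n \<in> \<omega>" shows "f \<in> B" "fn f A {h. fn h n bits}"
  using assms P_level_iff by blast+

text \<open>Conditions of all levels are relations between \<open>A\<close> and relations from
  \<open>\<omega>\<close> to \<open>bits\<close>, hence members of one iterated power set.\<close>

lemma setlike_P: "setlike Bm.P"
proof (rule setlike_subset)
  let ?Z = "{z. \<exists>x\<in>\<omega>. \<exists>y\<in>bits. z = pr x y}"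
  let ?H = "{h. is_set h \<and> elts h \<subseteq> ?Z}"
  show "setlike {f. is_set f \<and> elts f \<subseteq> {z. \<exists>x\<in>elts A. \<exists>y\<in>?H. z = pr x y}}"
    by (intro setlike_Pow setlike_Times setlike_elts' atom_set setlike_omega setlike_bits)
  show "Bm.P \<subseteq> {f. is_set f \<and> elts f \<subseteq> {z. \<exists>x\<in>elts A. \<exists>y\<in>?H. z = pr x y}}"
  proof
    fix f assume "f \<in> Bm.P"
    then obtain n where n: "n \<in> \<omega>" "f \<in> Bm.P_level n" using Bm_P_iff by blast
    note f = P_fn(2)[OF n(2,1)]
    have "h \<in> ?H" if h: "fn h n bits" for h
      unfolding mem_Collect_eq fn_elts[OF h] using fnD(1,3)[OF h] omega_mem[OF n(1)] by blast
    then have "ap f x \<in> ?H" if "x \<in> elts A" for x using fnD(3)[OF f that] by blast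
    then show "f \<in> {f. is_set f \<and> elts f \<subseteq> {z. \<exists>x\<in>elts A. \<exists>y\<in>?H. z = pr x y}}"
      unfolding mem_Collect_eq fn_elts[OF f] using fnD(1)[OF f] by blast
  qed
  show "D (\<lambda>e. e 0 \<in> Bm.P)" by (intro Bm.def_P atom_set order_refl DT_var)
qed

lemma P_in_B: "St Bm.P \<in> B"
  by (rule definable_in_perm_model[where K="{A}", OF setlike_P Bm.P_subset])
    (use A_in_B atom_set in \<open>auto intro!: Bm.def_P DT_var\<close>)

lemma le_P_iff:
  assumes "p \<in> B" "q \<in> B" "fn p A X" "fn q A Y"
  shows "Bm.le_P p q \<longleftrightarrow> (\<forall>a\<in>elts A. elts (ap q a) \<subseteq> elts (ap p a))"
proof -
  have "Bm.app p a h \<longleftrightarrow> a \<in> elts A \<and> h = ap p a" "Bm.app q a h \<longleftrightarrow> a \<in> elts A \<and> h = ap q a" for a h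
    unfolding Bm_app[OF assms(1)] Bm_app[OF assms(2)] fnD(4)[OF assms(3)] fnD(4)[OF assms(4)] by blast+
  moreover have "Bm.elts (ap p a) = elts (ap p a)" "Bm.elts (ap q a) = elts (ap q a)" if "a \<in> elts A" for a
    using app_B[OF assms(1) fnD(5)[OF assms(3) that]] app_B[OF assms(2) fnD(5)[OF assms(4) that]] Bm_elts by auto
  ultimately show ?thesis
    unfolding Bm.le_P_def Bm.le_Q_def Bm_elts[OF A_in_B] by auto
qed

definition separating :: "'a \<Rightarrow> 'a \<Rightarrow> 'a set" where
  "separating a b = {q \<in> Bm.P. \<exists>n\<in>\<omega>. app (ap q a) n zero \<and> app (ap q b) n one}"

text \<open>Genericity tests only dense sets of the model; this one belongs to it because it is
  definable from \<open>A\<close>, \<open>a\<close>, \<open>b\<close> and the two bits.\<close>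

lemma separating_dense:
  assumes a: "a \<in> elts A" and b: "b \<in> elts A" and ab: "a \<noteq> b"
  shows "forcing.dense B E A Bm.P Bm.le_P (St (separating a b))" "setlike (separating a b)" "St (separating a b) \<in> B"
proof -
  have sub: "separating a b \<subseteq> Bm.P" unfolding separating_def by blast
  let ?K = "{A, a, b, zero, one}"
  have KB: "?K \<subseteq> B" using A_in_B atoms_B[OF a] atoms_B[OF b] omega_B[OF zero_omega] omega_B[OF one_omega] by blast
  then have KM: "?K \<subseteq> M" using B_subset by blast
  have Def: "Def M E ?K (\<lambda>e. e 0 \<in> separating a b)" unfolding separating_def
    by (intro def_intros KM class_subsets) simp_all
  show s: "setlike (separating a b)"
    by (rule setlike_subset[OF setlike_P sub Def_mono[OF Def KM]])
  show sB: "St (separating a b) \<in> B"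
    by (rule definable_in_perm_model[OF s _ _ KB Def]) (use sub Bm.P_subset in auto)
  interpret F: forcing B E A Bm.P Bm.le_P .
  have "\<exists>q\<in>separating a b. Bm.le_P q p" if p: "p \<in> Bm.P" for p
  proof -
    obtain n where n: "n \<in> \<omega>" "p \<in> Bm.P_level n" using p Bm_P_iff by blast
    obtain q where q: "q \<in> Bm.P_level (sc n)" "\<forall>c\<in>elts A. elts (ap p c) \<subseteq> elts (ap q c)"
      "app (ap q a) n zero" "app (ap q b) n one" using density[OF n a b ab] by blast
    have scn: "sc n \<in> \<omega>" using n(1) by simp
    have "q \<in> separating a b" unfolding separating_def using q n(1) scn Bm_P_iff by blast
    moreover have "Bm.le_P q p"
      using le_P_iff[OF P_fn(1)[OF q(1) scn] P_fn(1)[OF n(2,1)] P_fn(2)[OF q(1) scn] P_fn(2)[OF n(2,1)]] q(2)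
      by blast
    ultimately show ?thesis by blast
  qed
  then show "forcing.dense B E A Bm.P Bm.le_P (St (separating a b))"
    unfolding F.dense_def Bm_is_set Bm_elts[OF sB] elts_St[OF s] using sB sub s by simp
qed

text \<open>The weakest condition is the constant function with value the empty function.\<close>

lemma top_condition:
  assumes unc: "\<not> is_countable A"
  shows "\<exists>u. u \<in> Bm.P \<and> (\<forall>p\<in>Bm.P. Bm.le_P p u) \<and> (\<forall>v\<in>Bm.P. (\<forall>p\<in>Bm.P. Bm.le_P p v) \<longrightarrow> v = u)"
proof -
  have As: "setlike (elts A)" using atom_set by simp
  have t: "tot (\<lambda>_. zero)" by (rule tot_const) simp
  let ?u = "graph (\<lambda>_. zero) (elts A)"
  have fn0: "fn h zero bits \<longleftrightarrow> h = zero" for h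
  proof
    assume h: "fn h zero bits"
    then have "elts h = {}" using fn_elts[OF h] by simp
    then show "h = zero" using extensionality[OF fnD(1)[OF h] is_set_zero] by simp
  qed (simp add: fn_def)
  have u: "fn ?u A {h. fn h zero bits}" by (rule fn_graph[OF t As refl]) (auto simp: fn0)
  have ap: "ap ?u a = zero" if "a \<in> elts A" for a by (rule ap_graph[OF t As that])
  have zB: "zero \<in> B" using omega_B by simp
  have uB: "?u \<in> B" unfolding graph_def
  proof (rule definable_in_perm_model[where K="{A, zero}", OF setlike_graph[OF t As]])
    show "(\<lambda>x. pr x zero) ` elts A \<subseteq> B" using pr_B atoms_B zB by blast
    show KB: "{A, zero} \<subseteq> B" using A_in_B zB by blast
    have eq: "(\<lambda>x. pr x zero) ` elts A = {z. \<exists>x\<in>elts A. z = pr x zero}" by blast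
    show "Def M E {A, zero} (\<lambda>e. e 0 \<in> (\<lambda>x. pr x zero) ` elts A)" unfolding eq
      by (intro def_intros elts_subset_M subset_trans[OF KB B_subset]) simp_all
  qed simp
  \<comment> \<open>At level zero the empty function has all of \<open>A\<close> as its fibre, which
    must be infinite; a finite \<open>A\<close> would be countable.\<close>
  have "\<not> is_finite A"
  proof
    assume "is_finite A"
    then obtain n F where F: "n \<in> \<omega>" "tot F" "bij_betw F (elts A) (elts n)"
      unfolding is_finite_iff[OF atom_set] by blast
    have "ctb (elts A)"
      by (rule ctbI[OF F(2) _ bij_betw_imp_inj_on[OF F(3)]]) (use bij_betw_apply[OF F(3)] omega_mem[OF F(1)] in blast)
    then show False using unc is_countable_iff[OF atom_set] by blast
  qed
  then have inf: "infin (elts A)" by (rule not_finite_infin[OF atom_set])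
  have "{a \<in> elts A. ap ?u a = zero} = elts A" using ap by blast
  then have "infin {a \<in> elts A. ap ?u a = t}" if "fn t zero bits" for t
    using that inf unfolding fn0 by simp
  moreover have "ctb {a \<in> elts A. \<exists>k\<in>elts zero. ap (ap ?u a) k = zero}"
    by (rule ctb_subset[OF ctb_single]) simp
  ultimately have "?u \<in> Bm.P_level zero"
    unfolding P_level_iff[OF zero_omega] using uB u by blast
  then have u1: "?u \<in> Bm.P" using Bm_P_iff zero_omega by blast
  have u2: "Bm.le_P p ?u" if p: "p \<in> Bm.P" for p
  proof -
    obtain n where n: "n \<in> \<omega>" "p \<in> Bm.P_level n" using p Bm_P_iff by blast
    show ?thesis
      by (rule iffD2[OF le_P_iff[OF P_fn(1)[OF n(2,1)] uB P_fn(2)[OF n(2,1)] u]]) (simp add: ap)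
  qed
  \<comment> \<open>If \<open>?u\<close> is below \<open>v\<close>, the values of \<open>v\<close>
    are included in the empty function.\<close>
  have u3: "v = ?u" if v: "v \<in> Bm.P" "Bm.le_P ?u v" for v
  proof -
    obtain n where n: "n \<in> \<omega>" "v \<in> Bm.P_level n" using v(1) Bm_P_iff by blast
    note fv = P_fn(2)[OF n(2,1)]
    have "ap v a = zero" if a: "a \<in> elts A" for a
    proof -
      have "elts (ap v a) \<subseteq> elts (ap ?u a)"
        using iffD1[OF le_P_iff[OF uB P_fn(1)[OF n(2,1)] u fv] v(2)] a by (rule bspec)
      then have "elts (ap v a) = {}" unfolding ap[OF a] elts_zero by (rule equalityI) (rule empty_subsetI)
      moreover have "fn (ap v a) n bits" using fnD(3)[OF fv a] by simp
      then have "is_set (ap v a)" by (rule fnD(1))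
      ultimately show ?thesis by (intro extensionality[OF _ is_set_zero]) (simp_all only: elts_zero)
    qed
    then show ?thesis by (intro fn_eq[OF fv u]) (simp add: ap)
  qed
  show ?thesis
  proof (intro exI[of _ ?u] conjI ballI impI u1)
    fix v assume v: "v \<in> Bm.P" "\<forall>p\<in>Bm.P. Bm.le_P p v"
    show "v = ?u" by (rule u3[OF v(1) bspec[OF v(2) u1]])
  qed (rule u2)
qed

section \<open>Canonical names\<close>

text \<open>The transitive closure is definable from \<open>x\<close>, so every support of
  \<open>x\<close> supports it.\<close>

lemma ex_transitive_B: assumes x: "x \<in> B" shows "\<exists>T\<in>B. transitive T \<and> x \<in> elts T"
proof -
  obtain T where T: "is_trancl x T" using ex_trancl[OF B_in[OF x]] by blast
  have tr: "transitive T" "x \<in> elts T" using T by (auto simp: is_trancl_def)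
  have TM: "T \<in> M" using transitive_in[OF tr(1)] .
  have Tset: "is_set T" using tr(1) by (simp add: transitive_def)
  have "D (\<lambda>e. e 0 \<in> B)" by (rule def_B[OF atom_set order_refl])
  from transitive_Int[OF tr(1) this]
  have U: "transitive (St {z \<in> elts T. z \<in> B})" "elts (St {z \<in> elts T. z \<in> B}) = {z \<in> elts T. z \<in> B}"
    using B_mem by blast+
  have "x \<in> elts (St {z \<in> elts T. z \<in> B})" unfolding U(2) using tr(2) x by blast
  then have "elts T \<subseteq> elts (St {z \<in> elts T. z \<in> B})" using T U(1) unfolding is_trancl_def by blast
  then have sub: "elts T \<subseteq> B" unfolding U(2) by blast
  obtain C where C: "cset C" "supports C x" using B_symmetric[OF x] by blast
  have "supports C T" unfolding supports_def
  proof (intro ballI impI)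
    fix \<pi> assume \<pi>: "\<pi> \<in> perms" "\<forall>c\<in>elts C. ap \<pi> c = c"
    have x': "act \<pi> x = x" using C(2) \<pi> unfolding supports_def by blast
    have TA: "is_set (act \<pi> T)" using act_set[OF permsD(2)[OF \<pi>(1)] Tset] by (simp add: codes_def)
    have "Def M E {A} (\<lambda>e. is_trancl (e 0) (e (Suc 0)))"
      by (intro def_is_trancl DT_var) (use atom_set in auto)
    from act_invariant[OF \<pi>(1) this, of "case_nat x (\<lambda>_. T)"]
    have "is_trancl (act \<pi> x) (act \<pi> T) \<longleftrightarrow> is_trancl x T"
      using act_A[OF \<pi>(1)] atom_set range_case_nat[of x M "\<lambda>_. T"] B_in[OF x] TM by auto
    then have "is_trancl x (act \<pi> T)" using T x' by simp
    from is_trancl_unique[OF this T] show "act \<pi> T = T" using extensionality[OF TA Tset] by blast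
  qed
  then have "T \<in> B" using supported_in_perm_model[OF TM sub C(1)] by blast
  then show ?thesis using tr by blast
qed

text \<open>The recursion is carried out in the universe, where \<open>eps_recursion\<close> is
  available; that the values and the witnesses of the recursion lie in \<open>B\<close> is shown
  afterwards.\<close>

definition check :: "'a \<Rightarrow> 'a \<Rightarrow> 'a" where
  "check u = (SOME f. tot f \<and> (\<forall>x\<in>elts A. f x = x) \<and>
    (\<forall>x. is_set x \<longrightarrow> codes (f x) ((\<lambda>s. pr (f s) u) ` elts x)))"

context
  fixes u :: 'a
  assumes uB: "u \<in> B"
begin

lemma uM: "u \<in> M"
  using uB B_in by blast

lemma check_spec: "tot (check u) \<and> (\<forall>x\<in>elts A. check u x = x) \<and>
    (\<forall>x. is_set x \<longrightarrow> codes (check u x) ((\<lambda>s. pr (check u s) u) ` elts x))"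
proof -
  \<comment> \<open>The instance of \<open>eps_recursion\<close> in which the value at each element
    is paired with \<open>u\<close> before it is collected.\<close>
  have "DTM (\<lambda>e. pr (e 0) u)" by (intro def_intros atom_set order_refl uM)
  from eps_recursion[OF this DT_var[of M E M 0]] have
    "\<exists>f. tot f \<and> (\<forall>x\<in>elts A. f x = x) \<and> (\<forall>x. is_set x \<longrightarrow> codes (f x) ((\<lambda>s. pr (f s) u) ` elts x))"
    unfolding tot_def .
  from someI_ex[OF this] show ?thesis unfolding check_def .
qed

lemma check_tot: "tot (check u)" and check_atom: "a \<in> elts A \<Longrightarrow> check u a = a"
  and check_codes: "is_set x \<Longrightarrow> codes (check u x) ((\<lambda>s. pr (check u s) u) ` elts x)"
  using check_spec by blast+

lemma check_in: "x \<in> M \<Longrightarrow> check u x \<in> M"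
  by (rule tot_in[OF check_tot])

lemma check_elts: "is_set x \<Longrightarrow> elts (check u x) = (\<lambda>s. pr (check u s) u) ` elts x"
  and check_is_set: "is_set x \<Longrightarrow> is_set (check u x)"
  using check_codes by (simp_all add: codes_def)

text \<open>The recursion uses \<open>u\<close> as its only parameter, so permutations fixing
  \<open>u\<close> commute with it. A common support of \<open>x\<close> and \<open>u\<close>
  therefore supports \<open>check u x\<close>.\<close>

lemma act_check:
  assumes \<pi>: "\<pi> \<in> perms" "act \<pi> u = u" and x: "x \<in> M"
  shows "act \<pi> (check u x) = check u (act \<pi> x)"
  using x
proof (rule eps_induct)
  note piM = permsD(2)[OF \<pi>(1)]
  show "D (\<lambda>e. act \<pi> (check u (e 0)) = check u (act \<pi> (e 0)))"
    by (intro Def_eq act_term[OF piM] tot_term[OF check_tot] DT_var)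
  fix x assume x: "x \<in> M" and IH: "\<And>y. y \<in> elts x \<Longrightarrow> act \<pi> (check u y) = check u (act \<pi> y)"
  show "act \<pi> (check u x) = check u (act \<pi> x)"
  proof (cases "x \<in> elts A")
    case True
    then show ?thesis using act_atom[OF piM True] check_atom perm_ap_in[OF \<pi>(1) True] by simp
  next
    case False
    then have s: "is_set x" using x is_set_or_atom by blast
    have s': "is_set (act \<pi> x)" using act_set[OF piM s] by (simp add: codes_def)
    have "act \<pi> (pr (check u y) u) = pr (check u (act \<pi> y)) u" if "y \<in> elts x" for y
      using act_pr[OF \<pi>(1) check_in[OF elts_in[OF that]] uM] IH[OF that] \<pi>(2) by simp
    then have "act \<pi> ` (\<lambda>s. pr (check u s) u) ` elts x = (\<lambda>s. pr (check u s) u) ` act \<pi> ` elts x"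
      unfolding image_image by (rule image_cong[OF refl])
    then have "codes (act \<pi> (check u x)) ((\<lambda>s. pr (check u s) u) ` elts (act \<pi> x))"
      using act_set[OF piM check_is_set[OF s]] unfolding check_elts[OF s] act_elts[OF piM s] by simp
    then show ?thesis using codes_unique check_codes[OF s'] by blast
  qed
qed

lemma check_B: assumes "x \<in> B" shows "check u x \<in> B"
proof -
  have "x \<in> B \<longrightarrow> check u x \<in> B"
  proof (rule eps_induct[OF B_in[OF assms]])
    show "D (\<lambda>e. e 0 \<in> B \<longrightarrow> check u (e 0) \<in> B)"
      by (intro Def_imp def_B Bm.def_class tot_term[OF check_tot] DT_var atom_set order_refl)
    fix x assume xM: "x \<in> M" and IH: "\<And>y. y \<in> elts x \<Longrightarrow> y \<in> B \<longrightarrow> check u y \<in> B"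
    show "x \<in> B \<longrightarrow> check u x \<in> B"
    proof
      assume x: "x \<in> B"
      show "check u x \<in> B"
      proof (cases "x \<in> elts A")
        case True
        then show ?thesis using check_atom x by simp
      next
        case False
        then have s: "is_set x" using xM is_set_or_atom by blast
        obtain C where C: "cset C" "\<forall>c\<in>{x, u}. supports C c" using common_support[of "{x, u}"] x uB by blast
        show ?thesis
        proof (rule supported_in_perm_model[OF check_in[OF xM] _ C(1)])
          show "elts (check u x) \<subseteq> B" unfolding check_elts[OF s]
            using IH B_mem[OF x] pr_B uB by blast
          show "supports C (check u x)" unfolding supports_def
          proof (intro ballI impI)
            fix \<pi> assume \<pi>: "\<pi> \<in> perms" "\<forall>c\<in>elts C. ap \<pi> c = c"
            then have "act \<pi> x = x" "act \<pi> u = u" using C(2) by (auto simp: supports_def)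
            then show "act \<pi> (check u x) = check u x" using act_check[OF \<pi>(1) _ xM] by simp
          qed
        qed
      qed
    qed
  qed
  with assms show ?thesis by blast
qed

text \<open>\<open>is_check\<close> demands a witness of the recursion inside the model; restricted
  to a set \<open>T\<close>, \<open>check u\<close> provides one supported along with
  \<open>T\<close> and \<open>u\<close>.\<close>

lemma graph_check_B: assumes T: "T \<in> B" "is_set T" shows "graph (check u) (elts T) \<in> B"
proof -
  have Ts: "setlike (elts T)" using T by simp
  obtain C where C: "cset C" "\<forall>c\<in>{T, u}. supports C c" using common_support[of "{T, u}"] T uB by blast
  note g = elts_graph[OF check_tot Ts]
  show ?thesis
  proof (rule supported_in_perm_model[OF graph_in[OF check_tot Ts] _ C(1)])
    show "elts (graph (check u) (elts T)) \<subseteq> B" unfolding g using pr_B check_B B_mem[OF T(1)] by blast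
    show "supports C (graph (check u) (elts T))"
    proof (rule supportsI[OF C(1) is_set_graph[OF check_tot Ts]])
      fix \<pi> z assume \<pi>: "\<pi> \<in> perms" "\<forall>c\<in>elts C. ap \<pi> c = c" and "z \<in> elts (graph (check u) (elts T))"
      then obtain t where t: "t \<in> elts T" "z = pr t (check u t)" unfolding g by blast
      have fix_: "act \<pi> T = T" "act \<pi> u = u" using C(2) \<pi> by (auto simp: supports_def)
      have tM: "t \<in> M" using elts_in[OF t(1)] .
      have "act \<pi> t \<in> elts T" using act_elts[OF permsD(2)[OF \<pi>(1)] T(2)] t(1) fix_(1) by auto
      moreover have "act \<pi> z = pr (act \<pi> t) (check u (act \<pi> t))"
        unfolding t(2) act_pr[OF \<pi>(1) tM check_in[OF tM]] act_check[OF \<pi>(1) fix_(2) tM] ..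
      ultimately show "act \<pi> z \<in> elts (graph (check u) (elts T))" unfolding g by blast
    qed
  qed
qed

end

context
  fixes u :: 'a
  assumes uP: "u \<in> Bm.P"
    and u_top: "\<forall>p\<in>Bm.P. Bm.le_P p u"
    and u_unique: "\<forall>v\<in>Bm.P. (\<forall>p\<in>Bm.P. Bm.le_P p v) \<longrightarrow> v = u"
begin

interpretation F: forcing B E A Bm.P Bm.le_P .

lemma top_in_B: "u \<in> B"
  using uP Bm.P_subset by blast

lemmas ck = check_tot[OF top_in_B] check_atom[OF top_in_B] check_codes[OF top_in_B] check_in[OF top_in_B]
  check_elts[OF top_in_B] check_is_set[OF top_in_B] act_check[OF top_in_B] check_B[OF top_in_B]
  graph_check_B[OF top_in_B]

text \<open>\<open>is_check\<close> refers to some weakest condition; as there is only one,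
  canonical names are unique.\<close>

lemma is_top_iff: "F.is_top v \<longleftrightarrow> v = u"
  unfolding F.is_top_def using uP u_top u_unique by blast

text \<open>Any witness in the model agrees with \<open>check u\<close> by induction on its
  transitive domain. Conversely a transitive set of the model containing \<open>x\<close> carries
  the witness \<open>graph (check u) (elts T)\<close>.\<close>

lemma is_check_iff: assumes x: "x \<in> B" shows "F.is_check x y \<longleftrightarrow> y = check u x"
proof
  assume "F.is_check x y"
  then obtain T g where T: "Bm.transitive T" "x \<in> Bm.elts T" "Bm.fn g T B" "Bm.app g x y" and
    rec: "\<And>t v. t \<in> Bm.elts T \<Longrightarrow> Bm.app g t v \<Longrightarrow> (if t \<in> Bm.elts A then v = t
         else Bm.codes v {z. \<exists>s\<in>Bm.elts t. \<exists>w. Bm.app g s w \<and> Bm.is_pair z w u})"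
    unfolding F.is_check_def is_top_iff by blast
  have TB: "T \<in> B" and tr: "transitive T" using T(1) Bm_transitive by auto
  have g: "g \<in> B" "fn g T B" using T(3) Bm_fn[OF TB] by auto
  have gM: "g \<in> M" "T \<in> M" using g(1) TB B_in by auto
  have app: "Bm.app g t v \<longleftrightarrow> t \<in> elts T \<and> v = ap g t" for t v
    unfolding Bm_app[OF g(1)] fnD(4)[OF g(2)] ..
  have "t \<in> elts T \<longrightarrow> ap g t = check u t" if "t \<in> M" for t
    using that
  proof (rule eps_induct)
    show "D (\<lambda>e. e 0 \<in> elts T \<longrightarrow> ap g (e 0) = check u (e 0))"
      by (intro Def_imp D_elts gM DT_var Def_eq tot_term[OF tot_ap[OF gM(1)]] tot_term[OF ck(1)])
    fix t assume tM: "t \<in> M" and IH: "\<And>s. s \<in> elts t \<Longrightarrow> s \<in> elts T \<longrightarrow> ap g s = check u s"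
    show "t \<in> elts T \<longrightarrow> ap g t = check u t"
    proof
      assume t: "t \<in> elts T"
      then have tB: "t \<in> B" using B_mem[OF TB] by blast
      have r: "if t \<in> elts A then ap g t = t
         else codes (ap g t) {z. \<exists>s\<in>elts t. \<exists>w. Bm.app g s w \<and> Bm.is_pair z w u}"
        using rec[of t "ap g t"] t unfolding Bm_elts[OF TB] Bm_elts[OF tB] Bm_elts[OF A_in_B] app Bm_codes
        by (simp split: if_splits)
      show "ap g t = check u t"
      proof (cases "t \<in> elts A")
        case True
        then show ?thesis using r ck(2) by simp
      next
        case False
        then have "is_set t" using tM is_set_or_atom by blast
        have "(\<exists>w. Bm.app g s w \<and> Bm.is_pair z w u) \<longleftrightarrow> z = pr (check u s) u" if "s \<in> elts t" for s z
        proof -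
          have "s \<in> elts T" using transitiveD[OF tr t that] .
          moreover have "check u s \<in> B" using ck(8) B_mem[OF tB that] by blast
          ultimately show ?thesis unfolding app Bm_is_pair using IH[OF that] top_in_B by auto
        qed
        then have "{z. \<exists>s\<in>elts t. \<exists>w. Bm.app g s w \<and> Bm.is_pair z w u} = (\<lambda>s. pr (check u s) u) ` elts t"
          by auto
        then have "codes (ap g t) ((\<lambda>s. pr (check u s) u) ` elts t)" using r False by simp
        then show ?thesis using codes_unique ck(3)[OF \<open>is_set t\<close>] by blast
      qed
    qed
  qed
  then show "y = check u x" using B_in[OF x] T(2,4) unfolding Bm_elts[OF TB] app by simp
next
  assume y: "y = check u x"
  obtain T where T: "T \<in> B" "transitive T" "x \<in> elts T" using ex_transitive_B[OF x] by blast
  have Tset: "is_set T" using T(2) by (simp add: transitive_def)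
  then have Ts: "setlike (elts T)" by simp
  let ?g = "graph (check u) (elts T)"
  have gB: "?g \<in> B" by (rule ck(9)[OF T(1) Tset])
  have app: "Bm.app ?g t v \<longleftrightarrow> t \<in> elts T \<and> v = check u t" for t v
    unfolding Bm_app[OF gB] app_graph[OF ck(1) Ts] ..
  have TB: "t \<in> B" if "t \<in> elts T" for t using B_mem[OF T(1) that] .
  have "Bm.fn ?g T B"
    unfolding Bm_fn[OF T(1)] using gB fn_graph[OF ck(1) Ts refl, of B] ck(8) TB by blast
  moreover have "if t \<in> Bm.elts A then v = t
      else Bm.codes v {z. \<exists>s\<in>Bm.elts t. \<exists>w. Bm.app ?g s w \<and> Bm.is_pair z w u}"
    if t: "t \<in> Bm.elts T" "Bm.app ?g t v" for t v
  proof (cases "t \<in> elts A")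
    case True
    then show ?thesis using t unfolding Bm_elts[OF A_in_B] app using ck(2) by simp
  next
    case False
    have tT: "t \<in> elts T" and v: "v = check u t" using t unfolding app by auto
    have "is_set t" using elts_in[OF tT] False is_set_or_atom by blast
    have "(\<exists>w. Bm.app ?g s w \<and> Bm.is_pair z w u) \<longleftrightarrow> z = pr (check u s) u" if "s \<in> elts t" for s z
      unfolding app Bm_is_pair using transitiveD[OF T(2) tT that] ck(8)[OF TB] top_in_B by auto
    then have "{z. \<exists>s\<in>elts t. \<exists>w. Bm.app ?g s w \<and> Bm.is_pair z w u} = (\<lambda>s. pr (check u s) u) ` elts t"
      by auto
    then show ?thesis
      using False ck(3)[OF \<open>is_set t\<close>] ck(8)[OF TB[OF tT]]
      unfolding Bm_elts[OF A_in_B] Bm_codes Bm_elts[OF TB[OF tT]] v by simp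
  qed
  moreover have "Bm.transitive T" "x \<in> Bm.elts T" "Bm.app ?g x y"
    unfolding Bm_transitive Bm_elts[OF T(1)] app using T y by auto
  ultimately show "F.is_check x y" unfolding F.is_check_def is_top_iff
    by (intro exI[of _ u] exI[of _ T] exI[of _ ?g]) blast
qed

section \<open>The standard name of the generic filter\<close>

definition generic_name :: 'a where
  "generic_name = St ((\<lambda>p. pr (check u p) p) ` Bm.P)"

lemma generic_name:
  shows elts_generic_name: "elts generic_name = (\<lambda>p. pr (check u p) p) ` Bm.P"
    and generic_name_set: "is_set generic_name"
    and generic_name_B: "generic_name \<in> B"
    and act_generic_name: "\<pi> \<in> perms \<Longrightarrow> act \<pi> u = u \<Longrightarrow> act \<pi> generic_name = generic_name"
proof -
  have s: "setlike ((\<lambda>p. pr (check u p) p) ` Bm.P)"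
    by (intro setlike_image setlike_P DT_pr atom_set order_refl DT_var tot_term[OF ck(1)])
  then show el: "elts generic_name = (\<lambda>p. pr (check u p) p) ` Bm.P" and set: "is_set generic_name"
    by (simp_all add: generic_name_def)
  have sub: "elts generic_name \<subseteq> B" unfolding el using pr_B ck(8) Bm.P_subset by blast
  obtain C where C: "cset C" "supports C u" using B_symmetric[OF top_in_B] by blast
  have inv: "act \<pi> z \<in> elts generic_name" if \<pi>: "\<pi> \<in> perms" "act \<pi> u = u" and z: "z \<in> elts generic_name" for \<pi> z
  proof -
    obtain p where p: "p \<in> Bm.P" "z = pr (check u p) p" using z unfolding el by blast
    have pM: "p \<in> M" using p(1) Bm.P_subset B_in by blast
    have "Def M E {A} (\<lambda>e. e 0 \<in> Bm.P)" by (intro Bm.def_P DT_var) (use atom_set in auto)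
    from act_invariant1[OF \<pi>(1) this _ _ pM] have "act \<pi> p \<in> Bm.P"
      using act_A[OF \<pi>(1)] atom_set p(1) by simp
    moreover have "act \<pi> z = pr (check u (act \<pi> p)) (act \<pi> p)"
      unfolding p(2) act_pr[OF \<pi>(1) ck(4)[OF pM] pM] ck(7)[OF \<pi> pM] ..
    ultimately show ?thesis unfolding el by blast
  qed
  have "supports C generic_name"
    by (rule supportsI[OF C(1) set]) (use inv C(2) in \<open>auto simp: supports_def\<close>)
  then show "generic_name \<in> B" using supported_in_perm_model[OF is_set_in[OF set] sub C(1)] by blast
  show "act \<pi> generic_name = generic_name" if \<pi>: "\<pi> \<in> perms" "act \<pi> u = u"
  proof -
    obtain \<rho> where \<rho>: "\<rho> \<in> perms" "\<forall>a\<in>elts A. ap \<rho> (ap \<pi> a) = a \<and> ap \<pi> (ap \<rho> a) = a"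
      using perm_inverse[OF \<pi>(1)] by blast
    have \<rho>u: "act \<rho> u = u" using act_inverse[OF \<pi>(1) \<rho>(1) _ B_in[OF top_in_B]] \<rho>(2) \<pi>(2) by simp
    have "act \<pi> ` elts generic_name = elts generic_name"
    proof
      show "act \<pi> ` elts generic_name \<subseteq> elts generic_name" using inv[OF \<pi>] by blast
      show "elts generic_name \<subseteq> act \<pi> ` elts generic_name"
      proof
        fix z assume z: "z \<in> elts generic_name"
        have "z = act \<pi> (act \<rho> z)" using act_inverse[OF \<rho>(1) \<pi>(1), of z] \<rho>(2) elts_in[OF z] by simp
        then show "z \<in> act \<pi> ` elts generic_name" using inv[OF \<rho>(1) \<rho>u z] by blast
      qed
    qed
    then have "codes (act \<pi> generic_name) (elts generic_name)"
      using act_set[OF permsD(2)[OF \<pi>(1)] set] by simp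
    then show ?thesis using St_eq St_elts[OF set] by metis
  qed
qed

lemma names:
  assumes x: "x \<in> B" shows "F.is_name (check u x)" "F.is_name generic_name"
proof -
  \<comment> \<open>One transitive set for both claims: it contains \<open>x\<close> and every
    condition. The canonical names of its elements, together with \<open>generic_name\<close>,
    contain every name occurring in one of them.\<close>
  obtain T where T: "T \<in> B" "transitive T" "St {x, St Bm.P} \<in> elts T"
    using ex_transitive_B[OF doubleton_B[OF x P_in_B]] by blast
  have Tset: "is_set T" using T(2) by (simp add: transitive_def)
  have xM: "x \<in> M" "St Bm.P \<in> M" using x P_in_B B_in by auto
  have "St Bm.P \<in> elts T" and xT: "x \<in> elts T"
    using transitiveD[OF T(2,3)] xM by simp_all
  then have PT: "p \<in> elts T" if "p \<in> Bm.P" for p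
    using transitiveD[OF T(2), of "St Bm.P" p] that setlike_P by simp
  let ?N = "insert generic_name (check u ` elts T)"
  have Ts: "setlike (check u ` elts T)" using T(1) Tset by (intro setlike_tot_image ck(1)) simp
  have N: "setlike ?N" using Ts is_set_in[OF generic_name_set] by simp
  have ckT: "check u t \<in> B" if "t \<in> elts T" for t using ck(8) B_mem[OF T(1) that] by blast
  have NB: "St ?N \<in> B"
  proof -
    obtain C where C: "cset C" "\<forall>c\<in>{T, u}. supports C c"
      using common_support[of "{T, u}"] T(1) top_in_B by blast
    show ?thesis
    proof (rule supported_in_perm_model[OF St_in[OF N] _ C(1)])
      show "elts (St ?N) \<subseteq> B" unfolding elts_St[OF N] using generic_name_B ckT by blast
      show "supports C (St ?N)"
      proof (rule supportsI[OF C(1) is_set_St[OF N]]; unfold elts_St[OF N])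
        fix \<pi> z assume \<pi>: "\<pi> \<in> perms" "\<forall>c\<in>elts C. ap \<pi> c = c" and z: "z \<in> ?N"
        have fix_: "act \<pi> T = T" "act \<pi> u = u" using C(2) \<pi> by (auto simp: supports_def)
        from z show "act \<pi> z \<in> ?N"
        proof
          assume "z = generic_name"
          then show ?thesis using act_generic_name[OF \<pi>(1) fix_(2)] by simp
        next
          assume "z \<in> check u ` elts T"
          then obtain t where t: "t \<in> elts T" "z = check u t" by blast
          have "act \<pi> t \<in> elts T" using act_elts[OF permsD(2)[OF \<pi>(1)] Tset] t(1) fix_(1) by auto
          then show ?thesis unfolding t(2) ck(7)[OF \<pi>(1) fix_(2) elts_in[OF t(1)]] by blast
        qed
      qed
    qed
  qed
  have "\<sigma> \<in> Bm.elts A \<or> (\<forall>z\<in>Bm.elts \<sigma>. \<exists>\<rho>\<in>?N. \<exists>p\<in>Bm.P. Bm.is_pair z \<rho> p)" if "\<sigma> \<in> ?N" for \<sigma>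
    using that
  proof
    assume \<sigma>: "\<sigma> = generic_name"
    have "\<exists>\<rho>\<in>?N. \<exists>p\<in>Bm.P. Bm.is_pair z \<rho> p" if z: "z \<in> elts generic_name" for z
    proof -
      obtain p where p: "p \<in> Bm.P" "z = pr (check u p) p" using z unfolding elts_generic_name by blast
      have "p \<in> B" using p(1) Bm.P_subset by blast
      then have "Bm.is_pair z (check u p) p" unfolding Bm_is_pair using ck(8) p(2) by simp
      moreover have "check u p \<in> ?N" using PT[OF p(1)] by blast
      ultimately show ?thesis using p(1) by blast
    qed
    then show ?thesis unfolding \<sigma> Bm_elts[OF generic_name_B] by blast
  next
    assume "\<sigma> \<in> check u ` elts T"
    then obtain t where t: "t \<in> elts T" "\<sigma> = check u t" by blast
    show ?thesis
    proof (cases "t \<in> elts A")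
      case True
      then show ?thesis using t(2) ck(2) Bm_elts[OF A_in_B] by simp
    next
      case False
      then have s: "is_set t" using elts_in[OF t(1)] is_set_or_atom by blast
      have "\<exists>\<rho>\<in>?N. \<exists>p\<in>Bm.P. Bm.is_pair z \<rho> p" if z: "z \<in> elts \<sigma>" for z
      proof -
        obtain s where s: "s \<in> elts t" "z = pr (check u s) u" using z unfolding t(2) ck(5)[OF s] by blast
        have sT: "s \<in> elts T" using transitiveD[OF T(2) t(1) s(1)] .
        have "Bm.is_pair z (check u s) u" unfolding Bm_is_pair using ckT[OF sT] top_in_B s(2) by simp
        then show ?thesis using sT uP by blast
      qed
      then show ?thesis using Bm_elts[OF ckT[OF t(1)]] t(2) by simp
    qed
  qed
  then have name: "F.is_name \<tau>" if "\<tau> \<in> ?N" for \<tau>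
    unfolding F.is_name_def using that NB N
    by (intro exI[of _ "St ?N"]) (simp add: Bm_is_set Bm_elts[OF NB])
  show "F.is_name (check u x)" "F.is_name generic_name" using name xT by blast+
qed

end

section \<open>The generic extension\<close>

lemma generic_atoms_separated:
  fixes N :: "'w set" and EN :: "'w \<Rightarrow> 'w \<Rightarrow> bool" and AN :: 'w and val :: "'a \<Rightarrow> 'w"
  assumes unc: "\<not> is_countable A"
    and gen: "forcing.generic B E A Bm.P Bm.le_P G"
    and ext: "forcing.generic_extension B E A Bm.P G N EN AN val"
  shows "\<exists>g. forcing.is_generic_object B E A Bm.P Bm.le_P G N EN AN val g \<and>
    (\<forall>a b. a \<in> membership.elts N EN AN \<and> b \<in> membership.elts N EN AN \<and> a \<noteq> b \<longrightarrow>
      (\<exists>f\<in>membership.elts N EN g. \<exists>n\<in>membership.\<omega> N EN AN.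
        (\<exists>h z. membership.app N EN AN f a h \<and> membership.app N EN AN h n z \<and>
               membership.is_zero N EN AN z) \<and>
        (\<exists>h z. membership.app N EN AN f b h \<and> membership.app N EN AN h n z \<and>
               membership.is_one N EN AN z)))"
proof -
  interpret F: forcing B E A Bm.P Bm.le_P .
  interpret Nm: membership N EN AN .
  obtain u where u: "u \<in> Bm.P" "\<forall>p\<in>Bm.P. Bm.le_P p u"
    "\<forall>v\<in>Bm.P. (\<forall>p\<in>Bm.P. Bm.le_P p v) \<longrightarrow> v = u"
    using top_condition[OF unc] by blast
  note uB = top_in_B[OF u]
  note names = names[OF u] and gname = elts_generic_name[OF u] generic_name_set[OF u] generic_name_B[OF u]
  note is_check = is_check_iff[OF u]
  note ck_atom = check_atom[OF uB] and ck_elts = check_elts[OF uB] and ck_set = check_is_set[OF uB]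
    and ck_B = check_B[OF uB]
  have G: "G \<subseteq> Bm.P" "G \<noteq> {}" "\<And>p q. p \<in> G \<Longrightarrow> q \<in> Bm.P \<Longrightarrow> Bm.le_P p q \<Longrightarrow> q \<in> G"
    "\<And>D. F.dense D \<Longrightarrow> G \<inter> Bm.elts D \<noteq> {}"
    using gen unfolding F.generic_def F.is_filter_def by blast+
  \<comment> \<open>Hence every pair in a canonical name contributes to its value.\<close>
  have uG: "u \<in> G" using G(1,2,3) u(1,2) by blast
  have N: "N = val ` {\<tau>. F.is_name \<tau>}" "\<And>a. a \<in> Bm.elts A \<Longrightarrow> val a \<in> Nm.elts AN \<and> Nm.elts (val a) = {}"
    "\<And>\<tau>. F.is_name \<tau> \<Longrightarrow> Bm.is_set \<tau> \<Longrightarrow>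
      Nm.codes (val \<tau>) {val \<sigma> | \<sigma> z p. z \<in> Bm.elts \<tau> \<and> Bm.is_pair z \<sigma> p \<and> p \<in> G}"
    using ext unfolding F.generic_extension_def by blast+
  \<comment> \<open>The canonical embedding. Injectivity of \<open>val\<close> is given on the atoms
    only, so facts are transported in one direction, from the ground model to the extension; their
    source is \<open>j_codes\<close>.\<close>
  define j where "j x = val (check u x)" for x
  have j_in: "j x \<in> N" if "x \<in> B" for x unfolding j_def N(1) using names(1)[OF that] by blast
  have j_atom: "j a = val a" if "a \<in> elts A" for a unfolding j_def ck_atom[OF that] ..
  have j_codes: "Nm.codes (j x) (j ` elts x)" if x: "x \<in> B" "is_set x" for x
  proof -
    note xB = ck_B[OF x(1)]
    have "{val \<sigma> | \<sigma> z p. z \<in> Bm.elts (check u x) \<and> Bm.is_pair z \<sigma> p \<and> p \<in> G} = j ` elts x" (is "?L = _")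
    proof
      show "?L \<subseteq> j ` elts x"
      proof
        fix v assume "v \<in> ?L"
        then obtain \<sigma> z p where v: "v = val \<sigma>" "z \<in> Bm.elts (check u x)" "Bm.is_pair z \<sigma> p" by blast
        then obtain s where s: "s \<in> elts x" "z = pr (check u s) u"
          unfolding Bm_elts[OF xB] ck_elts[OF x(2)] by blast
        have "check u s \<in> B" using ck_B B_mem[OF x(1) s(1)] by blast
        then have "\<sigma> = check u s" using v(3) s(2) uB B_in unfolding Bm_is_pair by auto
        then show "v \<in> j ` elts x" unfolding v(1) j_def using s(1) by blast
      qed
      show "j ` elts x \<subseteq> ?L"
      proof
        fix v assume "v \<in> j ` elts x"
        then obtain s where s: "s \<in> elts x" "v = val (check u s)" unfolding j_def by blast
        have "pr (check u s) u \<in> Bm.elts (check u x)" unfolding Bm_elts[OF xB] ck_elts[OF x(2)] using s(1) by blast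
        moreover have "Bm.is_pair (pr (check u s) u) (check u s) u"
          unfolding Bm_is_pair using ck_B[OF B_mem[OF x(1) s(1)]] uB by blast
        ultimately show "v \<in> ?L" using s(2) uG by blast
      qed
    qed
    moreover have "Bm.is_set (check u x)" unfolding Bm_is_set using xB ck_set[OF x(2)] by blast
    ultimately show ?thesis using N(3)[OF names(1)[OF x(1)]] unfolding j_def by simp
  qed
  have j_is_set: "Nm.is_set (j x)" if "x \<in> B" "is_set x" for x
    using j_codes[OF that] unfolding Nm.codes_def by blast
  have j_elts: "Nm.elts (j x) = j ` elts x" if x: "x \<in> B" for x
  proof (cases "x \<in> elts A")
    case True
    then show ?thesis using j_atom[OF True] N(2)[of x] Bm_elts[OF A_in_B] atoms_empty[OF True] by simp
  next
    case False
    then show ?thesis using j_codes[OF x] is_set_or_atom[OF B_in[OF x]] by (simp add: Nm.codes_def)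
  qed
  have j_St: "Nm.codes (j (St X)) (j ` X)" if "St X \<in> B" "setlike X" for X
    using j_codes[OF that(1) is_set_St[OF that(2)]] that(2) by simp
  have j_pair: "Nm.is_pair (j (pr x y)) (j x) (j y)" if xy: "x \<in> B" "y \<in> B" for x y
  proof -
    have M: "x \<in> M" "y \<in> M" using xy B_in by auto
    have single: "St {x} \<in> B" using doubleton_B[OF xy(1) xy(1)] by simp
    have "Nm.codes (j (St {x})) {j x}" using j_St[OF single] M by simp
    moreover have "Nm.codes (j (St {x, y})) {j x, j y}" using j_St[OF doubleton_B[OF xy]] M by simp
    moreover have "Nm.codes (j (pr x y)) {j (St {x}), j (St {x, y})}"
      unfolding pr_def using j_St[OF doubleton_B[OF single doubleton_B[OF xy]]] M by simp
    ultimately show ?thesis unfolding Nm.is_pair_def using j_in xy by blast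
  qed
  have j_app: "Nm.app (j f) (j x) (j y)" if f: "f \<in> B" "app f x y" for f x y
  proof -
    have xy: "x \<in> B" "y \<in> B" using app_B[OF f] by auto
    have "pr x y \<in> elts f" using f(2) unfolding app_iff by blast
    then have "j (pr x y) \<in> Nm.elts (j f)" unfolding j_elts[OF f(1)] by blast
    then show ?thesis unfolding Nm.app_def using j_pair[OF xy] by blast
  qed
  have zB: "zero \<in> B" using omega_B zero_omega by blast
  have j_zero: "Nm.is_zero (j zero)" unfolding Nm.is_zero_def using j_codes[OF zB is_set_zero] by simp
  have j_sc: "Nm.is_succ (j (sc x)) (j x)" if x: "x \<in> B" for x
  proof -
    have "Nm.codes (j (sc x)) (j ` elts (sc x))" by (rule j_codes[OF sc_B[OF x]]) (use B_in[OF x] in simp)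
    then show ?thesis unfolding Nm.is_succ_def j_elts[OF x] using j_in[OF x] B_in[OF x] by simp
  qed
  have j_one: "Nm.is_one (j one)" unfolding Nm.is_one_def one_def using j_zero j_sc[OF zB] by blast
  \<comment> \<open>The clauses defining a number concern its elements, zero and successors, all of
    which \<open>j\<close> carries along. Since the elements of \<open>j n\<close> are images of
    numbers, no other number of the extension comes into play.\<close>
  have j_omega: "j n \<in> Nm.\<omega>" if n: "n \<in> \<omega>" for n
  proof -
    have trans_: "Nm.transitive (j m)" if m: "m \<in> \<omega>" for m
      unfolding Nm.transitive_def
    proof (intro conjI ballI)
      show "Nm.is_set (j m)" by (rule j_is_set[OF omega_B[OF m] omegaD(1)[OF m]])
      fix y assume "y \<in> Nm.elts (j m)"
      then obtain k where k: "k \<in> elts m" "y = j k" unfolding j_elts[OF omega_B[OF m]] by blast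
      have "k \<in> B" using omega_B[OF omega_mem[OF m k(1)]] .
      then show "Nm.elts y \<subseteq> Nm.elts (j m)"
        unfolding k(2) j_elts[OF \<open>k \<in> B\<close>] j_elts[OF omega_B[OF m]] using omegaD(2)[OF m k(1)] by blast
    qed
    have elts_n: "Nm.elts (j n) = j ` elts n" by (rule j_elts[OF omega_B[OF n]])
    have "Nm.is_ord (j n)"
      unfolding Nm.is_ord_def elts_n using trans_[OF n] trans_[OF omega_mem[OF n]] by blast
    moreover have "Nm.is_zero m \<or> (\<exists>k. Nm.is_succ m k)" if m: "m \<in> insert (j n) (Nm.elts (j n))" for m
    proof -
      obtain k where k: "k \<in> insert n (elts n)" "m = j k" using m unfolding elts_n by blast
      have "k \<in> \<omega>" using k(1) n omega_mem by blast
      from omega_cases[OF this] show ?thesis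
      proof
        assume "k = zero"
        then show ?thesis using j_zero k(2) by simp
      next
        assume "\<exists>l\<in>\<omega>. k = sc l"
        then obtain l where "l \<in> \<omega>" "k = sc l" by blast
        then show ?thesis using j_sc[OF omega_B] k(2) by blast
      qed
    qed
    ultimately show ?thesis unfolding Nm.\<omega>_def by blast
  qed
  let ?g = "val (generic_name u)"
  have PB: "p \<in> B" if "p \<in> Bm.P" for p using that Bm.P_subset by blast
  have g_codes: "Nm.codes ?g (j ` G)"
  proof -
    have pair: "Bm.is_pair (pr (check u p) p) \<sigma> q \<longleftrightarrow> \<sigma> = check u p \<and> q = p" if "p \<in> Bm.P" for p \<sigma> q
      unfolding Bm_is_pair using ck_B[OF PB[OF that]] PB[OF that] B_in by auto
    have "{val \<sigma> | \<sigma> z p. z \<in> Bm.elts (generic_name u) \<and> Bm.is_pair z \<sigma> p \<and> p \<in> G} = j ` G" (is "?L = _")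
    proof
      show "?L \<subseteq> j ` G"
      proof
        fix v assume "v \<in> ?L"
        then obtain \<sigma> z p where v: "v = val \<sigma>" "z \<in> elts (generic_name u)" "Bm.is_pair z \<sigma> p" "p \<in> G"
          unfolding Bm_elts[OF gname(3)] by blast
        then obtain q where q: "q \<in> Bm.P" "z = pr (check u q) q" unfolding gname(1) by blast
        have "\<sigma> = check u p" using v(3) pair[OF q(1)] unfolding q(2) by simp
        then show "v \<in> j ` G" unfolding v(1) j_def using v(4) by blast
      qed
      show "j ` G \<subseteq> ?L"
      proof
        fix v assume "v \<in> j ` G"
        then obtain p where p: "p \<in> G" "v = val (check u p)" unfolding j_def by blast
        then have "p \<in> Bm.P" using G(1) by blast
        then have "pr (check u p) p \<in> Bm.elts (generic_name u)" unfolding Bm_elts[OF gname(3)] gname(1) by blast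
        moreover have "Bm.is_pair (pr (check u p) p) (check u p) p" using pair[OF \<open>p \<in> Bm.P\<close>] by blast
        ultimately show "v \<in> ?L" using p by blast
      qed
    qed
    moreover have "Bm.is_set (generic_name u)" unfolding Bm_is_set using gname(2,3) by blast
    ultimately show ?thesis using N(3)[OF names(2)[OF A_in_B]] by simp
  qed
  have chk: "F.is_check p y \<longleftrightarrow> y = check u p" if p: "p \<in> G" for p y
    by (rule is_check[OF PB[OF subsetD[OF G(1) p]]])
  have "{val y | p y. p \<in> G \<and> F.is_check p y} = {val y | p y. p \<in> G \<and> y = check u p}"
    using chk by (metis (no_types, lifting))
  also have "\<dots> = j ` G" unfolding j_def by blast
  finally have obj: "F.is_generic_object G N EN AN val ?g"
    unfolding F.is_generic_object_def using g_codes by simp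
  \<comment> \<open>A name that is a set has a set as its value, so an atom of the extension can
    only be the value of an atom.\<close>
  have atomsN: "\<exists>a0\<in>elts A. a = j a0" if a: "a \<in> Nm.elts AN" for a
  proof -
    have "a \<in> N" using a unfolding Nm.elts_def by blast
    then obtain \<tau> where \<tau>: "F.is_name \<tau>" "a = val \<tau>" unfolding N(1) by blast
    then have "\<tau> \<in> B" unfolding F.is_name_def Bm.elts_def by blast
    have "\<not> Bm.is_set \<tau>"
    proof
      assume "Bm.is_set \<tau>"
      then have "Nm.is_set a" using N(3)[OF \<tau>(1)] \<tau>(2) unfolding Nm.codes_def by blast
      then show False using a unfolding Nm.is_set_def by blast
    qed
    then have "\<tau> \<in> elts A" using is_set_or_atom[OF B_in[OF \<open>\<tau> \<in> B\<close>]] \<open>\<tau> \<in> B\<close> unfolding Bm_is_set by blast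
    then show ?thesis using j_atom[of \<tau>] \<tau>(2) by (intro bexI[of _ \<tau>]) simp_all
  qed
  have "\<exists>f\<in>Nm.elts ?g. \<exists>n\<in>Nm.\<omega>. (\<exists>h z. Nm.app f a h \<and> Nm.app h n z \<and> Nm.is_zero z) \<and>
      (\<exists>h z. Nm.app f b h \<and> Nm.app h n z \<and> Nm.is_one z)"
    if ab: "a \<in> Nm.elts AN" "b \<in> Nm.elts AN" "a \<noteq> b" for a b
  proof -
    obtain a0 b0 where a0: "a0 \<in> elts A" "a = j a0" "b0 \<in> elts A" "b = j b0" using atomsN ab(1,2) by blast
    then have "a0 \<noteq> b0" using ab(3) by blast
    note d = separating_dense[OF a0(1,3) this]
    have "Bm.elts (St (separating a0 b0)) = separating a0 b0" using Bm_elts[OF d(3)] d(2) by simp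
    then obtain q where q: "q \<in> G" "q \<in> separating a0 b0" using G(4)[OF d(1)] by blast
    then obtain n where n: "n \<in> \<omega>" "app (ap q a0) n zero" "app (ap q b0) n one" and qP: "q \<in> Bm.P"
      unfolding separating_def by blast
    obtain m where m: "m \<in> \<omega>" "q \<in> Bm.P_level m" using qP Bm_P_iff by blast
    note qf = P_fn[OF m(2,1)]
    have app: "app q a0 (ap q a0)" "app q b0 (ap q b0)" using fnD(5)[OF qf(2)] a0(1,3) by auto
    have B: "ap q a0 \<in> B" "ap q b0 \<in> B" using app_B[OF qf(1)] app by blast+
    have "j q \<in> Nm.elts ?g" using g_codes q(1) unfolding Nm.codes_def by blast
    moreover have "Nm.app (j q) a (j (ap q a0))" "Nm.app (j q) b (j (ap q b0))"
      unfolding a0(2,4) using j_app[OF qf(1)] app by blast+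
    moreover have "Nm.app (j (ap q a0)) (j n) (j zero)" "Nm.app (j (ap q b0)) (j n) (j one)"
      using j_app[OF B(1) n(2)] j_app[OF B(2) n(3)] by blast+
    ultimately show ?thesis using j_omega[OF n(1)] j_zero j_one by blast
  qed
  then show ?thesis using obj by blast
qed

end

theorem theorem5p27:
  fixes V B \<P> G :: "'v set" and E le :: "'v \<Rightarrow> 'v \<Rightarrow> bool" and A :: 'v
    and N :: "'w set" and EN :: "'w \<Rightarrow> 'w \<Rightarrow> bool" and AN :: 'w and val :: "'v \<Rightarrow> 'w"
  assumes "zfa_choice V E A"
    and "\<not> membership.is_countable V E A A"
    and "B = membership.perm_model V E A"
    and "\<P> = membership.P B E A"
    and "le = membership.le_P B E A"
    and "forcing.generic B E A \<P> le G"
    and "forcing.generic_extension B E A \<P> G N EN AN val"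
  shows "\<exists>g. forcing.is_generic_object B E A \<P> le G N EN AN val g \<and>
    (\<forall>a b. a \<in> membership.elts N EN AN \<and> b \<in> membership.elts N EN AN \<and> a \<noteq> b \<longrightarrow>
      (\<exists>f\<in>membership.elts N EN g. \<exists>n\<in>membership.\<omega> N EN AN.
        (\<exists>h z. membership.app N EN AN f a h \<and> membership.app N EN AN h n z \<and>
               membership.is_zero N EN AN z) \<and>
        (\<exists>h z. membership.app N EN AN f b h \<and> membership.app N EN AN h n z \<and>
               membership.is_one N EN AN z)))"
  unfolding assms(3-5)
  by (rule zfa_choice.generic_atoms_separated[OF assms(1,2) assms(6,7)[unfolded assms(3-5)]])

end
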